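(* Let $k$ be a field, let $G$ be a finite group of order $n$ and let $\mathcal{B}$ be a $G$-graded $k$-category. Then the $k$-categories $(\mathcal{B}\# k^G)\# kG$ and $M_n(\mathcal{B})$ are isomorphic.
   Context: A $k$-category is a category whose objects form a set, whose morphism sets ${}_y\mathcal{B}_x$ (from $x$ to $y$) are $k$-vector spaces, and whose composition is $k$-bilinear. Functors and isomorphisms between $k$-categories are understood to be $k$-linear. A $G$-grading of $\mathcal{B}$ is a decomposition ${}_y\mathcal{B}_x=\bigoplus_{s\in G}{}_y\mathcal{B}_x^{s}$ of each morphism space such that ${}_z\mathcal{B}_y^{t}\,{}_y\mathcal{B}_x^{s}\subseteq{}_z\mathcal{B}_x^{ts}$. If $H$ is a Hopf algebra and $\mathcal{D}$ is an $H$-module category (each morphism space is an $H$-module, composition maps are $H$-module maps for the diagonal action, and $h\,1_x=\epsilon(h)1_x$ for each object $x$), then the smash category $\mathcal{D}\# H$ has the same objects as $\mathcal{D}$, morphisms ${}_y(\mathcal{D}\# H)_x={}_y\mathcal{D}_x\otimes_k H$, and composition $(\varphi\otimes h)(\psi\otimes h')=\sum\varphi\,(h_1\psi)\otimes h_2h'$. The $G$-graded category $\mathcal{B}$ is a $k^G$-module category, where $k^G=(kG)^*$ is the Hopf algebra of functions on $G$ with basis $(\delta_s)_{s\in G}$ dual to $G$, and $\delta_s$ acts as projection onto the degree $s$ component; this defines $\mathcal{B}\# k^G$. In turn $\mathcal{B}\# k^G$ is a $kG$-module category via $t(f\otimes\delta_s)=f\otimes\delta_{st^{-1}}$ for $s,t\in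 G$; this defines $(\mathcal{B}\# k^G)\# kG$. The matrix category $M_n(\mathcal{B})$ has the same objects as $\mathcal{B}$; the morphisms from $x$ to $y$ are the $n\times n$ matrices with entries in ${}_y\mathcal{B}_x$, and composition is the matrix product combined with the composition of $\mathcal{B}$. *)

theory Defs
  imports
    "HOL-Algebra.Module"
    "HOL-Algebra.AbelCoset"
begin

section \<open>Linear and bilinear maps\<close>

definition linear_map ::
  "('k, 'r) ring_scheme \<Rightarrow> ('k, 'v, 'x) module_scheme \<Rightarrow> ('k, 'w, 'y) module_scheme \<Rightarrow> ('v \<Rightarrow> 'w) \<Rightarrow> bool"
  where "linear_map K V W f \<longleftrightarrow>
    f \<in> carrier V \<rightarrow> carrier W \<and>
    (\<forall>u\<in>carrier V. \<forall>v\<in>carrier V. f (u \<oplus>\<^bsub>V\<^esub> v) = f u \<oplus>\<^bsub>W\<^esub> f v) \<and>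
    (\<forall>a\<in>carrier K. \<forall>v\<in>carrier V. f (a \<odot>\<^bsub>V\<^esub> v) = a \<odot>\<^bsub>W\<^esub> f v)"

definition bilinear_map ::
  "('k, 'r) ring_scheme \<Rightarrow> ('k, 'u, 'x) module_scheme \<Rightarrow> ('k, 'v, 'y) module_scheme \<Rightarrow>
    ('k, 'w, 'z) module_scheme \<Rightarrow> ('u \<Rightarrow> 'v \<Rightarrow> 'w) \<Rightarrow> bool"
  where "bilinear_map K U V W b \<longleftrightarrow>
    (\<forall>u\<in>carrier U. linear_map K V W (b u)) \<and>
    (\<forall>v\<in>carrier V. linear_map K U W (\<lambda>u. b u v))"


section \<open>Tensor products\<close>

text \<open>
  The tensor product is the free module on the pairs, modulo the submodule generated by the
  bilinearity relations. The ring fields \<open>mult\<close> and \<open>one\<close> of a \<open>module\<close> record play no role for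
  the library's locale \<open>module\<close>; they are left \<open>undefined\<close> for spaces that are not algebras.
\<close>

definition free_module :: "('k, 'r) ring_scheme \<Rightarrow> 'a set \<Rightarrow> ('k, 'a \<Rightarrow> 'k) module"
  where "free_module K X = \<lparr>
    carrier = {u. range u \<subseteq> carrier K \<and> finite {p. u p \<noteq> \<zero>\<^bsub>K\<^esub>} \<and> {p. u p \<noteq> \<zero>\<^bsub>K\<^esub>} \<subseteq> X},
    mult = undefined,
    one = undefined,
    zero = (\<lambda>p. \<zero>\<^bsub>K\<^esub>),
    add = (\<lambda>u v p. u p \<oplus>\<^bsub>K\<^esub> v p),
    smult = (\<lambda>a u p. a \<otimes>\<^bsub>K\<^esub> u p)\<rparr>"

definition single :: "('k, 'r) ring_scheme \<Rightarrow> 'a \<Rightarrow> 'a \<Rightarrow> 'k"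
  where "single K q = (\<lambda>p. if p = q then \<one>\<^bsub>K\<^esub> else \<zero>\<^bsub>K\<^esub>)"

definition quotient_module ::
  "('k, 'r) ring_scheme \<Rightarrow> ('k, 'v, 'x) module_scheme \<Rightarrow> 'v set \<Rightarrow> ('k, 'v set) module"
  where "quotient_module K V N = \<lparr>
    carrier = a_rcosets\<^bsub>V\<^esub> N,
    mult = undefined,
    one = undefined,
    zero = N,
    add = (\<lambda>S T. S <+>\<^bsub>V\<^esub> T),
    smult = (\<lambda>a S. \<Union>u\<in>S. N +>\<^bsub>V\<^esub> (a \<odot>\<^bsub>V\<^esub> u))\<rparr>"

definition tensor_generators ::
  "('k, 'r) ring_scheme \<Rightarrow> ('k, 'v, 'x) module_scheme \<Rightarrow> ('k, 'w, 'y) module_scheme \<Rightarrow> ('v \<times> 'w \<Rightarrow> 'k) set"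
  where "tensor_generators K V W =
    (let F = free_module K (carrier V \<times> carrier W); e = (\<lambda>v w. single K (v, w)) in
      {e (v \<oplus>\<^bsub>V\<^esub> v') w \<ominus>\<^bsub>F\<^esub> (e v w \<oplus>\<^bsub>F\<^esub> e v' w) | v v' w.
          v \<in> carrier V \<and> v' \<in> carrier V \<and> w \<in> carrier W} \<union>
      {e v (w \<oplus>\<^bsub>W\<^esub> w') \<ominus>\<^bsub>F\<^esub> (e v w \<oplus>\<^bsub>F\<^esub> e v w') | v w w'.
          v \<in> carrier V \<and> w \<in> carrier W \<and> w' \<in> carrier W} \<union>
      {e (a \<odot>\<^bsub>V\<^esub> v) w \<ominus>\<^bsub>F\<^esub> a \<odot>\<^bsub>F\<^esub> e v w | a v w.
          a \<in> carrier K \<and> v \<in> carrier V \<and> w \<in> carrier W} \<union>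
      {e v (a \<odot>\<^bsub>W\<^esub> w) \<ominus>\<^bsub>F\<^esub> a \<odot>\<^bsub>F\<^esub> e v w | a v w.
          a \<in> carrier K \<and> v \<in> carrier V \<and> w \<in> carrier W})"

definition tensor_relations ::
  "('k, 'r) ring_scheme \<Rightarrow> ('k, 'v, 'x) module_scheme \<Rightarrow> ('k, 'w, 'y) module_scheme \<Rightarrow> ('v \<times> 'w \<Rightarrow> 'k) set"
  where "tensor_relations K V W =
    \<Inter>{N. submodule N K (free_module K (carrier V \<times> carrier W)) \<and> tensor_generators K V W \<subseteq> N}"

definition tensor_product ::
  "('k, 'r) ring_scheme \<Rightarrow> ('k, 'v, 'x) module_scheme \<Rightarrow> ('k, 'w, 'y) module_scheme \<Rightarrow>
    ('k, ('v \<times> 'w \<Rightarrow> 'k) set) module"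
  where "tensor_product K V W =
    quotient_module K (free_module K (carrier V \<times> carrier W)) (tensor_relations K V W)"

definition pure_tensor ::
  "('k, 'r) ring_scheme \<Rightarrow> ('k, 'v, 'x) module_scheme \<Rightarrow> ('k, 'w, 'y) module_scheme \<Rightarrow>
    'v \<Rightarrow> 'w \<Rightarrow> ('v \<times> 'w \<Rightarrow> 'k) set"
  where "pure_tensor K V W v w =
    tensor_relations K V W +>\<^bsub>free_module K (carrier V \<times> carrier W)\<^esub> single K (v, w)"

text \<open>
  \<open>tensor_lift K P b\<close> sends a tensor \<open>\<Sum> v \<otimes> w\<close> to \<open>\<Sum> b v w \<in> P\<close>. For bilinear \<open>b\<close> this does not
  depend on the chosen representative, and it is the linear map given by the universal property.
\<close>

definition tensor_lift ::
  "('k, 'r) ring_scheme \<Rightarrow> ('k, 'p, 'z) module_scheme \<Rightarrow> ('v \<Rightarrow> 'w \<Rightarrow> 'p) \<Rightarrow> ('v \<times> 'w \<Rightarrow> 'k) set \<Rightarrow> 'p"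
  where "tensor_lift K P b t =
    (let u = (SOME u. u \<in> t) in
      finsum P (\<lambda>p. u p \<odot>\<^bsub>P\<^esub> b (fst p) (snd p)) {p. u p \<noteq> \<zero>\<^bsub>K\<^esub>})"


section \<open>Hopf algebras\<close>

record ('k, 'h) hopf = "('k, 'h) module" +
  comult :: "'h \<Rightarrow> ('h \<times> 'h \<Rightarrow> 'k) set"
  counit :: "'h \<Rightarrow> 'k"
  antipode :: "'h \<Rightarrow> 'h"

text \<open>The library's locale \<open>algebra\<close> is for commutative algebras only.\<close>

locale assoc_algebra = field K + module K A + ring A
  for K (structure) and A (structure) +
  assumes mult_bilinear: "bilinear_map K A A A (\<lambda>x y. x \<otimes>\<^bsub>A\<^esub> y)"

text \<open>
  Sweedler sums \<open>\<Sum> b h\<^sub>1 h\<^sub>2\<close> are written \<open>tensor_lift K P b (comult H h)\<close>. Coassociativity is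
  stated in \<open>H \<otimes> (H \<otimes> H)\<close>.
\<close>

locale hopf_algebra = assoc_algebra K H
  for K (structure) and H :: "('k, 'h, 'z) hopf_scheme" (structure) +
  assumes comult_linear: "linear_map K H (tensor_product K H H) (comult H)"
    and counit_linear: "h \<in> carrier H \<Longrightarrow> counit H h \<in> carrier K"
      "\<lbrakk>h \<in> carrier H; h' \<in> carrier H\<rbrakk> \<Longrightarrow> counit H (h \<oplus>\<^bsub>H\<^esub> h') = counit H h \<oplus>\<^bsub>K\<^esub> counit H h'"
      "\<lbrakk>a \<in> carrier K; h \<in> carrier H\<rbrakk> \<Longrightarrow> counit H (a \<odot>\<^bsub>H\<^esub> h) = a \<otimes>\<^bsub>K\<^esub> counit H h"
    and coassoc: "h \<in> carrier H \<Longrightarrow>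
      tensor_lift K (tensor_product K H (tensor_product K H H))
        (\<lambda>x y. tensor_lift K (tensor_product K H (tensor_product K H H))
          (\<lambda>x\<^sub>1 x\<^sub>2. pure_tensor K H (tensor_product K H H) x\<^sub>1 (pure_tensor K H H x\<^sub>2 y)) (comult H x))
        (comult H h) =
      tensor_lift K (tensor_product K H (tensor_product K H H))
        (\<lambda>x y. pure_tensor K H (tensor_product K H H) x (comult H y)) (comult H h)"
    and counit_left: "h \<in> carrier H \<Longrightarrow>
      tensor_lift K H (\<lambda>x y. counit H x \<odot>\<^bsub>H\<^esub> y) (comult H h) = h"
    and counit_right: "h \<in> carrier H \<Longrightarrow>
      tensor_lift K H (\<lambda>x y. counit H y \<odot>\<^bsub>H\<^esub> x) (comult H h) = h"
    and comult_one: "comult H \<one>\<^bsub>H\<^esub> = pure_tensor K H H \<one>\<^bsub>H\<^esub> \<one>\<^bsub>H\<^esub>"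
    and comult_mult: "\<lbrakk>h \<in> carrier H; h' \<in> carrier H\<rbrakk> \<Longrightarrow>
      comult H (h \<otimes>\<^bsub>H\<^esub> h') =
      tensor_lift K (tensor_product K H H)
        (\<lambda>x y. tensor_lift K (tensor_product K H H)
          (\<lambda>x' y'. pure_tensor K H H (x \<otimes>\<^bsub>H\<^esub> x') (y \<otimes>\<^bsub>H\<^esub> y')) (comult H h'))
        (comult H h)"
    and counit_one: "counit H \<one>\<^bsub>H\<^esub> = \<one>\<^bsub>K\<^esub>"
    and counit_mult: "\<lbrakk>h \<in> carrier H; h' \<in> carrier H\<rbrakk> \<Longrightarrow>
      counit H (h \<otimes>\<^bsub>H\<^esub> h') = counit H h \<otimes>\<^bsub>K\<^esub> counit H h'"
    and antipode_linear: "linear_map K H H (antipode H)"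
    and antipode_left: "h \<in> carrier H \<Longrightarrow>
      tensor_lift K H (\<lambda>x y. antipode H x \<otimes>\<^bsub>H\<^esub> y) (comult H h) = counit H h \<odot>\<^bsub>H\<^esub> \<one>\<^bsub>H\<^esub>"
    and antipode_right: "h \<in> carrier H \<Longrightarrow>
      tensor_lift K H (\<lambda>x y. x \<otimes>\<^bsub>H\<^esub> antipode H y) (comult H h) = counit H h \<odot>\<^bsub>H\<^esub> \<one>\<^bsub>H\<^esub>"

definition delta :: "('k, 'r) ring_scheme \<Rightarrow> ('g, 's) monoid_scheme \<Rightarrow> 'g \<Rightarrow> 'g \<Rightarrow> 'k"
  where "delta K G s = (\<lambda>u\<in>carrier G. if u = s then \<one>\<^bsub>K\<^esub> else \<zero>\<^bsub>K\<^esub>)"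

definition function_algebra ::
  "('k, 'r) ring_scheme \<Rightarrow> ('g, 's) monoid_scheme \<Rightarrow> ('k, 'g \<Rightarrow> 'k) module"
  where "function_algebra K G = \<lparr>
    carrier = carrier G \<rightarrow>\<^sub>E carrier K,
    mult = (\<lambda>a b. \<lambda>s\<in>carrier G. a s \<otimes>\<^bsub>K\<^esub> b s),
    one = (\<lambda>s\<in>carrier G. \<one>\<^bsub>K\<^esub>),
    zero = (\<lambda>s\<in>carrier G. \<zero>\<^bsub>K\<^esub>),
    add = (\<lambda>a b. \<lambda>s\<in>carrier G. a s \<oplus>\<^bsub>K\<^esub> b s),
    smult = (\<lambda>c a. \<lambda>s\<in>carrier G. c \<otimes>\<^bsub>K\<^esub> a s)\<rparr>"

text \<open>
  \<open>k\<^sup>G\<close> for finite \<open>G\<close>: the comultiplication is dual to the product of \<open>kG\<close>, i.e. it sends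
  \<open>\<delta>\<^sub>s\<close> to the sum of \<open>\<delta>\<^sub>u \<otimes> \<delta>\<^sub>v\<close> over \<open>uv = s\<close>.
\<close>

definition function_hopf ::
  "('k, 'r) ring_scheme \<Rightarrow> ('g, 's) monoid_scheme \<Rightarrow> ('k, 'g \<Rightarrow> 'k) hopf"
  where "function_hopf K G = (let A = function_algebra K G; T = tensor_product K A A in
    module.extend A (hopf.fields
      (\<lambda>a. \<Oplus>\<^bsub>T\<^esub>p\<in>carrier G \<times> carrier G.
        a (fst p \<otimes>\<^bsub>G\<^esub> snd p) \<odot>\<^bsub>T\<^esub> pure_tensor K A A (delta K G (fst p)) (delta K G (snd p)))
      (\<lambda>a. a \<one>\<^bsub>G\<^esub>)
      (\<lambda>a. \<lambda>s\<in>carrier G. a (inv\<^bsub>G\<^esub> s))))"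

text \<open>\<open>kG\<close> for finite \<open>G\<close>; the group element \<open>s\<close> is \<open>delta K G s\<close>.\<close>

definition group_algebra ::
  "('k, 'r) ring_scheme \<Rightarrow> ('g, 's) monoid_scheme \<Rightarrow> ('k, 'g \<Rightarrow> 'k) module"
  where "group_algebra K G = (function_algebra K G)\<lparr>
    mult := (\<lambda>a b. \<lambda>s\<in>carrier G. \<Oplus>\<^bsub>K\<^esub>u\<in>carrier G. a u \<otimes>\<^bsub>K\<^esub> b (inv\<^bsub>G\<^esub> u \<otimes>\<^bsub>G\<^esub> s)),
    one := delta K G \<one>\<^bsub>G\<^esub>\<rparr>"

definition group_hopf ::
  "('k, 'r) ring_scheme \<Rightarrow> ('g, 's) monoid_scheme \<Rightarrow> ('k, 'g \<Rightarrow> 'k) hopf"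
  where "group_hopf K G = (let A = group_algebra K G; T = tensor_product K A A in
    module.extend A (hopf.fields
      (\<lambda>a. \<Oplus>\<^bsub>T\<^esub>s\<in>carrier G. a s \<odot>\<^bsub>T\<^esub> pure_tensor K A A (delta K G s) (delta K G s))
      (\<lambda>a. \<Oplus>\<^bsub>K\<^esub>s\<in>carrier G. a s)
      (\<lambda>a. \<lambda>s\<in>carrier G. a (inv\<^bsub>G\<^esub> s))))"


section \<open>\<open>k\<close>-categories\<close>

text \<open>
  \<open>Mor C y x\<close> is the space of morphisms from \<open>x\<close> to \<open>y\<close>, and \<open>Comp C z y x g f\<close> is the composite
  of \<open>f \<in> Mor C y x\<close> with \<open>g \<in> Mor C z y\<close>. Different morphism spaces need not be disjoint.
\<close>

record ('o, 'k, 'm) kcat =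
  Obj :: "'o set"
  Mor :: "'o \<Rightarrow> 'o \<Rightarrow> ('k, 'm) module"
  Comp :: "'o \<Rightarrow> 'o \<Rightarrow> 'o \<Rightarrow> 'm \<Rightarrow> 'm \<Rightarrow> 'm"
  Ident :: "'o \<Rightarrow> 'm"

locale k_category = field K
  for K (structure) and C :: "('o, 'k, 'm) kcat" +
  assumes Mor_module: "\<lbrakk>x \<in> Obj C; y \<in> Obj C\<rbrakk> \<Longrightarrow> module K (Mor C y x)"
    and Comp_bilinear: "\<lbrakk>x \<in> Obj C; y \<in> Obj C; z \<in> Obj C\<rbrakk> \<Longrightarrow>
      bilinear_map K (Mor C z y) (Mor C y x) (Mor C z x) (Comp C z y x)"
    and Comp_assoc: "\<lbrakk>w \<in> Obj C; x \<in> Obj C; y \<in> Obj C; z \<in> Obj C;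
        h \<in> carrier (Mor C z y); g \<in> carrier (Mor C y x); f \<in> carrier (Mor C x w)\<rbrakk> \<Longrightarrow>
      Comp C z x w (Comp C z y x h g) f = Comp C z y w h (Comp C y x w g f)"
    and Ident_closed: "x \<in> Obj C \<Longrightarrow> Ident C x \<in> carrier (Mor C x x)"
    and Ident_left: "\<lbrakk>x \<in> Obj C; y \<in> Obj C; f \<in> carrier (Mor C y x)\<rbrakk> \<Longrightarrow>
      Comp C y y x (Ident C y) f = f"
    and Ident_right: "\<lbrakk>x \<in> Obj C; y \<in> Obj C; f \<in> carrier (Mor C y x)\<rbrakk> \<Longrightarrow>
      Comp C y x x f (Ident C x) = f"

locale k_functor = source: k_category K C + target: k_category K D
  for K :: "('k, 'r) ring_scheme" and C :: "('o, 'k, 'm) kcat" and D :: "('p, 'k, 'n) kcat"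
    and FO :: "'o \<Rightarrow> 'p" and FM :: "'o \<Rightarrow> 'o \<Rightarrow> 'm \<Rightarrow> 'n" +
  assumes FO_closed: "x \<in> Obj C \<Longrightarrow> FO x \<in> Obj D"
    and FM_linear: "\<lbrakk>x \<in> Obj C; y \<in> Obj C\<rbrakk> \<Longrightarrow>
      linear_map K (Mor C y x) (Mor D (FO y) (FO x)) (FM y x)"
    and FM_Comp: "\<lbrakk>x \<in> Obj C; y \<in> Obj C; z \<in> Obj C;
        g \<in> carrier (Mor C z y); f \<in> carrier (Mor C y x)\<rbrakk> \<Longrightarrow>
      FM z x (Comp C z y x g f) = Comp D (FO z) (FO y) (FO x) (FM z y g) (FM y x f)"
    and FM_Ident: "x \<in> Obj C \<Longrightarrow> FM x x (Ident C x) = Ident D (FO x)"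

definition isomorphic_k_categories ::
  "('k, 'r) ring_scheme \<Rightarrow> ('o, 'k, 'm) kcat \<Rightarrow> ('p, 'k, 'n) kcat \<Rightarrow> bool"
  where "isomorphic_k_categories K C D \<longleftrightarrow>
    (\<exists>FO FM IO IM. k_functor K C D FO FM \<and> k_functor K D C IO IM \<and>
      (\<forall>x\<in>Obj C. IO (FO x) = x) \<and>
      (\<forall>x\<in>Obj D. FO (IO x) = x) \<and>
      (\<forall>x\<in>Obj C. \<forall>y\<in>Obj C. \<forall>f\<in>carrier (Mor C y x). IM (FO y) (FO x) (FM y x f) = f) \<and>
      (\<forall>x\<in>Obj D. \<forall>y\<in>Obj D. \<forall>f\<in>carrier (Mor D y x). FM (IO y) (IO x) (IM y x f) = f))"


section \<open>Graded categories\<close>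

definition is_decomposition ::
  "('k, 'v, 'x) module_scheme \<Rightarrow> 'i set \<Rightarrow> ('i \<Rightarrow> 'v set) \<Rightarrow> 'v \<Rightarrow> ('i \<Rightarrow> 'v) \<Rightarrow> bool"
  where "is_decomposition V I N v c \<longleftrightarrow>
    c \<in> (\<Pi>\<^sub>E i\<in>I. N i) \<and> finite {i\<in>I. c i \<noteq> \<zero>\<^bsub>V\<^esub>} \<and>
    v = (\<Oplus>\<^bsub>V\<^esub>i\<in>{i\<in>I. c i \<noteq> \<zero>\<^bsub>V\<^esub>}. c i)"

definition internal_direct_sum ::
  "('k, 'r) ring_scheme \<Rightarrow> ('k, 'v, 'x) module_scheme \<Rightarrow> 'i set \<Rightarrow> ('i \<Rightarrow> 'v set) \<Rightarrow> bool"
  where "internal_direct_sum K V I N \<longleftrightarrow>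
    (\<forall>i\<in>I. submodule (N i) K V) \<and> (\<forall>v\<in>carrier V. \<exists>!c. is_decomposition V I N v c)"

definition projection ::
  "('k, 'v, 'x) module_scheme \<Rightarrow> 'i set \<Rightarrow> ('i \<Rightarrow> 'v set) \<Rightarrow> 'i \<Rightarrow> 'v \<Rightarrow> 'v"
  where "projection V I N i v = (THE c. is_decomposition V I N v c) i"

text \<open>\<open>E y x s\<close> is the homogeneous component of degree \<open>s\<close> of \<open>Mor B y x\<close>.\<close>

locale graded_k_category = k_category K B + group G
  for K (structure) and G (structure) and B :: "('o, 'k, 'm) kcat"
    and E :: "'o \<Rightarrow> 'o \<Rightarrow> 'g \<Rightarrow> 'm set" +
  assumes grading: "\<lbrakk>x \<in> Obj B; y \<in> Obj B\<rbrakk> \<Longrightarrow>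
      internal_direct_sum K (Mor B y x) (carrier G) (E y x)"
    and grading_Comp: "\<lbrakk>x \<in> Obj B; y \<in> Obj B; z \<in> Obj B; s \<in> carrier G; t \<in> carrier G;
        g \<in> E z y t; f \<in> E y x s\<rbrakk> \<Longrightarrow>
      Comp B z y x g f \<in> E z x (t \<otimes>\<^bsub>G\<^esub> s)"


section \<open>Module categories and smash categories\<close>

locale hopf_module_category = k_category K C + hopf_algebra K H
  for K (structure) and H :: "('k, 'h, 'z) hopf_scheme" (structure) and C :: "('o, 'k, 'm) kcat"
    and act :: "'o \<Rightarrow> 'o \<Rightarrow> 'h \<Rightarrow> 'm \<Rightarrow> 'm" +
  assumes act_bilinear: "\<lbrakk>x \<in> Obj C; y \<in> Obj C\<rbrakk> \<Longrightarrow>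
      bilinear_map K H (Mor C y x) (Mor C y x) (act y x)"
    and act_one: "\<lbrakk>x \<in> Obj C; y \<in> Obj C; f \<in> carrier (Mor C y x)\<rbrakk> \<Longrightarrow>
      act y x \<one>\<^bsub>H\<^esub> f = f"
    and act_mult: "\<lbrakk>x \<in> Obj C; y \<in> Obj C; h \<in> carrier H; h' \<in> carrier H;
        f \<in> carrier (Mor C y x)\<rbrakk> \<Longrightarrow>
      act y x (h \<otimes>\<^bsub>H\<^esub> h') f = act y x h (act y x h' f)"
    and act_Comp: "\<lbrakk>x \<in> Obj C; y \<in> Obj C; z \<in> Obj C; h \<in> carrier H;
        g \<in> carrier (Mor C z y); f \<in> carrier (Mor C y x)\<rbrakk> \<Longrightarrow>
      act z x h (Comp C z y x g f) =
      tensor_lift K (Mor C z x) (\<lambda>h\<^sub>1 h\<^sub>2. Comp C z y x (act z y h\<^sub>1 g) (act y x h\<^sub>2 f)) (comult H h)"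
    and act_Ident: "\<lbrakk>x \<in> Obj C; h \<in> carrier H\<rbrakk> \<Longrightarrow>
      act x x h (Ident C x) = counit H h \<odot>\<^bsub>Mor C x x\<^esub> Ident C x"

text \<open>
  On pure tensors the composition below is
  \<open>(\<phi> \<otimes> h)(\<psi> \<otimes> h') = \<Sum> \<phi> (h\<^sub>1 \<psi>) \<otimes> h\<^sub>2 h'\<close>.
\<close>

definition smash ::
  "('k, 'r) ring_scheme \<Rightarrow> ('k, 'h, 'z) hopf_scheme \<Rightarrow> ('o, 'k, 'm) kcat \<Rightarrow>
    ('o \<Rightarrow> 'o \<Rightarrow> 'h \<Rightarrow> 'm \<Rightarrow> 'm) \<Rightarrow> ('o, 'k, ('m \<times> 'h \<Rightarrow> 'k) set) kcat"
  where "smash K H C act = \<lparr>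
    Obj = Obj C,
    Mor = (\<lambda>y x. tensor_product K (Mor C y x) H),
    Comp = (\<lambda>z y x S T.
      let P = tensor_product K (Mor C z x) H in
      tensor_lift K P (\<lambda>\<phi> h. tensor_lift K P (\<lambda>\<psi> h'.
        tensor_lift K P (\<lambda>h\<^sub>1 h\<^sub>2.
          pure_tensor K (Mor C z x) H (Comp C z y x \<phi> (act y x h\<^sub>1 \<psi>)) (h\<^sub>2 \<otimes>\<^bsub>H\<^esub> h'))
        (comult H h)) T) S),
    Ident = (\<lambda>x. pure_tensor K (Mor C x x) H (Ident C x) \<one>\<^bsub>H\<^esub>)\<rparr>"

text \<open>The linear extension of \<open>\<delta>\<^sub>s f = f\<^sub>s\<close>, as \<open>a = \<Sum> a(s) \<delta>\<^sub>s\<close>.\<close>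

definition grading_action ::
  "('g, 's) monoid_scheme \<Rightarrow> ('o, 'k, 'm) kcat \<Rightarrow> ('o \<Rightarrow> 'o \<Rightarrow> 'g \<Rightarrow> 'm set) \<Rightarrow>
    'o \<Rightarrow> 'o \<Rightarrow> ('g \<Rightarrow> 'k) \<Rightarrow> 'm \<Rightarrow> 'm"
  where "grading_action G B E y x a f =
    (\<Oplus>\<^bsub>Mor B y x\<^esub>s\<in>carrier G. a s \<odot>\<^bsub>Mor B y x\<^esub> projection (Mor B y x) (carrier G) (E y x) s f)"

definition graded_smash ::
  "('k, 'r) ring_scheme \<Rightarrow> ('g, 's) monoid_scheme \<Rightarrow> ('o, 'k, 'm) kcat \<Rightarrow>
    ('o \<Rightarrow> 'o \<Rightarrow> 'g \<Rightarrow> 'm set) \<Rightarrow> ('o, 'k, ('m \<times> ('g \<Rightarrow> 'k) \<Rightarrow> 'k) set) kcat"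
  where "graded_smash K G B E = smash K (function_hopf K G) B (grading_action G B E)"

text \<open>The bilinear extension of \<open>t (f \<otimes> \<delta>\<^sub>s) = f \<otimes> \<delta>\<^sub>r\<close> with \<open>r = st\<^sup>-\<^sup>1\<close>.\<close>

definition translation_action ::
  "('k, 'r) ring_scheme \<Rightarrow> ('g, 's) monoid_scheme \<Rightarrow> ('o, 'k, 'm) kcat \<Rightarrow>
    'o \<Rightarrow> 'o \<Rightarrow> ('g \<Rightarrow> 'k) \<Rightarrow> ('m \<times> ('g \<Rightarrow> 'k) \<Rightarrow> 'k) set \<Rightarrow> ('m \<times> ('g \<Rightarrow> 'k) \<Rightarrow> 'k) set"
  where "translation_action K G B y x a T =
    (let H = function_hopf K G; P = tensor_product K (Mor B y x) H in
      \<Oplus>\<^bsub>P\<^esub>t\<in>carrier G. a t \<odot>\<^bsub>P\<^esub>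
        tensor_lift K P
          (\<lambda>f b. \<Oplus>\<^bsub>P\<^esub>s\<in>carrier G. b s \<odot>\<^bsub>P\<^esub>
            pure_tensor K (Mor B y x) H f (delta K G (s \<otimes>\<^bsub>G\<^esub> inv\<^bsub>G\<^esub> t)))
          T)"


section \<open>Matrix categories\<close>

definition matrix_category :: "nat \<Rightarrow> ('o, 'k, 'm) kcat \<Rightarrow> ('o, 'k, nat \<times> nat \<Rightarrow> 'm) kcat"
  where "matrix_category n B = (let I = {..<n} \<times> {..<n} in \<lparr>
    Obj = Obj B,
    Mor = (\<lambda>y x. \<lparr>
      carrier = I \<rightarrow>\<^sub>E carrier (Mor B y x),
      mult = undefined,
      one = undefined,
      zero = (\<lambda>p\<in>I. \<zero>\<^bsub>Mor B y x\<^esub>),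
      add = (\<lambda>M N. \<lambda>p\<in>I. M p \<oplus>\<^bsub>Mor B y x\<^esub> N p),
      smult = (\<lambda>a M. \<lambda>p\<in>I. a \<odot>\<^bsub>Mor B y x\<^esub> M p)\<rparr>),
    Comp = (\<lambda>z y x M N. \<lambda>p\<in>I. \<Oplus>\<^bsub>Mor B z x\<^esub>l\<in>{..<n}. Comp B z y x (M (fst p, l)) (N (l, snd p))),
    Ident = (\<lambda>x. \<lambda>p\<in>I. if fst p = snd p then Ident B x else \<zero>\<^bsub>Mor B x x\<^esub>)\<rparr>)"

end

theory Submission
  imports Defs
begin

text \<open>
  In \<open>(\<B> # k\<^sup>G) # kG\<close> one computes
  \<open>(f \<otimes> \<delta>\<^sub>s \<otimes> u)(g \<otimes> \<delta>\<^sub>t \<otimes> v) = f g\<^sub>w \<otimes> \<delta>\<^sub>r \<otimes> uv\<close> with \<open>w = sut\<^sup>-\<^sup>1\<close> and \<open>r = tu\<^sup>-\<^sup>1\<close>. If \<open>f\<close> and \<open>g\<close> are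
  homogeneous of degrees \<open>d\<close> and \<open>e\<close>, this is zero unless \<open>su = et\<close>, which is the rule for
  multiplying matrix units: \<open>f \<otimes> \<delta>\<^sub>s \<otimes> u\<close> corresponds to the matrix, with rows and columns
  indexed by \<open>G\<close>, whose only entry is \<open>f\<close> in row \<open>ds\<close> and column \<open>su\<close>. The triple
  \<open>(d, s, u)\<close> is recovered from \<open>d\<close>, \<open>ds\<close> and \<open>su\<close>, so this is a linear bijection on morphism
  spaces; the category axioms for the double smash category are transported along it.
\<close>

section \<open>Linear maps\<close>

text \<open>The origin of the matrix positions: by the product rule in
  \<open>\<B> # k\<^sup>G\<close>, an element \<open>f \<otimes> \<delta>\<^sub>s\<close> with
  \<open>f\<close> of degree \<open>d\<close> behaves like a morphism from \<open>s\<close> to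
  \<open>ds\<close>, that is, like an entry in row \<open>ds\<close> and column \<open>s\<close>.
  The group element \<open>u\<close> corresponds to the permutation matrix with ones at the
  positions \<open>(r, ru)\<close>; multiplying by it on the right moves column \<open>s\<close> to
  column \<open>su\<close>. The obstacle is that morphisms are cosets in a free module and that
  composition consists of three nested lifts, each evaluated at a chosen representative. Nothing can
  be computed before every layer is known to be linear in every variable; after that, identities are
  checked on the elements \<open>f \<otimes> \<delta>\<^sub>s \<otimes> u\<close> with
  \<open>f\<close> homogeneous. For the same reason the isomorphism is given by reading off matrix
  entries, which are linear maps on tensors, and not by prescribing images of matrices. One fact
  about gradings is not formal: identity morphisms are homogeneous of neutral degree. It has to be
  derived from the grading before identities can be matched with identity matrices.\<close>

lemma linear_mapI:
  assumes "\<And>v. v \<in> carrier V \<Longrightarrow> f v \<in> carrier W"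
    and "\<And>u v. \<lbrakk>u \<in> carrier V; v \<in> carrier V\<rbrakk> \<Longrightarrow> f (u \<oplus>\<^bsub>V\<^esub> v) = f u \<oplus>\<^bsub>W\<^esub> f v"
    and "\<And>a v. \<lbrakk>a \<in> carrier K; v \<in> carrier V\<rbrakk> \<Longrightarrow> f (a \<odot>\<^bsub>V\<^esub> v) = a \<odot>\<^bsub>W\<^esub> f v"
  shows "linear_map K V W f"
  using assms by (simp add: linear_map_def Pi_def)

lemma linear_mapD:
  assumes "linear_map K V W f"
  shows "v \<in> carrier V \<Longrightarrow> f v \<in> carrier W"
    and "\<lbrakk>u \<in> carrier V; v \<in> carrier V\<rbrakk> \<Longrightarrow> f (u \<oplus>\<^bsub>V\<^esub> v) = f u \<oplus>\<^bsub>W\<^esub> f v"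
    and "\<lbrakk>a \<in> carrier K; v \<in> carrier V\<rbrakk> \<Longrightarrow> f (a \<odot>\<^bsub>V\<^esub> v) = a \<odot>\<^bsub>W\<^esub> f v"
  using assms by (auto simp: linear_map_def)

text \<open>The module hypothesis supplies closure: sums and multiples of elements of
  \<open>V\<close> stay in the carrier, where \<open>f\<close> and \<open>g\<close> agree.\<close>

lemma linear_map_cong:
  assumes "module K V" and "\<And>v. v \<in> carrier V \<Longrightarrow> f v = g v"
  shows "linear_map K V W f \<longleftrightarrow> linear_map K V W g"
proof -
  interpret module K V by fact
  show ?thesis using assms(2) by (simp add: linear_map_def Pi_def)
qed

lemma linear_map_compose:
  assumes "linear_map K U V f" and "linear_map K V W g"
  shows "linear_map K U W (\<lambda>u. g (f u))"
  using assms by (intro linear_mapI) (simp_all add: linear_mapD)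

lemma linear_map_zero:
  assumes "module K V" "module K W" "linear_map K V W f"
  shows "f \<zero>\<^bsub>V\<^esub> = \<zero>\<^bsub>W\<^esub>"
proof -
  interpret V: module K V by fact
  interpret W: module K W by fact
  have "f (\<zero>\<^bsub>K\<^esub> \<odot>\<^bsub>V\<^esub> \<zero>\<^bsub>V\<^esub>) = \<zero>\<^bsub>K\<^esub> \<odot>\<^bsub>W\<^esub> f \<zero>\<^bsub>V\<^esub>"
    by (rule linear_mapD(3)[OF assms(3)]) auto
  then show ?thesis
    using linear_mapD(1)[OF assms(3)] by simp
qed

lemma linear_map_minus:
  assumes "module K V" "module K W" "linear_map K V W f" "u \<in> carrier V" "v \<in> carrier V"
  shows "f (u \<ominus>\<^bsub>V\<^esub> v) = f u \<ominus>\<^bsub>W\<^esub> f v"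
proof -
  interpret V: module K V by fact
  interpret W: module K W by fact
  have "f (\<ominus>\<^bsub>V\<^esub> v) \<oplus>\<^bsub>W\<^esub> f v = \<zero>\<^bsub>W\<^esub>"
    using assms linear_mapD(2)[OF assms(3), of "\<ominus>\<^bsub>V\<^esub> v" v]
    by (simp add: V.l_neg linear_map_zero)
  then have "\<ominus>\<^bsub>W\<^esub> f v = f (\<ominus>\<^bsub>V\<^esub> v)"
    using assms by (intro W.minus_equality) (simp_all add: linear_mapD)
  then show ?thesis
    using assms by (simp add: a_minus_def linear_mapD)
qed

text \<open>For infinite \<open>A\<close> both sums take the default value zero, which a linear map
  preserves; hence the induction over arbitrary sets.\<close>

lemma linear_map_finsum:
  assumes "module K V" "module K W" "linear_map K V W f" "g \<in> A \<rightarrow> carrier V"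
  shows "f (finsum V g A) = (\<Oplus>\<^bsub>W\<^esub>i\<in>A. f (g i))"
proof -
  interpret V: module K V by fact
  interpret W: module K W by fact
  show ?thesis
    using assms(4)
  proof (induction A rule: infinite_finite_induct)
    case (insert i A)
    then have "g i \<in> carrier V" "g \<in> A \<rightarrow> carrier V" by auto
    moreover from this have "(\<lambda>i. f (g i)) \<in> A \<rightarrow> carrier W"
      using linear_mapD(1)[OF assms(3)] by auto
    ultimately show ?case
      using insert linear_mapD[OF assms(3)] by (simp add: Pi_def)
  qed (simp_all add: linear_map_zero[OF assms(1-3)])
qed

section \<open>Finite sums in a module\<close>

context module
begin

text \<open>The two actions and the matrix entries are all defined as sums over the group; their
  linearity is obtained from this rule.\<close>

lemma linear_map_finsumI:
  assumes "\<And>i. i \<in> A \<Longrightarrow> linear_map R V M (\<lambda>v. f v i)" and "finite A"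
  shows "linear_map R V M (\<lambda>v. \<Oplus>\<^bsub>M\<^esub>i\<in>A. f v i)"
proof (rule linear_mapI)
  show "(\<Oplus>\<^bsub>M\<^esub>i\<in>A. f v i) \<in> carrier M" if "v \<in> carrier V" for v
    using that linear_mapD(1)[OF assms(1)] by (intro finsum_closed) auto
  show "(\<Oplus>\<^bsub>M\<^esub>i\<in>A. f (u \<oplus>\<^bsub>V\<^esub> v) i) = (\<Oplus>\<^bsub>M\<^esub>i\<in>A. f u i) \<oplus>\<^bsub>M\<^esub> (\<Oplus>\<^bsub>M\<^esub>i\<in>A. f v i)"
    if "u \<in> carrier V" "v \<in> carrier V" for u v
  proof -
    have "(\<Oplus>\<^bsub>M\<^esub>i\<in>A. f (u \<oplus>\<^bsub>V\<^esub> v) i) = (\<Oplus>\<^bsub>M\<^esub>i\<in>A. f u i \<oplus>\<^bsub>M\<^esub> f v i)"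
      using that linear_mapD[OF assms(1)] by (intro finsum_cong') auto
    also have "\<dots> = (\<Oplus>\<^bsub>M\<^esub>i\<in>A. f u i) \<oplus>\<^bsub>M\<^esub> (\<Oplus>\<^bsub>M\<^esub>i\<in>A. f v i)"
      using that linear_mapD(1)[OF assms(1)] by (intro finsum_addf) auto
    finally show ?thesis .
  qed
  show "(\<Oplus>\<^bsub>M\<^esub>i\<in>A. f (a \<odot>\<^bsub>V\<^esub> v) i) = a \<odot>\<^bsub>M\<^esub> (\<Oplus>\<^bsub>M\<^esub>i\<in>A. f v i)"
    if "a \<in> carrier R" "v \<in> carrier V" for a v
  proof -
    have "(\<Oplus>\<^bsub>M\<^esub>i\<in>A. f (a \<odot>\<^bsub>V\<^esub> v) i) = (\<Oplus>\<^bsub>M\<^esub>i\<in>A. a \<odot>\<^bsub>M\<^esub> f v i)"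
      using that linear_mapD[OF assms(1)] by (intro finsum_cong') auto
    also have "\<dots> = a \<odot>\<^bsub>M\<^esub> (\<Oplus>\<^bsub>M\<^esub>i\<in>A. f v i)"
      using that linear_mapD(1)[OF assms(1)] assms(2)
      by (intro finsum_smult_ldistr[symmetric]) auto
    finally show ?thesis .
  qed
qed

lemma linear_map_smultI:
  assumes "linear_map R V M f" and "a \<in> carrier R"
  shows "linear_map R V M (\<lambda>v. a \<odot>\<^bsub>M\<^esub> f v)"
  using assms
  by (intro linear_mapI) (simp_all add: linear_mapD smult_r_distr smult_assoc1[symmetric] m_comm)

text \<open>Sums over the group collapse through this rule whenever a delta, a projection or a
  matrix unit kills all summands but one.\<close>

lemma finsum_eq_single:
  assumes "finite A" "i \<in> A" "f i \<in> carrier M" "\<And>j. \<lbrakk>j \<in> A; j \<noteq> i\<rbrakk> \<Longrightarrow> f j = \<zero>\<^bsub>M\<^esub>"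
  shows "finsum M f A = f i"
proof -
  have "finsum M f A = (\<Oplus>\<^bsub>M\<^esub>j\<in>A. if i = j then f j else \<zero>\<^bsub>M\<^esub>)"
    using assms by (intro finsum_cong') auto
  also have "\<dots> = f i"
    using assms by (intro finsum_singleton) (auto simp: Pi_def dest: assms(4))
  finally show ?thesis .
qed

end

section \<open>Bilinear maps\<close>

lemma bilinear_mapI:
  assumes "\<And>u. u \<in> carrier U \<Longrightarrow> linear_map K V W (b u)"
    and "\<And>v. v \<in> carrier V \<Longrightarrow> linear_map K U W (\<lambda>u. b u v)"
  shows "bilinear_map K U V W b"
  using assms by (simp add: bilinear_map_def)

lemma bilinear_mapD:
  assumes "bilinear_map K U V W b"
  shows "u \<in> carrier U \<Longrightarrow> linear_map K V W (b u)"
    and "v \<in> carrier V \<Longrightarrow> linear_map K U W (\<lambda>u. b u v)"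
  using assms by (auto simp: bilinear_map_def)

lemma bilinear_map_closed:
  assumes "bilinear_map K U V W b" "u \<in> carrier U" "v \<in> carrier V"
  shows "b u v \<in> carrier W"
  using assms by (blast dest: bilinear_mapD linear_mapD)

text \<open>The module laws are equations, apart from the existence of negatives, and all of this
  passes through a surjection that respects the operations. It is applied to the map from a free
  module onto its cosets, at a stage when the target is not yet known to be a module.\<close>

lemma module_surjective_image:
  assumes "module K V"
    and carr: "carrier W = \<pi> ` carrier V"
    and add: "\<And>u v. \<lbrakk>u \<in> carrier V; v \<in> carrier V\<rbrakk> \<Longrightarrow> \<pi> u \<oplus>\<^bsub>W\<^esub> \<pi> v = \<pi> (u \<oplus>\<^bsub>V\<^esub> v)"
    and zero: "\<zero>\<^bsub>W\<^esub> = \<pi> \<zero>\<^bsub>V\<^esub>"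
    and smult: "\<And>a v. \<lbrakk>a \<in> carrier K; v \<in> carrier V\<rbrakk> \<Longrightarrow> a \<odot>\<^bsub>W\<^esub> \<pi> v = \<pi> (a \<odot>\<^bsub>V\<^esub> v)"
  shows "module K W"
proof -
  interpret V: module K V by fact
  have "abelian_group W"
  proof (rule abelian_groupI)
    fix x assume "x \<in> carrier W"
    then obtain v where v: "v \<in> carrier V" "x = \<pi> v" using carr by auto
    then have "\<pi> (\<ominus>\<^bsub>V\<^esub> v) \<oplus>\<^bsub>W\<^esub> x = \<zero>\<^bsub>W\<^esub>" by (simp add: add zero V.l_neg)
    moreover have "\<pi> (\<ominus>\<^bsub>V\<^esub> v) \<in> carrier W" using v carr by auto
    ultimately show "\<exists>y\<in>carrier W. y \<oplus>\<^bsub>W\<^esub> x = \<zero>\<^bsub>W\<^esub>" by blast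
  qed (auto simp: carr add zero V.a_ac)
  then show ?thesis
    by (intro moduleI)
      (auto simp: carr add smult V.R.cring_axioms V.smult_l_distr V.smult_r_distr V.smult_assoc1)
qed

section \<open>Tensor products\<close>

lemma free_module_simps [simp]:
  "\<zero>\<^bsub>free_module K X\<^esub> = (\<lambda>p. \<zero>\<^bsub>K\<^esub>)"
  "u \<oplus>\<^bsub>free_module K X\<^esub> v = (\<lambda>p. u p \<oplus>\<^bsub>K\<^esub> v p)"
  "a \<odot>\<^bsub>free_module K X\<^esub> u = (\<lambda>p. a \<otimes>\<^bsub>K\<^esub> u p)"
  by (simp_all add: free_module_def)

lemma free_module_carrier:
  "u \<in> carrier (free_module K X) \<longleftrightarrow>
    (\<forall>p. u p \<in> carrier K) \<and> finite {p. u p \<noteq> \<zero>\<^bsub>K\<^esub>} \<and> {p. u p \<noteq> \<zero>\<^bsub>K\<^esub>} \<subseteq> X"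
  by (auto simp: free_module_def)

context cring
begin

lemma free_module_module:
  fixes X :: "'i set"
  shows "module R (free_module R X)"
proof -
  have sup1: "{p. u p \<oplus> v p \<noteq> \<zero>} \<subseteq> {p. u p \<noteq> \<zero>} \<union> {p. v p \<noteq> \<zero>}"
    for u v :: "'i \<Rightarrow> 'a" by auto
  have sup2: "{p. a \<otimes> u p \<noteq> \<zero>} \<subseteq> {p. u p \<noteq> \<zero>}" if "a \<in> carrier R" for a and u :: "'i \<Rightarrow> 'a"
    using that by auto
  have add_closed: "(\<lambda>p. u p \<oplus> v p) \<in> carrier (free_module R X)"
    if "u \<in> carrier (free_module R X)" "v \<in> carrier (free_module R X)" for u v
    using that finite_subset[OF sup1[of u v]] sup1[of u v] unfolding free_module_carrier by auto
  have smult_closed: "(\<lambda>p. a \<otimes> u p) \<in> carrier (free_module R X)"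
    if "u \<in> carrier (free_module R X)" "a \<in> carrier R" for a u
    using that finite_subset[OF sup2[of a u]] sup2[of a u] unfolding free_module_carrier by auto
  have "abelian_group (free_module R X)"
  proof (rule abelian_groupI)
    fix u assume u: "u \<in> carrier (free_module R X)"
    \<comment> \<open>The negative is taken as the multiple by minus one, so that its finite support
      comes from closure under scalars.\<close>
    have "(\<lambda>p. (\<ominus> \<one>) \<otimes> u p) \<oplus>\<^bsub>free_module R X\<^esub> u = \<zero>\<^bsub>free_module R X\<^esub>"
      using u by (auto simp: free_module_carrier l_minus l_neg)
    then show "\<exists>v\<in>carrier (free_module R X). v \<oplus>\<^bsub>free_module R X\<^esub> u = \<zero>\<^bsub>free_module R X\<^esub>"
      using smult_closed[OF u, of "\<ominus> \<one>"] by auto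
  qed (auto simp: add_closed, auto simp: free_module_carrier a_ac)
  then show ?thesis
    by (intro moduleI)
      (auto simp: smult_closed cring_axioms, auto simp: free_module_carrier l_distr r_distr m_assoc)
qed

lemma single_closed: "q \<in> X \<Longrightarrow> single R q \<in> carrier (free_module R X)"
  by (auto simp: free_module_carrier single_def)

text \<open>Induction on the finite support: every element is built up from zero by adding one
  multiple of a basis vector at a time.\<close>

lemma free_module_induct [consumes 1, case_names zero step]:
  assumes "u \<in> carrier (free_module R X)"
    and zero: "P (\<lambda>p. \<zero>)"
    and step: "\<And>a q v. \<lbrakk>a \<in> carrier R; q \<in> X; v \<in> carrier (free_module R X); P v\<rbrakk> \<Longrightarrow>
      P (\<lambda>p. a \<otimes> single R q p \<oplus> v p)"
  shows "P u"
proof -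
  have "P u" if "finite A" "{p. u p \<noteq> \<zero>} = A" "u \<in> carrier (free_module R X)" for A u
    using that
  proof (induction A arbitrary: u rule: finite_induct)
    case empty
    then have "u = (\<lambda>p. \<zero>)" by auto
    then show ?case using zero by simp
  next
    case (insert q A)
    \<comment> \<open>Erasing the coefficient at \<open>q\<close> leaves the support
      \<open>A\<close>, and the erased part is \<open>u q\<close> times the basis vector at
      \<open>q\<close>.\<close>
    define v where "v = u(q := \<zero>)"
    have v: "{p. v p \<noteq> \<zero>} = A" using insert by (auto simp: v_def)
    have "v \<in> carrier (free_module R X)"
      using insert.prems insert.hyps unfolding free_module_carrier v by (auto simp: v_def)
    moreover from this have "P v" by (rule insert.IH[OF v])
    moreover have "q \<in> X" "u q \<in> carrier R" using insert.prems by (auto simp: free_module_carrier)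
    ultimately have "P (\<lambda>p. u q \<otimes> single R q p \<oplus> v p)" by (intro step)
    also have "(\<lambda>p. u q \<otimes> single R q p \<oplus> v p) = u"
      using insert.prems by (auto simp: v_def single_def free_module_carrier)
    finally show ?case .
  qed
  then show ?thesis using assms(1) by (auto simp: free_module_carrier)
qed

end

section \<open>The tensor product as a quotient\<close>

locale tensor_pair = V: module K V + W: module K W
  for K :: "('k, 'r) ring_scheme" and V :: "('k, 'v, 'x) module_scheme"
    and W :: "('k, 'w, 'y) module_scheme"
begin

abbreviation F where "F \<equiv> free_module K (carrier V \<times> carrier W)"
abbreviation N where "N \<equiv> tensor_relations K V W"
abbreviation T where "T \<equiv> tensor_product K V W"
abbreviation tensor (infixl \<open>\<otimes>\<^sub>t\<close> 72) where "v \<otimes>\<^sub>t w \<equiv> pure_tensor K V W v w"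

sublocale F: module K F
  by (rule V.free_module_module)

lemma generators_subset: "tensor_generators K V W \<subseteq> carrier F"
  unfolding tensor_generators_def Let_def
  by (auto intro!: V.single_closed F.minus_closed F.smult_closed F.a_closed
      simp del: free_module_simps)

text \<open>An intersection of submodules is one as soon as the family is inhabited.
  \<open>carrier F\<close> belongs to it because it contains the generators, and this is what keeps
  \<open>N\<close> inside \<open>carrier F\<close>.\<close>

lemma relations_submodule: "submodule N K F"
proof (rule F.submoduleI)
  let ?S = "{N. submodule N K F \<and> tensor_generators K V W \<subseteq> N}"
  have "carrier F \<in> ?S" using generators_subset F.carrier_is_submodule by auto
  then show "N \<subseteq> carrier F" unfolding tensor_relations_def by blast
  show "\<zero>\<^bsub>F\<^esub> \<in> N" unfolding tensor_relations_def
    using subgroup.one_closed[OF submodule.axioms(1)] by fastforce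
  show "\<ominus>\<^bsub>F\<^esub> a \<in> N" if "a \<in> N" for a
    using that F.submoduleE(3) unfolding tensor_relations_def by blast
  show "a \<oplus>\<^bsub>F\<^esub> b \<in> N" if "a \<in> N" "b \<in> N" for a b
    using that F.submoduleE(5) unfolding tensor_relations_def by blast
  show "a \<odot>\<^bsub>F\<^esub> b \<in> N" if "a \<in> carrier K" "b \<in> N" for a b
    using that F.submoduleE(4) unfolding tensor_relations_def by blast
qed

lemma generators_relations: "tensor_generators K V W \<subseteq> N"
  unfolding tensor_relations_def by blast

lemma relations_least:
  "\<lbrakk>submodule M K F; tensor_generators K V W \<subseteq> M\<rbrakk> \<Longrightarrow> N \<subseteq> M"
  unfolding tensor_relations_def by blast

sublocale N: abelian_subgroup N F
  using relations_submodule
  by (intro abelian_subgroupI3 additive_subgroupI) (auto dest: submodule.axioms intro: F.abelian_group_axioms)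

lemma tensor_carrier: "carrier T = (\<lambda>u. N +>\<^bsub>F\<^esub> u) ` carrier F"
  by (auto simp: tensor_product_def quotient_module_def A_RCOSETS_def' a_r_coset_def')

lemma coset_add:
  "\<lbrakk>u \<in> carrier F; v \<in> carrier F\<rbrakk> \<Longrightarrow>
    (N +>\<^bsub>F\<^esub> u) \<oplus>\<^bsub>T\<^esub> (N +>\<^bsub>F\<^esub> v) = N +>\<^bsub>F\<^esub> (u \<oplus>\<^bsub>F\<^esub> v)"
  using N.a_rcos_sum by (simp add: tensor_product_def quotient_module_def del: free_module_simps)

lemma coset_eqI:
  assumes "u \<in> carrier F" "v \<in> carrier F" "u \<ominus>\<^bsub>F\<^esub> v \<in> N"
  shows "N +>\<^bsub>F\<^esub> u = N +>\<^bsub>F\<^esub> v"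
  using N.a_rcos_module_rev[of v u] N.a_repr_independence'[of u v] assms
  by (simp add: a_minus_def del: free_module_simps)

text \<open>Scalar multiplication on the quotient is a union over all representatives. Two
  representatives differ by a relation, so do their multiples, and all cosets in the union
  coincide.\<close>

lemma coset_smult:
  assumes a: "a \<in> carrier K" and v: "v \<in> carrier F"
  shows "a \<odot>\<^bsub>T\<^esub> (N +>\<^bsub>F\<^esub> v) = N +>\<^bsub>F\<^esub> (a \<odot>\<^bsub>F\<^esub> v)"
proof -
  have "N +>\<^bsub>F\<^esub> (a \<odot>\<^bsub>F\<^esub> u) = N +>\<^bsub>F\<^esub> (a \<odot>\<^bsub>F\<^esub> v)" if u: "u \<in> N +>\<^bsub>F\<^esub> v" for u
  proof (rule coset_eqI)
    have uF: "u \<in> carrier F"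
      using N.a_elemrcos_carrier[OF v u] .
    show "a \<odot>\<^bsub>F\<^esub> u \<in> carrier F" "a \<odot>\<^bsub>F\<^esub> v \<in> carrier F"
      using a uF v by (blast intro: F.smult_closed)+
    have "a \<odot>\<^bsub>F\<^esub> u \<ominus>\<^bsub>F\<^esub> a \<odot>\<^bsub>F\<^esub> v = a \<odot>\<^bsub>F\<^esub> (u \<oplus>\<^bsub>F\<^esub> \<ominus>\<^bsub>F\<^esub> v)"
      using a uF v
      by (simp add: a_minus_def F.smult_r_distr F.smult_r_minus F.a_inv_closed
          del: free_module_simps)
    also have "\<dots> \<in> N"
      using F.submoduleE(4)[OF relations_submodule a] N.a_rcos_module_imp[OF v u] by blast
    finally show "a \<odot>\<^bsub>F\<^esub> u \<ominus>\<^bsub>F\<^esub> a \<odot>\<^bsub>F\<^esub> v \<in> N" .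
  qed
  moreover have "v \<in> N +>\<^bsub>F\<^esub> v" using N.a_rcos_self[OF v] .
  ultimately have "(\<Union>u\<in>N +>\<^bsub>F\<^esub> v. N +>\<^bsub>F\<^esub> (a \<odot>\<^bsub>F\<^esub> u)) = N +>\<^bsub>F\<^esub> (a \<odot>\<^bsub>F\<^esub> v)" by blast
  then show ?thesis
    by (simp add: tensor_product_def quotient_module_def)
qed

lemma tensor_module: "module K T"
proof (rule module_surjective_image[where \<pi> = "\<lambda>u. N +>\<^bsub>F\<^esub> u", OF F.module_axioms tensor_carrier])
  have "N +>\<^bsub>F\<^esub> \<zero>\<^bsub>F\<^esub> = N" using N.zero_closed by (rule N.a_rcos_const)
  then show "\<zero>\<^bsub>T\<^esub> = N +>\<^bsub>F\<^esub> \<zero>\<^bsub>F\<^esub>"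
    by (simp add: tensor_product_def quotient_module_def)
qed (simp_all add: coset_add coset_smult del: free_module_simps)

sublocale T: module K T
  by (rule tensor_module)

lemma coset_linear: "linear_map K F T (\<lambda>u. N +>\<^bsub>F\<^esub> u)"
  by (rule linear_mapI) (simp_all add: tensor_carrier coset_add coset_smult del: free_module_simps)

lemma pure_tensor_closed: "\<lbrakk>v \<in> carrier V; w \<in> carrier W\<rbrakk> \<Longrightarrow> v \<otimes>\<^sub>t w \<in> carrier T"
  unfolding pure_tensor_def by (intro linear_mapD(1)[OF coset_linear] V.single_closed) simp

text \<open>Each of the four laws says precisely that one of the four families of generators lies in
  \<open>N\<close>.\<close>

lemma pure_tensor_bilinear: "bilinear_map K V W T (\<otimes>\<^sub>t)"
proof -
  note [simp del] = free_module_simps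
  note [simp] = V.single_closed coset_add coset_smult
  note rel = subsetD[OF generators_relations, unfolded tensor_generators_def Let_def]
  show ?thesis
  proof (intro bilinear_mapI linear_mapI)
    fix v w w' assume "v \<in> carrier V" "w \<in> carrier W" "w' \<in> carrier W"
    then show "v \<otimes>\<^sub>t (w \<oplus>\<^bsub>W\<^esub> w') = v \<otimes>\<^sub>t w \<oplus>\<^bsub>T\<^esub> v \<otimes>\<^sub>t w'"
      unfolding pure_tensor_def by (simp, intro coset_eqI rel) (simp_all, blast)
  next
    fix v v' w assume "v \<in> carrier V" "v' \<in> carrier V" "w \<in> carrier W"
    then show "(v \<oplus>\<^bsub>V\<^esub> v') \<otimes>\<^sub>t w = v \<otimes>\<^sub>t w \<oplus>\<^bsub>T\<^esub> v' \<otimes>\<^sub>t w"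
      unfolding pure_tensor_def by (simp, intro coset_eqI rel) (simp_all, blast)
  next
    fix a v w assume "v \<in> carrier V" "a \<in> carrier K" "w \<in> carrier W"
    then show "v \<otimes>\<^sub>t (a \<odot>\<^bsub>W\<^esub> w) = a \<odot>\<^bsub>T\<^esub> (v \<otimes>\<^sub>t w)"
      unfolding pure_tensor_def by (simp, intro coset_eqI rel) (simp_all, blast)
  next
    fix a v w assume "v \<in> carrier V" "a \<in> carrier K" "w \<in> carrier W"
    then show "(a \<odot>\<^bsub>V\<^esub> v) \<otimes>\<^sub>t w = a \<odot>\<^bsub>T\<^esub> (v \<otimes>\<^sub>t w)"
      unfolding pure_tensor_def by (simp, intro coset_eqI rel) (simp_all, blast)
  qed (simp_all add: pure_tensor_closed)
qed

text \<open>Two cases suffice: a scalar is absorbed into the left factor of a pure tensor, and zero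
  is the pure tensor of two zeros.\<close>

lemma tensor_induct [consumes 1, case_names pure add]:
  assumes "t \<in> carrier T"
    and pure: "\<And>v w. \<lbrakk>v \<in> carrier V; w \<in> carrier W\<rbrakk> \<Longrightarrow> P (v \<otimes>\<^sub>t w)"
    and add: "\<And>s t. \<lbrakk>s \<in> carrier T; t \<in> carrier T; P s; P t\<rbrakk> \<Longrightarrow> P (s \<oplus>\<^bsub>T\<^esub> t)"
  shows "P t"
proof -
  note [simp del] = free_module_simps
  obtain u where u: "u \<in> carrier F" "t = N +>\<^bsub>F\<^esub> u"
    using assms(1) by (auto simp: tensor_carrier)
  have "P (N +>\<^bsub>F\<^esub> u)"
    using u(1)
  proof (induction u rule: V.free_module_induct)
    case zero
    have "N +>\<^bsub>F\<^esub> \<zero>\<^bsub>F\<^esub> = \<zero>\<^bsub>T\<^esub>"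
      by (rule linear_map_zero[OF F.module_axioms T.module_axioms coset_linear])
    also have "\<dots> = \<zero>\<^bsub>V\<^esub> \<otimes>\<^sub>t \<zero>\<^bsub>W\<^esub>"
      using linear_map_zero[OF W.module_axioms T.module_axioms
          bilinear_mapD(1)[OF pure_tensor_bilinear]] by simp
    finally show ?case using pure by (simp add: free_module_simps)
  next
    case (step a q u)
    then obtain v w where q: "q = (v, w)" "v \<in> carrier V" "w \<in> carrier W" by auto
    have "N +>\<^bsub>F\<^esub> (a \<odot>\<^bsub>F\<^esub> single K q \<oplus>\<^bsub>F\<^esub> u) = a \<odot>\<^bsub>T\<^esub> (v \<otimes>\<^sub>t w) \<oplus>\<^bsub>T\<^esub> (N +>\<^bsub>F\<^esub> u)"
      using step q V.single_closed[of q "carrier V \<times> carrier W"]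
      by (simp add: pure_tensor_def linear_mapD[OF coset_linear] F.smult_closed)
    also have "a \<odot>\<^bsub>T\<^esub> (v \<otimes>\<^sub>t w) = (a \<odot>\<^bsub>V\<^esub> v) \<otimes>\<^sub>t w"
      using linear_mapD(3)[OF bilinear_mapD(2)[OF pure_tensor_bilinear]] step q by simp
    finally show ?case
      using add[OF pure_tensor_closed[of "a \<odot>\<^bsub>V\<^esub> v" w] linear_mapD(1)[OF coset_linear]] step q
        pure[of "a \<odot>\<^bsub>V\<^esub> v" w]
      by (simp add: free_module_simps)
  qed
  then show ?thesis using u by simp
qed

text \<open>The uniqueness half of the universal property.\<close>

lemma linear_map_eq_on_pure:
  assumes "linear_map K T P f" "linear_map K T P g" "t \<in> carrier T"
    and "\<And>v w. \<lbrakk>v \<in> carrier V; w \<in> carrier W\<rbrakk> \<Longrightarrow> f (v \<otimes>\<^sub>t w) = g (v \<otimes>\<^sub>t w)"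
  shows "f t = g t"
  using assms(3)
  by (induction rule: tensor_induct)
    (simp_all add: assms(4) linear_mapD(2)[OF assms(1)] linear_mapD(2)[OF assms(2)])

end

section \<open>The universal property\<close>

locale tensor_bilinear = tensor_pair K V W + P: module K P
  for K :: "('k, 'r) ring_scheme" and V :: "('k, 'v, 'x) module_scheme"
    and W :: "('k, 'w, 'y) module_scheme" and P :: "('k, 'p, 'z) module_scheme" +
  fixes b :: "'v \<Rightarrow> 'w \<Rightarrow> 'p"
  assumes b_bilinear: "bilinear_map K V W P b"
begin

text \<open>The lift before passing to the quotient; \<open>tensor_lift\<close> is its value at a
  chosen representative of the coset.\<close>

abbreviation L where
  "L u \<equiv> (\<Oplus>\<^bsub>P\<^esub>p\<in>{p. u p \<noteq> \<zero>\<^bsub>K\<^esub>}. u p \<odot>\<^bsub>P\<^esub> b (fst p) (snd p))"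

text \<open>The support depends on \<open>u\<close> and may shrink under addition or scaling.
  Summing over a common finite superset makes the values of \<open>L\<close> at different elements
  comparable.\<close>

lemma L_superset:
  assumes "u \<in> carrier F" "finite A" "{p. u p \<noteq> \<zero>\<^bsub>K\<^esub>} \<subseteq> A" "A \<subseteq> carrier V \<times> carrier W"
  shows "L u = (\<Oplus>\<^bsub>P\<^esub>p\<in>A. u p \<odot>\<^bsub>P\<^esub> b (fst p) (snd p))"
proof -
  have b: "b (fst p) (snd p) \<in> carrier P" if "p \<in> A" for p
    using that assms(4) bilinear_map_closed[OF b_bilinear] by auto
  show ?thesis
    using assms b
    by (intro P.add.finprod_mono_neutral_cong_left) (auto simp: free_module_carrier Pi_def)
qed

lemma L_linear: "linear_map K F P L"
proof (rule linear_mapI)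
  have b: "b (fst p) (snd p) \<in> carrier P" if "p \<in> carrier V \<times> carrier W" for p
    using that bilinear_map_closed[OF b_bilinear] by auto
  show "L u \<in> carrier P" if "u \<in> carrier F" for u
    using that b by (intro P.finsum_closed) (auto simp: free_module_carrier)
  show "L (u \<oplus>\<^bsub>F\<^esub> v) = L u \<oplus>\<^bsub>P\<^esub> L v" if uv: "u \<in> carrier F" "v \<in> carrier F" for u v
  proof -
    let ?A = "{p. u p \<noteq> \<zero>\<^bsub>K\<^esub>} \<union> {p. v p \<noteq> \<zero>\<^bsub>K\<^esub>}"
    have A: "finite ?A" "?A \<subseteq> carrier V \<times> carrier W" using uv by (auto simp: free_module_carrier)
    have u: "u p \<in> carrier K" "v p \<in> carrier K" for p using uv unfolding free_module_carrier by blast+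
    have bA: "b (fst p) (snd p) \<in> carrier P" if "p \<in> ?A" for p using that A b by blast
    have "L (u \<oplus>\<^bsub>F\<^esub> v) = (\<Oplus>\<^bsub>P\<^esub>p\<in>?A. (u p \<oplus>\<^bsub>K\<^esub> v p) \<odot>\<^bsub>P\<^esub> b (fst p) (snd p))"
      using F.a_closed[OF uv] A by (subst L_superset[of _ ?A]) auto
    also have "\<dots> = (\<Oplus>\<^bsub>P\<^esub>p\<in>?A. u p \<odot>\<^bsub>P\<^esub> b (fst p) (snd p) \<oplus>\<^bsub>P\<^esub> v p \<odot>\<^bsub>P\<^esub> b (fst p) (snd p))"
      using u bA by (intro P.finsum_cong') (auto simp: P.smult_l_distr)
    also have "\<dots> = (\<Oplus>\<^bsub>P\<^esub>p\<in>?A. u p \<odot>\<^bsub>P\<^esub> b (fst p) (snd p)) \<oplus>\<^bsub>P\<^esub> (\<Oplus>\<^bsub>P\<^esub>p\<in>?A. v p \<odot>\<^bsub>P\<^esub> b (fst p) (snd p))"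
      using u bA by (intro P.finsum_addf) auto
    also have "\<dots> = L u \<oplus>\<^bsub>P\<^esub> L v"
      using uv A L_superset[of u ?A] L_superset[of v ?A] by simp
    finally show ?thesis .
  qed
  show "L (a \<odot>\<^bsub>F\<^esub> u) = a \<odot>\<^bsub>P\<^esub> L u" if a: "a \<in> carrier K" "u \<in> carrier F" for a u
  proof -
    let ?A = "{p. u p \<noteq> \<zero>\<^bsub>K\<^esub>}"
    have A: "finite ?A" "?A \<subseteq> carrier V \<times> carrier W" using a by (auto simp: free_module_carrier)
    have u: "u p \<in> carrier K" for p using a unfolding free_module_carrier by blast
    have bA: "b (fst p) (snd p) \<in> carrier P" if "p \<in> ?A" for p using that A b by blast
    have "L (a \<odot>\<^bsub>F\<^esub> u) = (\<Oplus>\<^bsub>P\<^esub>p\<in>?A. (a \<otimes>\<^bsub>K\<^esub> u p) \<odot>\<^bsub>P\<^esub> b (fst p) (snd p))"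
      using F.smult_closed[OF a] A a by (subst L_superset[of _ ?A]) auto
    also have "\<dots> = (\<Oplus>\<^bsub>P\<^esub>p\<in>?A. a \<odot>\<^bsub>P\<^esub> (u p \<odot>\<^bsub>P\<^esub> b (fst p) (snd p)))"
      using a u bA by (intro P.finsum_cong') (auto simp: P.smult_assoc1)
    also have "\<dots> = a \<odot>\<^bsub>P\<^esub> L u"
      using a u bA A by (intro P.finsum_smult_ldistr[symmetric]) auto
    finally show ?thesis .
  qed
qed

lemma L_single:
  assumes "v \<in> carrier V" "w \<in> carrier W"
  shows "L (single K (v, w)) = b v w"
proof -
  have "L (single K (v, w)) = (\<Oplus>\<^bsub>P\<^esub>p\<in>{(v, w)}. single K (v, w) p \<odot>\<^bsub>P\<^esub> b (fst p) (snd p))"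
    using assms V.single_closed[of "(v, w)"] by (intro L_superset) (auto simp: single_def)
  also have "\<dots> = b v w"
    using bilinear_map_closed[OF b_bilinear assms] by (simp add: single_def)
  finally show ?thesis .
qed

text \<open>The kernel of \<open>L\<close> is a submodule, and bilinearity of \<open>b\<close> puts
  the generators into it; \<open>N\<close> is the least such submodule.\<close>

lemma L_relations: "N \<subseteq> {u \<in> carrier F. L u = \<zero>\<^bsub>P\<^esub>}"
proof (rule relations_least)
  note [simp del] = free_module_simps
  note lin = linear_mapD[OF L_linear]
  note minus = linear_map_minus[OF F.module_axioms P.module_axioms L_linear]
  show "submodule {u \<in> carrier F. L u = \<zero>\<^bsub>P\<^esub>} K F"
  proof (rule F.submoduleI)
    show "\<zero>\<^bsub>F\<^esub> \<in> {u \<in> carrier F. L u = \<zero>\<^bsub>P\<^esub>}"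
      using linear_map_zero[OF F.module_axioms P.module_axioms L_linear] by simp
    show "\<ominus>\<^bsub>F\<^esub> u \<in> {u \<in> carrier F. L u = \<zero>\<^bsub>P\<^esub>}" if "u \<in> {u \<in> carrier F. L u = \<zero>\<^bsub>P\<^esub>}" for u
      using that minus[of "\<zero>\<^bsub>F\<^esub>" u] linear_map_zero[OF F.module_axioms P.module_axioms L_linear]
      by (simp add: a_minus_def)
  qed (auto simp: lin)
  note bl = bilinear_mapD[OF b_bilinear]
  show "tensor_generators K V W \<subseteq> {u \<in> carrier F. L u = \<zero>\<^bsub>P\<^esub>}"
    using generators_subset
    unfolding tensor_generators_def Let_def
    by (auto simp: minus lin L_single V.single_closed bilinear_map_closed[OF b_bilinear]
        linear_mapD[OF bl(1)] linear_mapD[OF bl(2)] P.r_neg a_minus_def[of P])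
qed

text \<open>The representative picked by the choice operator differs from \<open>u\<close> by an
  element of \<open>N\<close>, on which \<open>L\<close> vanishes.\<close>

lemma tensor_lift_coset:
  assumes "u \<in> carrier F"
  shows "tensor_lift K P b (N +>\<^bsub>F\<^esub> u) = L u"
proof -
  note [simp del] = free_module_simps
  define v where "v = (SOME v. v \<in> N +>\<^bsub>F\<^esub> u)"
  have v: "v \<in> N +>\<^bsub>F\<^esub> u"
    unfolding v_def using someI[of "\<lambda>v. v \<in> N +>\<^bsub>F\<^esub> u", OF N.a_rcos_self[OF assms]] .
  then have vF: "v \<in> carrier F" by (rule N.a_elemrcos_carrier[OF assms])
  have "v \<ominus>\<^bsub>F\<^esub> u \<in> N"
    using N.a_rcos_module_imp[OF assms v] by (simp add: a_minus_def)
  then have "L (v \<ominus>\<^bsub>F\<^esub> u) = \<zero>\<^bsub>P\<^esub>" using L_relations by auto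
  then have "L v \<ominus>\<^bsub>P\<^esub> L u = \<zero>\<^bsub>P\<^esub>"
    using linear_map_minus[OF F.module_axioms P.module_axioms L_linear vF assms] by simp
  then have "L v = L u"
    using linear_mapD(1)[OF L_linear assms] linear_mapD(1)[OF L_linear vF]
      P.minus_equality[of "L v" "\<ominus>\<^bsub>P\<^esub> L u"]
    by (simp only: a_minus_def P.minus_minus P.a_inv_closed)
  then show ?thesis
    by (simp add: tensor_lift_def v_def)
qed

lemma tensor_lift_linear: "linear_map K T P (tensor_lift K P b)"
proof (rule linear_mapI)
  note [simp del] = free_module_simps
  note [simp] = tensor_lift_coset coset_add coset_smult linear_mapD[OF L_linear]
  show "tensor_lift K P b t \<in> carrier P" if "t \<in> carrier T" for t
    using that by (auto simp: tensor_carrier)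
  show "tensor_lift K P b (s \<oplus>\<^bsub>T\<^esub> t) = tensor_lift K P b s \<oplus>\<^bsub>P\<^esub> tensor_lift K P b t"
    if "s \<in> carrier T" "t \<in> carrier T" for s t
    using that by (auto simp: tensor_carrier)
  show "tensor_lift K P b (a \<odot>\<^bsub>T\<^esub> t) = a \<odot>\<^bsub>P\<^esub> tensor_lift K P b t"
    if "a \<in> carrier K" "t \<in> carrier T" for a t
    using that by (auto simp: tensor_carrier)
qed

lemma tensor_lift_pure:
  assumes "v \<in> carrier V" "w \<in> carrier W"
  shows "tensor_lift K P b (v \<otimes>\<^sub>t w) = b v w"
  using assms by (simp add: pure_tensor_def tensor_lift_coset V.single_closed L_single)

end

text \<open>Here the tensor is fixed and the bilinear map varies, the opposite of the situation in
  the universal property. Nested lifts need both: the outer variables of a composite enter the inner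
  lifts as parameters. The proof is an induction on \<open>t\<close>, since on pure tensors the lift
  is just \<open>b x v w\<close>.\<close>

lemma tensor_lift_linear_parameter:
  assumes U: "module K U" and V: "module K V" and W: "module K W" and P: "module K P"
    and bil: "\<And>x. x \<in> carrier U \<Longrightarrow> bilinear_map K V W P (b x)"
    and lin: "\<And>v w. \<lbrakk>v \<in> carrier V; w \<in> carrier W\<rbrakk> \<Longrightarrow> linear_map K U P (\<lambda>x. b x v w)"
    and t: "t \<in> carrier (tensor_product K V W)"
  shows "linear_map K U P (\<lambda>x. tensor_lift K P (b x) t)"
proof -
  interpret P: module K P by fact
  interpret tensor_pair K V W using V W by (rule tensor_pair.intro)
  have tb: "tensor_bilinear K V W P (b x)" if "x \<in> carrier U" for x
    using bil[OF that] P by (intro tensor_bilinear.intro tensor_bilinear_axioms.intro tensor_pair_axioms)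
  note lift = linear_mapD[OF tensor_bilinear.tensor_lift_linear[OF tb]]
  show ?thesis
    using t
  proof (induction t rule: tensor_induct)
    case (pure v w)
    then show ?case
      using lin[of v w] tensor_bilinear.tensor_lift_pure[OF tb]
      by (subst linear_map_cong[OF U, where g = "\<lambda>x. b x v w"]) auto
  next
    case (add s t)
    note S = linear_mapD[OF add(3)] and T = linear_mapD[OF add(4)]
    interpret U: module K U by fact
    show ?case
    proof (rule linear_mapI)
      fix x y assume "x \<in> carrier U" "y \<in> carrier U"
      then show "tensor_lift K P (b (x \<oplus>\<^bsub>U\<^esub> y)) (s \<oplus>\<^bsub>T\<^esub> t) =
          tensor_lift K P (b x) (s \<oplus>\<^bsub>T\<^esub> t) \<oplus>\<^bsub>P\<^esub> tensor_lift K P (b y) (s \<oplus>\<^bsub>T\<^esub> t)"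
        using add(1,2) by (simp add: lift(2) S T P.a_ac)
    next
      fix a x assume "a \<in> carrier K" "x \<in> carrier U"
      then show "tensor_lift K P (b (a \<odot>\<^bsub>U\<^esub> x)) (s \<oplus>\<^bsub>T\<^esub> t) =
          a \<odot>\<^bsub>P\<^esub> tensor_lift K P (b x) (s \<oplus>\<^bsub>T\<^esub> t)"
        using add(1,2) by (simp add: lift(2) S T P.smult_r_distr)
    qed (use add(1,2) lift in auto)
  qed
qed

lemma tensor_lift_linear:
  assumes "module K V" "module K W" "module K P" "bilinear_map K V W P b"
  shows "linear_map K (tensor_product K V W) P (tensor_lift K P b)"
  using assms
  by (intro tensor_bilinear.tensor_lift_linear tensor_bilinear.intro tensor_pair.intro
      tensor_bilinear_axioms.intro)

lemma tensor_lift_pure: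
  assumes "module K V" "module K W" "module K P" "bilinear_map K V W P b"
    "v \<in> carrier V" "w \<in> carrier W"
  shows "tensor_lift K P b (pure_tensor K V W v w) = b v w"
  using assms
  by (intro tensor_bilinear.tensor_lift_pure tensor_bilinear.intro tensor_pair.intro
      tensor_bilinear_axioms.intro)

text \<open>The comultiplications are defined with the tensor square of the plain algebra record,
  whereas smash products refer to that of the Hopf algebra record. A tensor product sees only
  carrier, addition and scalars, so the two agree.\<close>

lemma tensor_product_cong:
  assumes "carrier V = carrier V'" "add V = add V'" "smult V = smult V'"
    and "carrier W = carrier W'" "add W = add W'" "smult W = smult W'"
  shows "tensor_product K V W = tensor_product K V' W'"
    and "pure_tensor K V W = pure_tensor K V' W'"
proof -
  have "tensor_generators K V W = tensor_generators K V' W'"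
    by (simp add: tensor_generators_def assms)
  then have "tensor_relations K V W = tensor_relations K V' W'"
    by (simp add: tensor_relations_def assms)
  then show "tensor_product K V W = tensor_product K V' W'" "pure_tensor K V W = pure_tensor K V' W'"
    by (simp_all add: tensor_product_def pure_tensor_def fun_eq_iff assms)
qed

section \<open>Smash categories\<close>

text \<open>Linearity of every ingredient is what makes the composition of a smash category well
  defined and bilinear. Associativity and units of the double smash category come later, by
  transport from matrices.\<close>

locale smash_data =
  fixes K :: "('k, 'r) ring_scheme" and H :: "('k, 'h, 'z) hopf_scheme"
    and C :: "('o, 'k, 'm) kcat" and act :: "'o \<Rightarrow> 'o \<Rightarrow> 'h \<Rightarrow> 'm \<Rightarrow> 'm"
  assumes Mor_module: "\<lbrakk>x \<in> Obj C; y \<in> Obj C\<rbrakk> \<Longrightarrow> module K (Mor C y x)"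
    and Comp_bilinear: "\<lbrakk>x \<in> Obj C; y \<in> Obj C; z \<in> Obj C\<rbrakk> \<Longrightarrow>
      bilinear_map K (Mor C z y) (Mor C y x) (Mor C z x) (Comp C z y x)"
    and H_module: "module K H"
    and mult_bilinear: "bilinear_map K H H H (mult H)"
    and comult_linear: "linear_map K H (tensor_product K H H) (comult H)"
    and act_bilinear: "\<lbrakk>x \<in> Obj C; y \<in> Obj C\<rbrakk> \<Longrightarrow>
      bilinear_map K H (Mor C y x) (Mor C y x) (act y x)"
begin

context
  fixes x y z assumes obj: "x \<in> Obj C" "y \<in> Obj C" "z \<in> Obj C"
begin

abbreviation P where "P \<equiv> tensor_product K (Mor C z x) H"

interpretation zx: tensor_pair K "Mor C z x" H
  by (intro tensor_pair.intro Mor_module H_module obj)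

interpretation zy: tensor_pair K "Mor C z y" H
  by (intro tensor_pair.intro Mor_module H_module obj)

interpretation yx: tensor_pair K "Mor C y x" H
  by (intro tensor_pair.intro Mor_module H_module obj)

lemmas comp_lin = bilinear_mapD[OF Comp_bilinear[OF obj]]
lemmas act_lin = bilinear_mapD[OF act_bilinear[OF obj(1,2)]]
lemmas mult_lin = bilinear_mapD[OF mult_bilinear]
lemmas pure_lin = bilinear_mapD[OF zx.pure_tensor_bilinear]

lemmas clsd = linear_mapD(1)[OF comp_lin(1)] linear_mapD(1)[OF act_lin(1)]
  linear_mapD(1)[OF mult_lin(1)] zx.pure_tensor_closed

text \<open>The composition is three nested lifts. \<open>summand\<close>, \<open>comp1\<close> and
  \<open>comp2\<close> name their integrands from the inside out, so that linearity can be carried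
  from one layer to the next.\<close>

definition summand where
  "summand \<phi> \<psi> h' h\<^sub>1 h\<^sub>2 =
    pure_tensor K (Mor C z x) H (Comp C z y x \<phi> (act y x h\<^sub>1 \<psi>)) (h\<^sub>2 \<otimes>\<^bsub>H\<^esub> h')"

lemma summand_linear:
  shows "\<lbrakk>\<psi> \<in> carrier (Mor C y x); h' \<in> carrier H; h\<^sub>1 \<in> carrier H; h\<^sub>2 \<in> carrier H\<rbrakk> \<Longrightarrow>
      linear_map K (Mor C z y) P (\<lambda>\<phi>. summand \<phi> \<psi> h' h\<^sub>1 h\<^sub>2)"
    and "\<lbrakk>\<phi> \<in> carrier (Mor C z y); h' \<in> carrier H; h\<^sub>1 \<in> carrier H; h\<^sub>2 \<in> carrier H\<rbrakk> \<Longrightarrow>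
      linear_map K (Mor C y x) P (\<lambda>\<psi>. summand \<phi> \<psi> h' h\<^sub>1 h\<^sub>2)"
    and "\<lbrakk>\<phi> \<in> carrier (Mor C z y); \<psi> \<in> carrier (Mor C y x); h\<^sub>1 \<in> carrier H; h\<^sub>2 \<in> carrier H\<rbrakk> \<Longrightarrow>
      linear_map K H P (\<lambda>h'. summand \<phi> \<psi> h' h\<^sub>1 h\<^sub>2)"
    and "\<lbrakk>\<phi> \<in> carrier (Mor C z y); \<psi> \<in> carrier (Mor C y x); h' \<in> carrier H; h\<^sub>2 \<in> carrier H\<rbrakk> \<Longrightarrow>
      linear_map K H P (\<lambda>h\<^sub>1. summand \<phi> \<psi> h' h\<^sub>1 h\<^sub>2)"
    and "\<lbrakk>\<phi> \<in> carrier (Mor C z y); \<psi> \<in> carrier (Mor C y x); h' \<in> carrier H; h\<^sub>1 \<in> carrier H\<rbrakk> \<Longrightarrow>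
      linear_map K H P (summand \<phi> \<psi> h' h\<^sub>1)"
  unfolding summand_def[abs_def]
      apply (rule linear_map_compose[OF comp_lin(2) pure_lin(2)]; simp add: clsd)
     apply (rule linear_map_compose[OF linear_map_compose[OF act_lin(1) comp_lin(1)] pure_lin(2)]; simp add: clsd)
    apply (rule linear_map_compose[OF mult_lin(1) pure_lin(1)]; simp add: clsd)
   apply (rule linear_map_compose[OF linear_map_compose[OF act_lin(2) comp_lin(1)] pure_lin(2)]; simp add: clsd)
  apply (rule linear_map_compose[OF mult_lin(2) pure_lin(1)]; simp add: clsd)
  done

lemma summand_bilinear:
  assumes "\<phi> \<in> carrier (Mor C z y)" "\<psi> \<in> carrier (Mor C y x)" "h' \<in> carrier H"
  shows "bilinear_map K H H P (summand \<phi> \<psi> h')"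
  using assms by (intro bilinear_mapI summand_linear)

definition comp1 where
  "comp1 \<phi> h \<psi> h' = tensor_lift K P (summand \<phi> \<psi> h') (comult H h)"

text \<open>For \<open>\<phi>\<close>, \<open>\<psi>\<close> and \<open>h'\<close> the tensor
  \<open>comult H h\<close> is fixed and the integrand varies linearly. For \<open>h\<close> the
  tensor itself varies, and the map is the lift after the comultiplication.\<close>

lemma comp1_linear:
  shows "\<lbrakk>h \<in> carrier H; \<psi> \<in> carrier (Mor C y x); h' \<in> carrier H\<rbrakk> \<Longrightarrow>
      linear_map K (Mor C z y) P (\<lambda>\<phi>. comp1 \<phi> h \<psi> h')"
    and "\<lbrakk>\<phi> \<in> carrier (Mor C z y); h \<in> carrier H; h' \<in> carrier H\<rbrakk> \<Longrightarrow>
      linear_map K (Mor C y x) P (\<lambda>\<psi>. comp1 \<phi> h \<psi> h')"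
    and "\<lbrakk>\<phi> \<in> carrier (Mor C z y); h \<in> carrier H; \<psi> \<in> carrier (Mor C y x)\<rbrakk> \<Longrightarrow>
      linear_map K H P (comp1 \<phi> h \<psi>)"
    and "\<lbrakk>\<phi> \<in> carrier (Mor C z y); \<psi> \<in> carrier (Mor C y x); h' \<in> carrier H\<rbrakk> \<Longrightarrow>
      linear_map K H P (\<lambda>h. comp1 \<phi> h \<psi> h')"
  unfolding comp1_def[abs_def]
     apply (rule tensor_lift_linear_parameter[OF zy.V.module_axioms H_module H_module zx.tensor_module];
      simp add: summand_bilinear summand_linear linear_mapD(1)[OF comult_linear])
    apply (rule tensor_lift_linear_parameter[OF yx.V.module_axioms H_module H_module zx.tensor_module];
      simp add: summand_bilinear summand_linear linear_mapD(1)[OF comult_linear])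
   apply (rule tensor_lift_linear_parameter[OF H_module H_module H_module zx.tensor_module];
      simp add: summand_bilinear summand_linear linear_mapD(1)[OF comult_linear])
  apply (rule linear_map_compose[OF comult_linear tensor_lift_linear];
      simp add: H_module zx.tensor_module summand_bilinear)
  done

lemma comp1_bilinear:
  assumes "\<phi> \<in> carrier (Mor C z y)" "h \<in> carrier H"
  shows "bilinear_map K (Mor C y x) H P (comp1 \<phi> h)"
  using assms by (intro bilinear_mapI comp1_linear)

definition comp2 where
  "comp2 \<phi> h t = tensor_lift K P (comp1 \<phi> h) t"

lemma comp2_linear:
  shows "\<lbrakk>h \<in> carrier H; t \<in> carrier (tensor_product K (Mor C y x) H)\<rbrakk> \<Longrightarrow>
      linear_map K (Mor C z y) P (\<lambda>\<phi>. comp2 \<phi> h t)"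
    and "\<lbrakk>\<phi> \<in> carrier (Mor C z y); t \<in> carrier (tensor_product K (Mor C y x) H)\<rbrakk> \<Longrightarrow>
      linear_map K H P (\<lambda>h. comp2 \<phi> h t)"
    and "\<lbrakk>\<phi> \<in> carrier (Mor C z y); h \<in> carrier H\<rbrakk> \<Longrightarrow>
      linear_map K (tensor_product K (Mor C y x) H) P (comp2 \<phi> h)"
  unfolding comp2_def[abs_def]
    apply (rule tensor_lift_linear_parameter[OF zy.V.module_axioms yx.V.module_axioms H_module zx.tensor_module];
      simp add: comp1_bilinear comp1_linear)
   apply (rule tensor_lift_linear_parameter[OF H_module yx.V.module_axioms H_module zx.tensor_module];
      simp add: comp1_bilinear comp1_linear)
  apply (rule tensor_lift_linear[OF yx.V.module_axioms H_module zx.tensor_module];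
      simp add: comp1_bilinear)
  done

lemma comp2_bilinear:
  assumes "t \<in> carrier (tensor_product K (Mor C y x) H)"
  shows "bilinear_map K (Mor C z y) H P (\<lambda>\<phi> h. comp2 \<phi> h t)"
  using assms by (intro bilinear_mapI comp2_linear)

lemma smash_Comp_eq:
  "Comp (smash K H C act) z y x s t = tensor_lift K P (\<lambda>\<phi> h. comp2 \<phi> h t) s"
  by (simp add: smash_def summand_def[abs_def] comp1_def[abs_def] comp2_def Let_def)

lemma smash_Comp_bilinear:
  "bilinear_map K (Mor (smash K H C act) z y) (Mor (smash K H C act) y x)
    (Mor (smash K H C act) z x) (Comp (smash K H C act) z y x)"
proof (rule bilinear_mapI)
  have M: "Mor (smash K H C act) v u = tensor_product K (Mor C v u) H" for u v
    by (simp add: smash_def)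
  show "linear_map K (Mor (smash K H C act) y x) (Mor (smash K H C act) z x)
      (Comp (smash K H C act) z y x s)" if "s \<in> carrier (Mor (smash K H C act) z y)" for s
    using that unfolding M smash_Comp_eq[abs_def]
    by (intro tensor_lift_linear_parameter[OF yx.tensor_module zy.V.module_axioms H_module zx.tensor_module])
      (simp_all add: comp2_bilinear comp2_linear)
  show "linear_map K (Mor (smash K H C act) z y) (Mor (smash K H C act) z x)
      (\<lambda>s. Comp (smash K H C act) z y x s t)" if "t \<in> carrier (Mor (smash K H C act) y x)" for t
    using that unfolding M smash_Comp_eq[abs_def]
    by (intro tensor_lift_linear comp2_bilinear zy.V.module_axioms H_module zx.tensor_module)
qed

lemma smash_Comp_pure:
  assumes "\<phi> \<in> carrier (Mor C z y)" "\<psi> \<in> carrier (Mor C y x)" "h' \<in> carrier H" "h \<in> carrier H"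
  shows "Comp (smash K H C act) z y x (pure_tensor K (Mor C z y) H \<phi> h) (pure_tensor K (Mor C y x) H \<psi> h') =
    tensor_lift K P (\<lambda>h\<^sub>1 h\<^sub>2.
     pure_tensor K (Mor C z x) H (Comp C z y x \<phi> (act y x h\<^sub>1 \<psi>)) (h\<^sub>2 \<otimes>\<^bsub>H\<^esub> h')) (comult H h)"
proof -
  have "Comp (smash K H C act) z y x (pure_tensor K (Mor C z y) H \<phi> h) (pure_tensor K (Mor C y x) H \<psi> h') =
    comp2 \<phi> h (pure_tensor K (Mor C y x) H \<psi> h')"
    unfolding smash_Comp_eq
    using assms yx.pure_tensor_closed
    by (intro tensor_lift_pure comp2_bilinear zy.V.module_axioms H_module zx.tensor_module)
  also have "\<dots> = comp1 \<phi> h \<psi> h'"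
    unfolding comp2_def
    using assms by (intro tensor_lift_pure comp1_bilinear yx.V.module_axioms H_module zx.tensor_module)
  finally show ?thesis by (simp add: comp1_def summand_def[abs_def])
qed

end

lemma smash_Mor_module:
  "\<lbrakk>x \<in> Obj C; y \<in> Obj C\<rbrakk> \<Longrightarrow> module K (Mor (smash K H C act) y x)"
  by (simp add: smash_def tensor_pair.tensor_module tensor_pair.intro Mor_module H_module)

end

section \<open>Graded spaces\<close>

locale graded_space = module K V
  for K :: "('k, 'r) ring_scheme" and V :: "('k, 'v, 'x) module_scheme" +
  fixes I :: "'i set" and N :: "'i \<Rightarrow> 'v set"
  assumes direct_sum: "internal_direct_sum K V I N" and finite_I: "finite I"
begin

abbreviation proj where "proj \<equiv> projection V I N"

lemma component_submodule: "i \<in> I \<Longrightarrow> submodule (N i) K V"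
  using direct_sum by (simp add: internal_direct_sum_def)

lemmas component_rules = submoduleE[OF component_submodule]

lemma component_carrier: "\<lbrakk>i \<in> I; v \<in> N i\<rbrakk> \<Longrightarrow> v \<in> carrier V"
  using component_rules(1) by blast

lemma component_zero: "i \<in> I \<Longrightarrow> \<zero>\<^bsub>V\<^esub> \<in> N i"
  using subgroup.one_closed[OF submodule.axioms(1)[OF component_submodule]] by fastforce

text \<open>Decompositions are defined by sums over their support; for a finite index set the sum
  may run over all indices, which spares any discussion of supports below.\<close>

lemma finsum_support:
  assumes "\<And>i. i \<in> I \<Longrightarrow> c i \<in> carrier V"
  shows "(\<Oplus>\<^bsub>V\<^esub>i\<in>{i \<in> I. c i \<noteq> \<zero>\<^bsub>V\<^esub>}. c i) = (\<Oplus>\<^bsub>V\<^esub>i\<in>I. c i)"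
  using assms finite_I by (intro add.finprod_mono_neutral_cong_left) auto

lemma projection_decomposition:
  assumes "v \<in> carrier V"
  shows "is_decomposition V I N v (THE c. is_decomposition V I N v c)"
  using theI'[of "is_decomposition V I N v"] assms direct_sum
  by (simp add: internal_direct_sum_def)

lemma proj_component: "\<lbrakk>v \<in> carrier V; i \<in> I\<rbrakk> \<Longrightarrow> proj i v \<in> N i"
  using projection_decomposition[of v] by (auto simp: projection_def is_decomposition_def)

lemma proj_closed: "\<lbrakk>v \<in> carrier V; i \<in> I\<rbrakk> \<Longrightarrow> proj i v \<in> carrier V"
  using proj_component component_carrier by blast

lemma sum_proj:
  assumes "v \<in> carrier V"
  shows "(\<Oplus>\<^bsub>V\<^esub>i\<in>I. proj i v) = v"
  using projection_decomposition[OF assms] finsum_support[of "\<lambda>i. proj i v"] proj_closed[OF assms]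
  by (simp add: projection_def is_decomposition_def)

text \<open>Uniqueness of decompositions: any family with one member in each component is the
  decomposition of its own sum. All further properties of projections follow by exhibiting such a
  family.\<close>

lemma proj_sum:
  assumes "\<And>i. i \<in> I \<Longrightarrow> c i \<in> N i" "j \<in> I"
  shows "proj j (\<Oplus>\<^bsub>V\<^esub>i\<in>I. c i) = c j"
proof -
  \<comment> \<open>Decompositions are extensional functions, so \<open>c\<close> has to be cut down
    to \<open>I\<close> before uniqueness applies.\<close>
  let ?c = "restrict c I"
  have c: "c i \<in> carrier V" if "i \<in> I" for i using assms(1) component_carrier that by blast
  have v: "(\<Oplus>\<^bsub>V\<^esub>i\<in>I. c i) \<in> carrier V" using c by (intro finsum_closed) auto
  have "(\<Oplus>\<^bsub>V\<^esub>i\<in>I. c i) = (\<Oplus>\<^bsub>V\<^esub>i\<in>I. ?c i)" using c by (intro finsum_cong') auto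
  then have "is_decomposition V I N (\<Oplus>\<^bsub>V\<^esub>i\<in>I. c i) ?c"
    using assms(1) finite_I finsum_support[of ?c] c by (auto simp: is_decomposition_def)
  then have "(THE c'. is_decomposition V I N (\<Oplus>\<^bsub>V\<^esub>i\<in>I. c i) c') = ?c"
    using direct_sum v by (intro the1_equality) (simp_all add: internal_direct_sum_def)
  then show ?thesis using assms(2) by (simp add: projection_def)
qed

lemma proj_homogeneous:
  assumes "v \<in> N i" "i \<in> I" "j \<in> I"
  shows "proj j v = (if j = i then v else \<zero>\<^bsub>V\<^esub>)"
proof -
  have v: "v \<in> carrier V" using assms component_carrier by blast
  have "(\<Oplus>\<^bsub>V\<^esub>j\<in>I. if j = i then v else \<zero>\<^bsub>V\<^esub>) = v"
    using finsum_eq_single[of I i "\<lambda>j. if j = i then v else \<zero>\<^bsub>V\<^esub>"] finite_I assms v by simp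
  then show ?thesis
    using proj_sum[of "\<lambda>j. if j = i then v else \<zero>\<^bsub>V\<^esub>" j] assms component_zero by auto
qed

text \<open>Components are submodules, so sums and multiples of decompositions are again
  decompositions.\<close>

lemma proj_linear:
  assumes "j \<in> I"
  shows "linear_map K V V (proj j)"
proof (rule linear_mapI)
  show "proj j v \<in> carrier V" if "v \<in> carrier V" for v using that assms by (rule proj_closed)
  show "proj j (u \<oplus>\<^bsub>V\<^esub> v) = proj j u \<oplus>\<^bsub>V\<^esub> proj j v" if "u \<in> carrier V" "v \<in> carrier V" for u v
  proof -
    have "(\<Oplus>\<^bsub>V\<^esub>i\<in>I. proj i u \<oplus>\<^bsub>V\<^esub> proj i v) = u \<oplus>\<^bsub>V\<^esub> v"
      using that by (subst finsum_addf) (auto simp: proj_closed sum_proj)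
    then show ?thesis
      using proj_sum[of "\<lambda>i. proj i u \<oplus>\<^bsub>V\<^esub> proj i v" j] that assms
      by (simp add: component_rules(5) proj_component)
  qed
  show "proj j (a \<odot>\<^bsub>V\<^esub> v) = a \<odot>\<^bsub>V\<^esub> proj j v" if "a \<in> carrier K" "v \<in> carrier V" for a v
  proof -
    have "(\<Oplus>\<^bsub>V\<^esub>i\<in>I. a \<odot>\<^bsub>V\<^esub> proj i v) = a \<odot>\<^bsub>V\<^esub> v"
      using that finite_I by (subst finsum_smult_ldistr[symmetric]) (auto simp: proj_closed sum_proj)
    then show ?thesis
      using proj_sum[of "\<lambda>i. a \<odot>\<^bsub>V\<^esub> proj i v" j] that assms
      by (simp add: component_rules(4) proj_component)
  qed
qed

lemma proj_eqI:
  assumes "u \<in> carrier V" "v \<in> carrier V" "\<And>i. i \<in> I \<Longrightarrow> proj i u = proj i v"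
  shows "u = v"
proof -
  have "(\<Oplus>\<^bsub>V\<^esub>i\<in>I. proj i u) = (\<Oplus>\<^bsub>V\<^esub>i\<in>I. proj i v)"
    using assms by (intro finsum_cong') (auto simp: proj_closed)
  then show ?thesis using assms by (simp add: sum_proj)
qed

end

lemma (in abelian_monoid) finsum_induct:
  assumes "\<And>i. i \<in> A \<Longrightarrow> f i \<in> carrier G" "\<And>i. i \<in> A \<Longrightarrow> P (f i)" "P \<zero>"
    and "\<And>x y. \<lbrakk>x \<in> carrier G; y \<in> carrier G; P x; P y\<rbrakk> \<Longrightarrow> P (x \<oplus> y)"
  shows "P (finsum G f A)"
  using assms(1,2)
proof (induction A rule: infinite_finite_induct)
  case (insert i A)
  then show ?case
    using assms(4)[of "f i" "finsum G f A"] by (simp add: Pi_def)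
qed (simp_all add: assms(3))

text \<open>The index set must be inhabited so that zero, the empty sum, is reached as a homogeneous
  element.\<close>

lemma (in graded_space) homogeneous_induct [consumes 2, case_names homogeneous add]:
  assumes "v \<in> carrier V" "I \<noteq> {}"
    and hom: "\<And>i v. \<lbrakk>i \<in> I; v \<in> N i\<rbrakk> \<Longrightarrow> P v"
    and add: "\<And>u v. \<lbrakk>u \<in> carrier V; v \<in> carrier V; P u; P v\<rbrakk> \<Longrightarrow> P (u \<oplus>\<^bsub>V\<^esub> v)"
  shows "P v"
proof -
  have "P (\<Oplus>\<^bsub>V\<^esub>i\<in>I. proj i v)"
  proof (rule finsum_induct)
    show "P \<zero>\<^bsub>V\<^esub>" using assms(2) hom component_zero by blast
  qed (use assms in \<open>auto intro: proj_closed hom proj_component\<close>)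
  then show ?thesis using assms(1) by (simp add: sum_proj)
qed

section \<open>The Hopf algebras of a finite group\<close>

text \<open>\<open>k\<^sup>G\<close> and \<open>kG\<close> have the same underlying vector space of
  functions on the group and differ in products and comultiplications. The locale fixes only the
  linear structure and so serves both.\<close>

locale function_space = G: group G + K: field K
  for K :: "('k, 'r) ring_scheme" and G :: "('g, 's) monoid_scheme" +
  fixes H :: "('k, 'g \<Rightarrow> 'k, 'z) module_scheme"
  assumes finite_G: "finite (carrier G)"
    and H_carrier: "carrier H = carrier G \<rightarrow>\<^sub>E carrier K"
    and H_zero: "\<zero>\<^bsub>H\<^esub> = (\<lambda>s\<in>carrier G. \<zero>\<^bsub>K\<^esub>)"
    and H_add: "add H = (\<lambda>a b. \<lambda>s\<in>carrier G. a s \<oplus>\<^bsub>K\<^esub> b s)"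
    and H_smult: "smult H = (\<lambda>c a. \<lambda>s\<in>carrier G. c \<otimes>\<^bsub>K\<^esub> a s)"
begin

lemma H_apply:
  "s \<in> carrier G \<Longrightarrow> (a \<oplus>\<^bsub>H\<^esub> b) s = a s \<oplus>\<^bsub>K\<^esub> b s"
  "s \<in> carrier G \<Longrightarrow> (c \<odot>\<^bsub>H\<^esub> a) s = c \<otimes>\<^bsub>K\<^esub> a s"
  "s \<in> carrier G \<Longrightarrow> \<zero>\<^bsub>H\<^esub> s = \<zero>\<^bsub>K\<^esub>"
  "a \<in> carrier H \<Longrightarrow> s \<in> carrier G \<Longrightarrow> a s \<in> carrier K"
  by (auto simp: H_add H_smult H_zero H_carrier)

lemma H_eqI:
  assumes "a \<in> carrier H" "b \<in> carrier H" "\<And>s. s \<in> carrier G \<Longrightarrow> a s = b s"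
  shows "a = b"
  using assms by (auto simp: H_carrier intro: PiE_ext)

lemma restrict_closed:
  "(\<And>s. s \<in> carrier G \<Longrightarrow> f s \<in> carrier K) \<Longrightarrow> restrict f (carrier G) \<in> carrier H"
  by (simp add: H_carrier)

lemma H_module: "module K H"
proof -
  have closed: "\<lbrakk>a \<in> carrier H; b \<in> carrier H\<rbrakk> \<Longrightarrow> a \<oplus>\<^bsub>H\<^esub> b \<in> carrier H"
    "\<lbrakk>c \<in> carrier K; a \<in> carrier H\<rbrakk> \<Longrightarrow> c \<odot>\<^bsub>H\<^esub> a \<in> carrier H" for a b c
    using H_apply(4) by (auto simp: H_add H_smult intro!: restrict_closed)
  have zero_closed: "\<zero>\<^bsub>H\<^esub> \<in> carrier H"
    by (simp add: H_zero restrict_closed)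
  have "abelian_group H"
  proof (rule abelian_groupI)
    fix a assume a: "a \<in> carrier H"
    let ?b = "\<lambda>s\<in>carrier G. \<ominus>\<^bsub>K\<^esub> a s"
    have b: "?b \<in> carrier H" using a by (intro restrict_closed) (simp add: H_apply)
    have "?b \<oplus>\<^bsub>H\<^esub> a = \<zero>\<^bsub>H\<^esub>"
      using a b by (intro H_eqI closed zero_closed) (simp_all add: H_apply K.l_neg)
    with b show "\<exists>b\<in>carrier H. b \<oplus>\<^bsub>H\<^esub> a = \<zero>\<^bsub>H\<^esub>" by blast
  qed (auto simp: closed zero_closed H_apply K.a_ac intro!: H_eqI)
  then show ?thesis
    by (rule moduleI[OF K.cring_axioms])
      (auto simp: closed H_apply K.l_distr K.r_distr K.m_assoc intro!: H_eqI)
qed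

sublocale H: module K H by (rule H_module)

lemma delta_closed: "delta K G s \<in> carrier H"
  by (auto simp: H_carrier delta_def)

lemma delta_apply: "u \<in> carrier G \<Longrightarrow> delta K G s u = (if u = s then \<one>\<^bsub>K\<^esub> else \<zero>\<^bsub>K\<^esub>)"
  by (simp add: delta_def)

text \<open>The index map \<open>f\<close> is there for the comultiplication of
  \<open>k\<^sup>G\<close>, a sum over pairs whose coefficients are the values of \<open>a\<close>
  at the products of the pairs. Elsewhere \<open>f\<close> is the identity.\<close>

lemma linear_extension:
  assumes "module K P" "\<And>s. s \<in> A \<Longrightarrow> f s \<in> carrier G" "\<And>s. s \<in> A \<Longrightarrow> x s \<in> carrier P" "finite A"
  shows "linear_map K H P (\<lambda>a. \<Oplus>\<^bsub>P\<^esub>s\<in>A. a (f s) \<odot>\<^bsub>P\<^esub> x s)"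
proof -
  interpret P: module K P by fact
  show ?thesis
    using assms(2-4)
    by (intro P.linear_map_finsumI linear_mapI)
      (auto simp: H_apply P.smult_l_distr P.smult_assoc1)
qed

lemma linear_extension_delta:
  assumes "module K P" "\<And>s. s \<in> carrier G \<Longrightarrow> x s \<in> carrier P" "u \<in> carrier G"
  shows "(\<Oplus>\<^bsub>P\<^esub>s\<in>carrier G. delta K G u s \<odot>\<^bsub>P\<^esub> x s) = x u"
proof -
  interpret P: module K P by fact
  show ?thesis
    using assms(2,3) finite_G
    by (subst P.finsum_eq_single[of _ u]) (auto simp: delta_apply)
qed

lemma H_finsum_apply:
  assumes "\<And>i. i \<in> A \<Longrightarrow> f i \<in> carrier H" "s \<in> carrier G"
  shows "(\<Oplus>\<^bsub>H\<^esub>i\<in>A. f i) s = (\<Oplus>\<^bsub>K\<^esub>i\<in>A. f i s)"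
  using assms
proof (induction A rule: infinite_finite_induct)
  case (insert i A)
  then show ?case by (simp add: H_apply Pi_def)
qed (simp_all add: H_zero)

lemma delta_expansion:
  assumes "a \<in> carrier H"
  shows "a = (\<Oplus>\<^bsub>H\<^esub>s\<in>carrier G. a s \<odot>\<^bsub>H\<^esub> delta K G s)"
proof (rule H_eqI)
  have closed: "a s \<odot>\<^bsub>H\<^esub> delta K G s \<in> carrier H" if "s \<in> carrier G" for s
    using that assms delta_closed by (simp add: H_apply)
  show "(\<Oplus>\<^bsub>H\<^esub>s\<in>carrier G. a s \<odot>\<^bsub>H\<^esub> delta K G s) \<in> carrier H"
    using closed by (intro H.finsum_closed) auto
  fix u assume u: "u \<in> carrier G"
  have "(\<Oplus>\<^bsub>H\<^esub>s\<in>carrier G. a s \<odot>\<^bsub>H\<^esub> delta K G s) u = (\<Oplus>\<^bsub>K\<^esub>s\<in>carrier G. (a s \<odot>\<^bsub>H\<^esub> delta K G s) u)"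
    using closed u by (rule H_finsum_apply)
  also have "\<dots> = (\<Oplus>\<^bsub>K\<^esub>s\<in>carrier G. if u = s then a s else \<zero>\<^bsub>K\<^esub>)"
    using assms u by (intro K.finsum_cong') (auto simp: H_apply delta_apply)
  also have "\<dots> = a u"
    using assms u finite_G by (intro K.finsum_singleton) (auto simp: H_apply)
  finally show "a u = (\<Oplus>\<^bsub>H\<^esub>s\<in>carrier G. a s \<odot>\<^bsub>H\<^esub> delta K G s) u" by simp
qed (use assms in simp)

end

section \<open>Coordinates on a tensor product with functions on the group\<close>

locale function_tensor = function_space K G H + V: module K V
  for K :: "('k, 'r) ring_scheme" and G :: "('g, 's) monoid_scheme"
    and H :: "('k, 'g \<Rightarrow> 'k, 'z) module_scheme" and V :: "('k, 'v, 'x) module_scheme"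
begin

sublocale tensor_pair K V H
  by (intro tensor_pair.intro V.module_axioms H_module)

notation tensor (infixl \<open>\<otimes>\<^sub>t\<close> 72)

text \<open>The deltas form a basis of \<open>H\<close>, so \<open>V \<otimes> H\<close> is a sum of
  copies of \<open>V\<close> indexed by the group. Evaluating the second factor at \<open>s\<close>
  gives the projection onto the copy at \<open>s\<close>.\<close>

abbreviation coord where "coord s \<equiv> tensor_lift K V (\<lambda>v a. a s \<odot>\<^bsub>V\<^esub> v)"

lemma coord_bilinear:
  "s \<in> carrier G \<Longrightarrow> bilinear_map K V H V (\<lambda>v a. a s \<odot>\<^bsub>V\<^esub> v)"
  by (intro bilinear_mapI linear_mapI)
    (auto simp: H_apply V.smult_l_distr V.smult_r_distr V.smult_assoc1[symmetric] K.m_comm)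

lemma coord_linear: "s \<in> carrier G \<Longrightarrow> linear_map K T V (coord s)"
  by (intro tensor_lift_linear V.module_axioms H_module coord_bilinear)

lemma coord_pure:
  "\<lbrakk>s \<in> carrier G; v \<in> carrier V; a \<in> carrier H\<rbrakk> \<Longrightarrow> coord s (v \<otimes>\<^sub>t a) = a s \<odot>\<^bsub>V\<^esub> v"
  by (intro tensor_lift_pure V.module_axioms H_module coord_bilinear)

text \<open>Both sides are linear in \<open>t\<close>. On a pure tensor the scalars
  \<open>a s\<close> move from the first factor to the second, where they reassemble
  \<open>a\<close> from the deltas.\<close>

lemma coord_expansion:
  assumes "t \<in> carrier T"
  shows "(\<Oplus>\<^bsub>T\<^esub>s\<in>carrier G. coord s t \<otimes>\<^sub>t delta K G s) = t"
proof (rule linear_map_eq_on_pure[OF _ _ assms])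
  show "linear_map K T T (\<lambda>t. t)" by (rule linear_mapI) auto
  show "linear_map K T T (\<lambda>t. \<Oplus>\<^bsub>T\<^esub>s\<in>carrier G. coord s t \<otimes>\<^sub>t delta K G s)"
    using finite_G
    by (intro T.linear_map_finsumI linear_map_compose[OF coord_linear]
        bilinear_mapD(2)[OF pure_tensor_bilinear] delta_closed)
  fix v a assume va: "v \<in> carrier V" "a \<in> carrier H"
  note lin = bilinear_mapD[OF pure_tensor_bilinear]
  have "(\<Oplus>\<^bsub>T\<^esub>s\<in>carrier G. coord s (v \<otimes>\<^sub>t a) \<otimes>\<^sub>t delta K G s) =
      (\<Oplus>\<^bsub>T\<^esub>s\<in>carrier G. v \<otimes>\<^sub>t (a s \<odot>\<^bsub>H\<^esub> delta K G s))"
    using va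
    by (intro T.finsum_cong')
      (auto simp: coord_pure linear_mapD(3)[OF lin(1)] linear_mapD(3)[OF lin(2)] delta_closed
        H_apply pure_tensor_closed)
  also have "\<dots> = v \<otimes>\<^sub>t (\<Oplus>\<^bsub>H\<^esub>s\<in>carrier G. a s \<odot>\<^bsub>H\<^esub> delta K G s)"
    using va
    by (intro linear_map_finsum[OF H_module tensor_module lin(1), symmetric])
      (auto simp: H_apply delta_closed)
  also have "\<dots> = v \<otimes>\<^sub>t a" using delta_expansion[OF va(2)] by simp
  finally show "(\<Oplus>\<^bsub>T\<^esub>s\<in>carrier G. coord s (v \<otimes>\<^sub>t a) \<otimes>\<^sub>t delta K G s) = v \<otimes>\<^sub>t a" .
qed

lemma coord_sum:
  assumes "\<And>s. s \<in> carrier G \<Longrightarrow> c s \<in> carrier V" "r \<in> carrier G"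
  shows "coord r (\<Oplus>\<^bsub>T\<^esub>s\<in>carrier G. c s \<otimes>\<^sub>t delta K G s) = c r"
proof -
  have "coord r (\<Oplus>\<^bsub>T\<^esub>s\<in>carrier G. c s \<otimes>\<^sub>t delta K G s) =
      (\<Oplus>\<^bsub>V\<^esub>s\<in>carrier G. coord r (c s \<otimes>\<^sub>t delta K G s))"
    using assms
    by (intro linear_map_finsum[OF tensor_module V.module_axioms coord_linear])
      (auto simp: pure_tensor_closed delta_closed)
  also have "\<dots> = c r"
    using assms finite_G
    by (subst V.finsum_eq_single[of _ r]) (auto simp: coord_pure delta_closed delta_apply)
  finally show ?thesis .
qed

lemma coord_eqI:
  assumes "t \<in> carrier T" "t' \<in> carrier T" "\<And>s. s \<in> carrier G \<Longrightarrow> coord s t = coord s t'"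
  shows "t = t'"
proof -
  have "(\<Oplus>\<^bsub>T\<^esub>s\<in>carrier G. coord s t \<otimes>\<^sub>t delta K G s) =
      (\<Oplus>\<^bsub>T\<^esub>s\<in>carrier G. coord s t' \<otimes>\<^sub>t delta K G s)"
    using assms linear_mapD(1)[OF coord_linear]
    by (intro T.finsum_cong') (auto simp: pure_tensor_closed delta_closed)
  then show ?thesis using assms by (simp add: coord_expansion)
qed

lemma delta_induct [consumes 1, case_names delta add]:
  assumes "t \<in> carrier T"
    and delta: "\<And>v s. \<lbrakk>v \<in> carrier V; s \<in> carrier G\<rbrakk> \<Longrightarrow> P (v \<otimes>\<^sub>t delta K G s)"
    and add: "\<And>t t'. \<lbrakk>t \<in> carrier T; t' \<in> carrier T; P t; P t'\<rbrakk> \<Longrightarrow> P (t \<oplus>\<^bsub>T\<^esub> t')"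
  shows "P t"
proof -
  have "P (\<Oplus>\<^bsub>T\<^esub>s\<in>carrier G. coord s t \<otimes>\<^sub>t delta K G s)"
  proof (rule T.finsum_induct)
    \<comment> \<open>The induction over the sum starts at zero, which has to be presented as a
      tensor with some delta; the neutral element supplies one.\<close>
    have "\<zero>\<^bsub>V\<^esub> \<otimes>\<^sub>t delta K G \<one>\<^bsub>G\<^esub> = \<zero>\<^bsub>T\<^esub>"
      by (rule linear_map_zero[OF V.module_axioms tensor_module])
        (intro bilinear_mapD(2)[OF pure_tensor_bilinear] delta_closed)
    then show "P \<zero>\<^bsub>T\<^esub>" using delta[of "\<zero>\<^bsub>V\<^esub>" "\<one>\<^bsub>G\<^esub>"] by simp
  qed (use assms linear_mapD(1)[OF coord_linear] in \<open>auto simp: pure_tensor_closed delta_closed\<close>)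
  then show ?thesis using assms(1) by (simp add: coord_expansion)
qed

end

section \<open>Products and comultiplications on the delta basis\<close>

context
  fixes K :: "('k, 'r) ring_scheme" and G :: "('g, 's) monoid_scheme"
  assumes K: "field K" and G: "group G" and fin: "finite (carrier G)"
begin

interpretation K: field K by (rule K)
interpretation G: group G by (rule G)

lemma function_hopf_space: "function_space K G (function_hopf K G)"
  by (intro function_space.intro function_space_axioms.intro K G fin)
    (simp_all add: function_hopf_def function_algebra_def module.extend_def hopf.fields_def Let_def)

lemma group_hopf_space: "function_space K G (group_hopf K G)"
  by (intro function_space.intro function_space_axioms.intro K G fin)
    (simp_all add: group_hopf_def group_algebra_def function_algebra_def module.extend_def
      hopf.fields_def Let_def)

interpretation A: function_space K G "function_hopf K G" by (rule function_hopf_space)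
interpretation D: function_space K G "group_hopf K G" by (rule group_hopf_space)

interpretation AA: tensor_pair K "function_hopf K G" "function_hopf K G"
  by (intro tensor_pair.intro A.H_module)
interpretation DD: tensor_pair K "group_hopf K G" "group_hopf K G"
  by (intro tensor_pair.intro D.H_module)

lemma function_hopf_mult:
  "mult (function_hopf K G) = (\<lambda>a b. \<lambda>s\<in>carrier G. a s \<otimes>\<^bsub>K\<^esub> b s)"
  "\<one>\<^bsub>function_hopf K G\<^esub> = (\<lambda>s\<in>carrier G. \<one>\<^bsub>K\<^esub>)"
  by (simp_all add: function_hopf_def function_algebra_def module.extend_def hopf.fields_def Let_def)

lemma group_hopf_mult:
  "mult (group_hopf K G) =
    (\<lambda>a b. \<lambda>s\<in>carrier G. \<Oplus>\<^bsub>K\<^esub>u\<in>carrier G. a u \<otimes>\<^bsub>K\<^esub> b (inv\<^bsub>G\<^esub> u \<otimes>\<^bsub>G\<^esub> s))"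
  "\<one>\<^bsub>group_hopf K G\<^esub> = delta K G \<one>\<^bsub>G\<^esub>"
  by (simp_all add: group_hopf_def group_algebra_def function_algebra_def module.extend_def
      hopf.fields_def Let_def)

lemma function_hopf_comult:
  "comult (function_hopf K G) = (\<lambda>a. \<Oplus>\<^bsub>AA.T\<^esub>p\<in>carrier G \<times> carrier G.
    a (fst p \<otimes>\<^bsub>G\<^esub> snd p) \<odot>\<^bsub>AA.T\<^esub> AA.tensor (delta K G (fst p)) (delta K G (snd p)))"
proof -
  let ?A = "function_algebra K G" and ?H = "function_hopf K G"
  have eqs: "carrier ?A = carrier ?H" "add ?A = add ?H" "smult ?A = smult ?H"
    by (simp_all add: function_hopf_def function_algebra_def module.extend_def hopf.fields_def Let_def)
  note cong = tensor_product_cong[OF eqs eqs]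
  have "comult ?H = (\<lambda>a. \<Oplus>\<^bsub>tensor_product K ?A ?A\<^esub>p\<in>carrier G \<times> carrier G.
    a (fst p \<otimes>\<^bsub>G\<^esub> snd p) \<odot>\<^bsub>tensor_product K ?A ?A\<^esub>
      pure_tensor K ?A ?A (delta K G (fst p)) (delta K G (snd p)))"
    by (simp add: function_hopf_def module.extend_def hopf.fields_def Let_def)
  then show ?thesis unfolding cong .
qed

lemma group_hopf_comult:
  "comult (group_hopf K G) = (\<lambda>a. \<Oplus>\<^bsub>DD.T\<^esub>s\<in>carrier G.
    a s \<odot>\<^bsub>DD.T\<^esub> DD.tensor (delta K G s) (delta K G s))"
proof -
  let ?A = "group_algebra K G" and ?H = "group_hopf K G"
  have eqs: "carrier ?A = carrier ?H" "add ?A = add ?H" "smult ?A = smult ?H"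
    by (simp_all add: group_hopf_def module.extend_def hopf.fields_def Let_def)
  note cong = tensor_product_cong[OF eqs eqs]
  have "comult ?H = (\<lambda>a. \<Oplus>\<^bsub>tensor_product K ?A ?A\<^esub>s\<in>carrier G.
    a s \<odot>\<^bsub>tensor_product K ?A ?A\<^esub> pure_tensor K ?A ?A (delta K G s) (delta K G s))"
    by (simp add: group_hopf_def module.extend_def hopf.fields_def Let_def)
  then show ?thesis unfolding cong .
qed

lemma function_hopf_comult_linear:
  "linear_map K (function_hopf K G) AA.T (comult (function_hopf K G))"
  unfolding function_hopf_comult
  using fin by (intro A.linear_extension AA.tensor_module AA.pure_tensor_closed A.delta_closed) auto

lemma group_hopf_comult_linear:
  "linear_map K (group_hopf K G) DD.T (comult (group_hopf K G))"
  unfolding group_hopf_comult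
  using fin by (intro D.linear_extension DD.tensor_module DD.pure_tensor_closed D.delta_closed) auto

text \<open>Group elements are group-like; hence Sweedler sums for the outer smash product have a
  single term.\<close>

lemma group_hopf_comult_delta:
  "s \<in> carrier G \<Longrightarrow> comult (group_hopf K G) (delta K G s) = DD.tensor (delta K G s) (delta K G s)"
  unfolding group_hopf_comult
  by (intro D.linear_extension_delta DD.tensor_module DD.pure_tensor_closed D.delta_closed)

lemma function_hopf_mult_bilinear:
  "bilinear_map K (function_hopf K G) (function_hopf K G) (function_hopf K G) (mult (function_hopf K G))"
proof -
  let ?A = "function_hopf K G"
  have closed: "a \<otimes>\<^bsub>?A\<^esub> b \<in> carrier ?A" if "a \<in> carrier ?A" "b \<in> carrier ?A" for a b
    using that unfolding function_hopf_mult by (intro A.restrict_closed) (simp add: A.H_apply)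
  have mult_apply: "(a \<otimes>\<^bsub>?A\<^esub> b) s = a s \<otimes>\<^bsub>K\<^esub> b s" if "s \<in> carrier G" for a b s
    using that by (simp add: function_hopf_mult)
  show ?thesis
    by (intro bilinear_mapI linear_mapI)
      (auto simp: closed mult_apply A.H_apply K.l_distr K.r_distr K.m_ac intro!: A.H_eqI)
qed

lemma function_hopf_mult_delta:
  "\<lbrakk>s \<in> carrier G; t \<in> carrier G\<rbrakk> \<Longrightarrow> delta K G s \<otimes>\<^bsub>function_hopf K G\<^esub> delta K G t =
    (if s = t then delta K G t else \<zero>\<^bsub>function_hopf K G\<^esub>)"
  by (auto simp: function_hopf_mult A.H_zero delta_def fun_eq_iff)

lemma group_hopf_mult_bilinear:
  "bilinear_map K (group_hopf K G) (group_hopf K G) (group_hopf K G) (mult (group_hopf K G))"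
proof -
  let ?D = "group_hopf K G"
  have closed: "a \<otimes>\<^bsub>?D\<^esub> b \<in> carrier ?D" if "a \<in> carrier ?D" "b \<in> carrier ?D" for a b
    using that unfolding group_hopf_mult
    by (intro D.restrict_closed K.finsum_closed) (auto simp: D.H_apply)
  have mult_apply: "(a \<otimes>\<^bsub>?D\<^esub> b) s = (\<Oplus>\<^bsub>K\<^esub>u\<in>carrier G. a u \<otimes>\<^bsub>K\<^esub> b (inv\<^bsub>G\<^esub> u \<otimes>\<^bsub>G\<^esub> s))"
    if "s \<in> carrier G" for a b s
    using that by (simp add: group_hopf_mult)
  note app = mult_apply D.H_apply
  \<comment> \<open>This and \<open>sum_smult\<close> are shaped as introduction rules: a law for
    convolutions is reduced to an identity between the summands.\<close>
  have sum_add: "(\<Oplus>\<^bsub>K\<^esub>u\<in>carrier G. f u) = (\<Oplus>\<^bsub>K\<^esub>u\<in>carrier G. g u) \<oplus>\<^bsub>K\<^esub> (\<Oplus>\<^bsub>K\<^esub>u\<in>carrier G. h u)"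
    if "\<And>u. u \<in> carrier G \<Longrightarrow> f u = g u \<oplus>\<^bsub>K\<^esub> h u" "\<And>u. u \<in> carrier G \<Longrightarrow> g u \<in> carrier K"
      "\<And>u. u \<in> carrier G \<Longrightarrow> h u \<in> carrier K" for f g h
  proof -
    have "(\<Oplus>\<^bsub>K\<^esub>u\<in>carrier G. f u) = (\<Oplus>\<^bsub>K\<^esub>u\<in>carrier G. g u \<oplus>\<^bsub>K\<^esub> h u)"
      using that by (intro K.finsum_cong') auto
    also have "\<dots> = (\<Oplus>\<^bsub>K\<^esub>u\<in>carrier G. g u) \<oplus>\<^bsub>K\<^esub> (\<Oplus>\<^bsub>K\<^esub>u\<in>carrier G. h u)"
      using that by (intro K.finsum_addf) auto
    finally show ?thesis .
  qed
  have sum_smult: "(\<Oplus>\<^bsub>K\<^esub>u\<in>carrier G. f u) = c \<otimes>\<^bsub>K\<^esub> (\<Oplus>\<^bsub>K\<^esub>u\<in>carrier G. g u)"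
    if "\<And>u. u \<in> carrier G \<Longrightarrow> f u = c \<otimes>\<^bsub>K\<^esub> g u" "\<And>u. u \<in> carrier G \<Longrightarrow> g u \<in> carrier K"
      "c \<in> carrier K" for f g c
    using that fin by (subst K.finsum_rdistr) (auto intro!: K.finsum_cong')
  show ?thesis
    by (intro bilinear_mapI linear_mapI)
      (auto simp: closed app K.l_distr K.r_distr K.m_ac intro!: D.H_eqI sum_add sum_smult)
qed

text \<open>The first delta concentrates the convolution sum at \<open>u = s\<close>; what is left
  tests whether \<open>r\<close> is the product of \<open>s\<close> and \<open>t\<close>.\<close>

lemma group_hopf_mult_delta:
  assumes "s \<in> carrier G" "t \<in> carrier G"
  shows "delta K G s \<otimes>\<^bsub>group_hopf K G\<^esub> delta K G t = delta K G (s \<otimes>\<^bsub>G\<^esub> t)"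
proof (rule D.H_eqI)
  show "delta K G s \<otimes>\<^bsub>group_hopf K G\<^esub> delta K G t \<in> carrier (group_hopf K G)"
    by (intro bilinear_map_closed[OF group_hopf_mult_bilinear] D.delta_closed)
  fix r assume r: "r \<in> carrier G"
  have iff: "inv\<^bsub>G\<^esub> s \<otimes>\<^bsub>G\<^esub> r = t \<longleftrightarrow> r = s \<otimes>\<^bsub>G\<^esub> t"
    using assms r by (metis G.inv_solve_left G.m_closed)
  have "(delta K G s \<otimes>\<^bsub>group_hopf K G\<^esub> delta K G t) r =
      (\<Oplus>\<^bsub>K\<^esub>u\<in>carrier G. if s = u then delta K G t (inv\<^bsub>G\<^esub> u \<otimes>\<^bsub>G\<^esub> r) else \<zero>\<^bsub>K\<^esub>)"
    using r by (auto simp: group_hopf_mult delta_def intro!: K.finsum_cong')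
  also have "\<dots> = delta K G t (inv\<^bsub>G\<^esub> s \<otimes>\<^bsub>G\<^esub> r)"
    using fin assms r by (intro K.finsum_singleton) (auto simp: delta_def)
  also have "\<dots> = delta K G (s \<otimes>\<^bsub>G\<^esub> t) r"
    using assms r by (simp add: delta_def iff)
  finally show "(delta K G s \<otimes>\<^bsub>group_hopf K G\<^esub> delta K G t) r = delta K G (s \<otimes>\<^bsub>G\<^esub> t) r" .
qed (rule D.delta_closed)

end

section \<open>The two smash categories\<close>

lemma smash_simps:
  "Obj (smash K H C act) = Obj C"
  "Mor (smash K H C act) y x = tensor_product K (Mor C y x) H"
  "Ident (smash K H C act) x = pure_tensor K (Mor C x x) H (Ident C x) \<one>\<^bsub>H\<^esub>"
  by (simp_all add: smash_def)

locale finite_grading = K: field K + G: group G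
  for K :: "('k, 'r) ring_scheme" and G :: "('g, 's) monoid_scheme" +
  fixes B :: "('o, 'k, 'm) kcat" and E :: "'o \<Rightarrow> 'o \<Rightarrow> 'g \<Rightarrow> 'm set"
  assumes graded: "graded_k_category K G B E" and finite_G: "finite (carrier G)"
begin

abbreviation A where "A \<equiv> function_hopf K G"
abbreviation D where "D \<equiv> group_hopf K G"
abbreviation S where "S \<equiv> graded_smash K G B E"
abbreviation X where "X \<equiv> smash K D S (translation_action K G B)"
abbreviation \<delta> where "\<delta> \<equiv> delta K G"
abbreviation proj where "proj y x \<equiv> projection (Mor B y x) (carrier G) (E y x)"

lemma K_field: "field K" ..
lemma G_group: "group G" ..

sublocale A: function_space K G A
  using K_field G_group finite_G by (rule function_hopf_space)
sublocale D: function_space K G D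
  using K_field G_group finite_G by (rule group_hopf_space)

sublocale B: k_category K B
  using graded by (rule graded_k_category.axioms)

lemmas grading_Comp = graded_k_category.grading_Comp[OF graded]

lemma Mor_graded: "\<lbrakk>x \<in> Obj B; y \<in> Obj B\<rbrakk> \<Longrightarrow> graded_space K (Mor B y x) (carrier G) (E y x)"
  using graded_k_category.grading[OF graded] finite_G
  by (intro graded_space.intro graded_space_axioms.intro B.Mor_module)

lemma Mor_tensor: "\<lbrakk>x \<in> Obj B; y \<in> Obj B\<rbrakk> \<Longrightarrow> function_tensor K G A (Mor B y x)"
  by (intro function_tensor.intro B.Mor_module A.function_space_axioms)

lemma grading_action_bilinear:
  assumes "x \<in> Obj B" "y \<in> Obj B"
  shows "bilinear_map K A (Mor B y x) (Mor B y x) (grading_action G B E y x)"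
proof -
  interpret yx: graded_space K "Mor B y x" "carrier G" "E y x" by (intro Mor_graded assms)
  show ?thesis
  proof (rule bilinear_mapI)
    fix f assume "f \<in> carrier (Mor B y x)"
    then show "linear_map K A (Mor B y x) (\<lambda>a. grading_action G B E y x a f)"
      unfolding grading_action_def
      by (intro A.linear_extension yx.module_axioms finite_G yx.proj_closed)
  next
    fix a assume "a \<in> carrier A"
    then show "linear_map K (Mor B y x) (Mor B y x) (grading_action G B E y x a)"
      unfolding grading_action_def[abs_def]
      by (intro yx.linear_map_finsumI yx.linear_map_smultI yx.proj_linear finite_G A.H_apply)
  qed
qed

lemma grading_action_delta:
  assumes "x \<in> Obj B" "y \<in> Obj B" "f \<in> carrier (Mor B y x)" "s \<in> carrier G"
  shows "grading_action G B E y x (\<delta> s) f = proj y x s f"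
proof -
  interpret yx: graded_space K "Mor B y x" "carrier G" "E y x" by (intro Mor_graded assms)
  show ?thesis
    unfolding grading_action_def
    using assms by (intro A.linear_extension_delta yx.module_axioms yx.proj_closed)
qed

sublocale SD: smash_data K A B "grading_action G B E"
  using function_hopf_mult_bilinear[OF K_field G_group finite_G]
    function_hopf_comult_linear[OF K_field G_group finite_G]
  by (intro smash_data.intro B.Mor_module B.Comp_bilinear A.H_module grading_action_bilinear)

lemma S_simps:
  "Obj S = Obj B"
  "Mor S y x = tensor_product K (Mor B y x) A"
  "Ident S x = pure_tensor K (Mor B x x) A (Ident B x) \<one>\<^bsub>A\<^esub>"
  by (simp_all add: graded_smash_def smash_simps)

lemma S_module: "\<lbrakk>x \<in> Obj B; y \<in> Obj B\<rbrakk> \<Longrightarrow> module K (Mor S y x)"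
  unfolding graded_smash_def by (rule SD.smash_Mor_module)

lemma S_Comp_bilinear:
  "\<lbrakk>x \<in> Obj B; y \<in> Obj B; z \<in> Obj B\<rbrakk> \<Longrightarrow>
    bilinear_map K (Mor S z y) (Mor S y x) (Mor S z x) (Comp S z y x)"
  unfolding graded_smash_def by (rule SD.smash_Comp_bilinear)

text \<open>The comultiplication of \<open>\<delta> s\<close> is the sum of
  \<open>\<delta> u \<otimes> \<delta> v\<close> over all \<open>u\<close>, \<open>v\<close> with
  product \<open>s\<close>. Deltas are orthogonal idempotents, so multiplying the second factor by
  \<open>\<delta> t\<close> leaves only \<open>v = t\<close>, which forces \<open>u\<close> to be
  \<open>s\<close> times the inverse of \<open>t\<close>. The action of \<open>\<delta> u\<close>
  then projects \<open>g\<close> onto that degree.\<close>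

lemma S_Comp_pure:
  assumes obj: "x \<in> Obj B" "y \<in> Obj B" "z \<in> Obj B"
    and f: "f \<in> carrier (Mor B z y)" and g: "g \<in> carrier (Mor B y x)"
    and s: "s \<in> carrier G" and t: "t \<in> carrier G"
  shows "Comp S z y x (pure_tensor K (Mor B z y) A f (\<delta> s)) (pure_tensor K (Mor B y x) A g (\<delta> t)) =
    pure_tensor K (Mor B z x) A (Comp B z y x f (proj y x (s \<otimes>\<^bsub>G\<^esub> inv\<^bsub>G\<^esub> t) g)) (\<delta> t)"
proof -
  interpret zx: function_tensor K G A "Mor B z x" by (intro Mor_tensor obj)
  interpret yx: graded_space K "Mor B y x" "carrier G" "E y x" by (intro Mor_graded obj)
  interpret AA: tensor_pair K A A by (intro tensor_pair.intro A.H_module)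
  \<comment> \<open>With the integrand named, its bilinearity can be quoted from the general smash
    construction, and the lift can be evaluated termwise on the comultiplication.\<close>
  define b where "b h\<^sub>1 h\<^sub>2 = zx.tensor (Comp B z y x f (grading_action G B E y x h\<^sub>1 g)) (h\<^sub>2 \<otimes>\<^bsub>A\<^esub> \<delta> t)"
    for h\<^sub>1 h\<^sub>2
  have b_bil: "bilinear_map K A A zx.T b"
    using SD.summand_bilinear[OF obj f g A.delta_closed[of t]]
    by (simp add: b_def[abs_def] SD.summand_def[OF obj, abs_def])
  note L = tensor_lift_linear[OF A.H_module A.H_module zx.tensor_module b_bil]
  note comp_closed = bilinear_map_closed[OF B.Comp_bilinear[OF obj]]
  have b_delta: "b (\<delta> u) (\<delta> v) = (if v = t then zx.tensor (Comp B z y x f (proj y x u g)) (\<delta> t) else \<zero>\<^bsub>zx.T\<^esub>)"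
    if "u \<in> carrier G" "v \<in> carrier G" for u v
  proof -
    have c: "Comp B z y x f (proj y x u g) \<in> carrier (Mor B z x)"
      using f g that yx.proj_closed by (intro comp_closed)
    show ?thesis
      using that obj g t linear_map_zero[OF A.H_module zx.tensor_module
          bilinear_mapD(1)[OF zx.pure_tensor_bilinear c]]
      by (simp add: b_def grading_action_delta function_hopf_mult_delta[OF K_field G_group finite_G])
  qed
  let ?st = "s \<otimes>\<^bsub>G\<^esub> inv\<^bsub>G\<^esub> t"
  have "Comp S z y x (pure_tensor K (Mor B z y) A f (\<delta> s)) (pure_tensor K (Mor B y x) A g (\<delta> t)) =
      tensor_lift K zx.T b (comult A (\<delta> s))"
    unfolding graded_smash_def b_def[abs_def]
    using f g by (intro SD.smash_Comp_pure obj A.delta_closed)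
  also have "\<dots> = (\<Oplus>\<^bsub>zx.T\<^esub>p\<in>carrier G \<times> carrier G.
      tensor_lift K zx.T b (\<delta> s (fst p \<otimes>\<^bsub>G\<^esub> snd p) \<odot>\<^bsub>AA.T\<^esub> AA.tensor (\<delta> (fst p)) (\<delta> (snd p))))"
    unfolding function_hopf_comult[OF K_field G_group finite_G]
    by (intro linear_map_finsum[OF AA.tensor_module zx.tensor_module L])
      (auto intro!: AA.pure_tensor_closed A.delta_closed A.H_apply(4))
  also have "\<dots> = (\<Oplus>\<^bsub>zx.T\<^esub>p\<in>carrier G \<times> carrier G.
      \<delta> s (fst p \<otimes>\<^bsub>G\<^esub> snd p) \<odot>\<^bsub>zx.T\<^esub> b (\<delta> (fst p)) (\<delta> (snd p)))"
    using bilinear_map_closed[OF b_bil]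
    by (intro zx.T.finsum_cong')
      (auto simp: linear_mapD(3)[OF L] AA.pure_tensor_closed A.delta_closed A.H_apply(4)
        tensor_lift_pure[OF A.H_module A.H_module zx.tensor_module b_bil])
  also have "\<dots> = \<delta> s (fst (?st, t) \<otimes>\<^bsub>G\<^esub> snd (?st, t)) \<odot>\<^bsub>zx.T\<^esub> b (\<delta> (fst (?st, t))) (\<delta> (snd (?st, t)))"
  proof (rule zx.T.finsum_eq_single)
    fix p assume p: "p \<in> carrier G \<times> carrier G" "p \<noteq> (?st, t)"
    then obtain u v where uv: "p = (u, v)" "u \<in> carrier G" "v \<in> carrier G" by auto
    have "u \<otimes>\<^bsub>G\<^esub> v \<noteq> s" if "v = t"
      using p uv s t that by (metis G.inv_solve_right)
    then show "\<delta> s (fst p \<otimes>\<^bsub>G\<^esub> snd p) \<odot>\<^bsub>zx.T\<^esub> b (\<delta> (fst p)) (\<delta> (snd p)) = \<zero>\<^bsub>zx.T\<^esub>"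
      using uv bilinear_map_closed[OF b_bil A.delta_closed A.delta_closed, of u v]
      by (cases "v = t") (simp_all add: A.delta_apply b_delta)
  qed (use s t finite_G bilinear_map_closed[OF b_bil] in \<open>auto intro!: A.H_apply(4) A.delta_closed\<close>)
  also have "\<dots> = zx.tensor (Comp B z y x f (proj y x ?st g)) (\<delta> t)"
    using s t f g yx.proj_closed
    by (simp add: A.delta_apply G.m_assoc b_delta zx.pure_tensor_closed A.delta_closed comp_closed)
  finally show ?thesis .
qed

lemma S_tensor: "\<lbrakk>x \<in> Obj B; y \<in> Obj B\<rbrakk> \<Longrightarrow> function_tensor K G D (Mor S y x)"
  by (intro function_tensor.intro S_module D.function_space_axioms)

section \<open>The translation action of the group algebra\<close>

context
  fixes x y assumes obj: "x \<in> Obj B" "y \<in> Obj B"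
begin

interpretation yx: function_tensor K G A "Mor B y x" by (intro Mor_tensor obj)

text \<open>The action of a single group element \<open>t\<close>; the action of the group algebra
  is its linear extension.\<close>

definition translate where
  "translate t = tensor_lift K yx.T (\<lambda>f b. \<Oplus>\<^bsub>yx.T\<^esub>s\<in>carrier G. b s \<odot>\<^bsub>yx.T\<^esub>
            yx.tensor f (\<delta> (s \<otimes>\<^bsub>G\<^esub> inv\<^bsub>G\<^esub> t)))"

lemma translate_bilinear:
  "bilinear_map K (Mor B y x) A yx.T (\<lambda>f b. \<Oplus>\<^bsub>yx.T\<^esub>s\<in>carrier G. b s \<odot>\<^bsub>yx.T\<^esub>
            yx.tensor f (\<delta> (s \<otimes>\<^bsub>G\<^esub> inv\<^bsub>G\<^esub> t)))"
proof (rule bilinear_mapI)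
  fix f assume "f \<in> carrier (Mor B y x)"
  then show "linear_map K A yx.T (\<lambda>b. \<Oplus>\<^bsub>yx.T\<^esub>s\<in>carrier G. b s \<odot>\<^bsub>yx.T\<^esub>
            yx.tensor f (\<delta> (s \<otimes>\<^bsub>G\<^esub> inv\<^bsub>G\<^esub> t)))"
    by (intro A.linear_extension yx.tensor_module yx.pure_tensor_closed A.delta_closed finite_G)
next
  fix b assume "b \<in> carrier A"
  then show "linear_map K (Mor B y x) yx.T (\<lambda>f. \<Oplus>\<^bsub>yx.T\<^esub>s\<in>carrier G. b s \<odot>\<^bsub>yx.T\<^esub>
            yx.tensor f (\<delta> (s \<otimes>\<^bsub>G\<^esub> inv\<^bsub>G\<^esub> t)))"
    by (intro yx.T.linear_map_finsumI yx.T.linear_map_smultI finite_G A.H_apply(4) A.delta_closed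
        bilinear_mapD(2)[OF yx.pure_tensor_bilinear])
qed

lemma translate_linear: "linear_map K yx.T yx.T (translate t)"
  unfolding translate_def
  by (intro tensor_lift_linear A.H_module yx.V.module_axioms yx.tensor_module translate_bilinear)

lemma translate_pure:
  assumes "f \<in> carrier (Mor B y x)" "s \<in> carrier G" "t \<in> carrier G"
  shows "translate t (yx.tensor f (\<delta> s)) = yx.tensor f (\<delta> (s \<otimes>\<^bsub>G\<^esub> inv\<^bsub>G\<^esub> t))"
proof -
  have "translate t (yx.tensor f (\<delta> s)) = (\<Oplus>\<^bsub>yx.T\<^esub>r\<in>carrier G. \<delta> s r \<odot>\<^bsub>yx.T\<^esub>
            yx.tensor f (\<delta> (r \<otimes>\<^bsub>G\<^esub> inv\<^bsub>G\<^esub> t)))"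
    unfolding translate_def using assms
    by (intro tensor_lift_pure[OF _ _ _ translate_bilinear] A.H_module yx.V.module_axioms
        yx.tensor_module A.delta_closed)
  also have "\<dots> = yx.tensor f (\<delta> (s \<otimes>\<^bsub>G\<^esub> inv\<^bsub>G\<^esub> t))"
    using assms
    by (intro A.linear_extension_delta yx.tensor_module yx.pure_tensor_closed A.delta_closed)
  finally show ?thesis .
qed

lemma translation_action_eq:
  "translation_action K G B y x a t =
    (\<Oplus>\<^bsub>yx.T\<^esub>u\<in>carrier G. a u \<odot>\<^bsub>yx.T\<^esub> translate u t)"
  by (simp add: translation_action_def translate_def Let_def)

lemma translation_action_bilinear:
  "bilinear_map K D (Mor S y x) (Mor S y x) (translation_action K G B y x)"
  unfolding S_simps
proof (rule bilinear_mapI)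
  fix t assume "t \<in> carrier yx.T"
  then show "linear_map K D yx.T (\<lambda>a. translation_action K G B y x a t)"
    unfolding translation_action_eq
    by (intro D.linear_extension yx.tensor_module linear_mapD(1)[OF translate_linear] finite_G)
next
  fix a assume "a \<in> carrier D"
  then show "linear_map K yx.T yx.T (translation_action K G B y x a)"
    unfolding translation_action_eq[abs_def]
    by (intro yx.T.linear_map_finsumI yx.T.linear_map_smultI finite_G D.H_apply(4) translate_linear)
qed

lemma translation_action_delta:
  assumes "f \<in> carrier (Mor B y x)" "s \<in> carrier G" "t \<in> carrier G"
  shows "translation_action K G B y x (\<delta> t) (yx.tensor f (\<delta> s)) =
    yx.tensor f (\<delta> (s \<otimes>\<^bsub>G\<^esub> inv\<^bsub>G\<^esub> t))"
proof -
  have "translation_action K G B y x (\<delta> t) (yx.tensor f (\<delta> s)) = translate t (yx.tensor f (\<delta> s))"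
    unfolding translation_action_eq using assms
    by (intro D.linear_extension_delta yx.tensor_module linear_mapD(1)[OF translate_linear]
        yx.pure_tensor_closed A.delta_closed)
  then show ?thesis using assms by (simp add: translate_pure)
qed

end

section \<open>The double smash category\<close>

sublocale XD: smash_data K D S "translation_action K G B"
  using group_hopf_mult_bilinear[OF K_field G_group finite_G]
    group_hopf_comult_linear[OF K_field G_group finite_G]
  by (intro smash_data.intro; simp only: S_simps(1))
    (auto intro: S_module S_Comp_bilinear D.H_module translation_action_bilinear)

lemma X_simps:
  "Obj X = Obj B"
  "Mor X y x = tensor_product K (Mor S y x) D"
  "Ident X x = pure_tensor K (Mor S x x) D (Ident S x) \<one>\<^bsub>D\<^esub>"
  by (simp_all add: smash_simps S_simps(1))

lemma X_module: "\<lbrakk>x \<in> Obj B; y \<in> Obj B\<rbrakk> \<Longrightarrow> module K (Mor X y x)"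
  using XD.smash_Mor_module by (simp only: S_simps(1))

lemma X_Comp_bilinear:
  "\<lbrakk>x \<in> Obj B; y \<in> Obj B; z \<in> Obj B\<rbrakk> \<Longrightarrow>
    bilinear_map K (Mor X z y) (Mor X y x) (Mor X z x) (Comp X z y x)"
  using XD.smash_Comp_bilinear by (simp only: S_simps(1))

text \<open>Since \<open>\<delta> u\<close> is group-like, there is one Sweedler term: one copy of
  \<open>u\<close> translates \<open>\<psi>\<close>, the other multiplies
  \<open>\<delta> v\<close>.\<close>

lemma X_Comp_pure:
  assumes obj: "x \<in> Obj B" "y \<in> Obj B" "z \<in> Obj B"
    and \<phi>: "\<phi> \<in> carrier (Mor S z y)" and \<psi>: "\<psi> \<in> carrier (Mor S y x)"
    and u: "u \<in> carrier G" and v: "v \<in> carrier G"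
  shows "Comp X z y x (pure_tensor K (Mor S z y) D \<phi> (\<delta> u)) (pure_tensor K (Mor S y x) D \<psi> (\<delta> v)) =
    pure_tensor K (Mor S z x) D (Comp S z y x \<phi> (translation_action K G B y x (\<delta> u) \<psi>)) (\<delta> (u \<otimes>\<^bsub>G\<^esub> v))"
proof -
  have objS: "x \<in> Obj S" "y \<in> Obj S" "z \<in> Obj S" using obj by (simp_all add: S_simps(1))
  interpret zx: function_tensor K G D "Mor S z x" by (intro S_tensor obj)
  define b where "b h\<^sub>1 h\<^sub>2 = zx.tensor (Comp S z y x \<phi> (translation_action K G B y x h\<^sub>1 \<psi>)) (h\<^sub>2 \<otimes>\<^bsub>D\<^esub> \<delta> v)"
    for h\<^sub>1 h\<^sub>2
  have b_bil: "bilinear_map K D D zx.T b"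
    using XD.summand_bilinear[OF objS \<phi> \<psi> D.delta_closed[of v]]
    by (simp add: b_def[abs_def] XD.summand_def[OF objS, abs_def])
  have "Comp X z y x (pure_tensor K (Mor S z y) D \<phi> (\<delta> u)) (pure_tensor K (Mor S y x) D \<psi> (\<delta> v)) =
      tensor_lift K zx.T b (comult D (\<delta> u))"
    unfolding b_def[abs_def] using \<phi> \<psi> by (intro XD.smash_Comp_pure objS D.delta_closed)
  also have "\<dots> = b (\<delta> u) (\<delta> u)"
    unfolding group_hopf_comult_delta[OF K_field G_group finite_G u]
    by (intro tensor_lift_pure[OF D.H_module D.H_module zx.tensor_module b_bil] D.delta_closed)
  finally show ?thesis
    using u v by (simp add: b_def group_hopf_mult_delta[OF K_field G_group finite_G])
qed

end

context finite_grading
begin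

section \<open>Matrix entries\<close>

lemma G_cancel:
  "\<lbrakk>a \<in> carrier G; b \<in> carrier G\<rbrakk> \<Longrightarrow> a \<otimes>\<^bsub>G\<^esub> (inv\<^bsub>G\<^esub> a \<otimes>\<^bsub>G\<^esub> b) = b"
  "\<lbrakk>a \<in> carrier G; b \<in> carrier G\<rbrakk> \<Longrightarrow> inv\<^bsub>G\<^esub> a \<otimes>\<^bsub>G\<^esub> (a \<otimes>\<^bsub>G\<^esub> b) = b"
  by (simp_all add: G.m_assoc[symmetric])

text \<open>For homogeneous \<open>f\<close> these elements are the counterparts of matrices with a
  single nonzero entry.\<close>

definition gen where
  "gen y x f s u = pure_tensor K (Mor S y x) D (pure_tensor K (Mor B y x) A f (\<delta> s)) (\<delta> u)"

text \<open>The coordinate at \<open>u\<close> in the outer factor followed by the coordinate at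
  \<open>s\<close> in the inner one, i.e. the coefficient of
  \<open>\<delta> s \<otimes> \<delta> u\<close>.\<close>

definition component where
  "component y x s u T = tensor_lift K (Mor B y x) (\<lambda>v a. a s \<odot>\<^bsub>Mor B y x\<^esub> v)
    (tensor_lift K (Mor S y x) (\<lambda>v a. a u \<odot>\<^bsub>Mor S y x\<^esub> v) T)"

text \<open>
  Row \<open>p\<close> and column \<open>q\<close> receive, for each \<open>s\<close>, the part with \<open>ds = p\<close> and \<open>su = q\<close>.
\<close>

definition entry where
  "entry y x p q T = (\<Oplus>\<^bsub>Mor B y x\<^esub>s\<in>carrier G.
    proj y x (p \<otimes>\<^bsub>G\<^esub> inv\<^bsub>G\<^esub> s) (component y x s (inv\<^bsub>G\<^esub> s \<otimes>\<^bsub>G\<^esub> q) T))"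

context
  fixes x y assumes obj: "x \<in> Obj B" "y \<in> Obj B"
begin

interpretation A': function_tensor K G A "Mor B y x" by (intro Mor_tensor obj)
interpretation D': function_tensor K G D "Mor S y x" by (intro S_tensor obj)
interpretation yx: graded_space K "Mor B y x" "carrier G" "E y x" by (intro Mor_graded obj)

lemma pure_closed_S:
  "f \<in> carrier (Mor B y x) \<Longrightarrow> A'.tensor f (\<delta> s) \<in> carrier (Mor S y x)"
  by (simp add: S_simps A'.pure_tensor_closed A.delta_closed)

lemma gen_closed: "f \<in> carrier (Mor B y x) \<Longrightarrow> gen y x f s u \<in> carrier (Mor X y x)"
  unfolding gen_def X_simps
  by (intro D'.pure_tensor_closed pure_closed_S D.delta_closed)

lemma gen_linear: "linear_map K (Mor B y x) (Mor X y x) (\<lambda>f. gen y x f s u)"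
  unfolding gen_def X_simps
  using bilinear_mapD(2)[OF A'.pure_tensor_bilinear, of "\<delta> s"]
  by (intro linear_map_compose[OF _ bilinear_mapD(2)[OF D'.pure_tensor_bilinear]])
    (simp_all add: S_simps A.delta_closed D.delta_closed)

text \<open>Generation in three layers: the group algebra factor, the factor
  \<open>k\<^sup>G\<close>, and the grading. Homogeneity of \<open>f\<close> is demanded because the
  matrix position of a generator depends on its degree.\<close>

lemma gen_induct [consumes 1, case_names gen add]:
  assumes "t \<in> carrier (Mor X y x)"
    and gen: "\<And>d f s u. \<lbrakk>d \<in> carrier G; f \<in> E y x d; s \<in> carrier G; u \<in> carrier G\<rbrakk> \<Longrightarrow> P (gen y x f s u)"
    and add: "\<And>t t'. \<lbrakk>t \<in> carrier (Mor X y x); t' \<in> carrier (Mor X y x); P t; P t'\<rbrakk> \<Longrightarrow>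
      P (t \<oplus>\<^bsub>Mor X y x\<^esub> t')"
  shows "P t"
  using assms(1) unfolding X_simps
proof (induction t rule: D'.delta_induct)
  case (add t t')
  then show ?case using assms(3) by (simp add: X_simps)
next
  case (delta \<phi> u)
  note lin = bilinear_mapD(2)[OF D'.pure_tensor_bilinear D.delta_closed]
  from delta(1) show ?case unfolding S_simps
  proof (induction \<phi> rule: A'.delta_induct)
    case (add t t')
    then show ?case
      using assms(3) linear_mapD[OF lin] by (simp add: X_simps S_simps)
  next
    case (delta f s)
    from delta(1) G.carrier_not_empty have "P (gen y x f s u)"
    proof (induction f rule: yx.homogeneous_induct)
      case (add f g)
      then show ?case
        using assms(3) linear_mapD[OF gen_linear] by (simp add: gen_closed)
    qed (use gen delta \<open>u \<in> carrier G\<close> in auto)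
    then show ?case by (simp add: gen_def S_simps)
  qed
qed

lemma linear_map_eq_on_gen:
  assumes "linear_map K (Mor X y x) P g" "linear_map K (Mor X y x) P h" "t \<in> carrier (Mor X y x)"
    and "\<And>d f s u. \<lbrakk>d \<in> carrier G; f \<in> E y x d; s \<in> carrier G; u \<in> carrier G\<rbrakk> \<Longrightarrow>
      g (gen y x f s u) = h (gen y x f s u)"
  shows "g t = h t"
  using assms(3)
  by (induction rule: gen_induct)
    (simp_all add: assms(4) linear_mapD(2)[OF assms(1)] linear_mapD(2)[OF assms(2)])

lemma component_linear:
  "\<lbrakk>s \<in> carrier G; u \<in> carrier G\<rbrakk> \<Longrightarrow> linear_map K (Mor X y x) (Mor B y x) (component y x s u)"
  unfolding component_def[abs_def] X_simps
  by (intro linear_map_compose[OF D'.coord_linear]) (simp_all only: S_simps A'.coord_linear)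

text \<open>General functions \<open>a\<close> and \<open>b\<close> are allowed because of the
  identity morphism, whose factor in \<open>k\<^sup>G\<close> is the constant function one and not a
  single delta.\<close>

lemma component_pure:
  assumes "s \<in> carrier G" "u \<in> carrier G" "f \<in> carrier (Mor B y x)" "a \<in> carrier A" "b \<in> carrier D"
  shows "component y x s u (D'.tensor (A'.tensor f a) b) = (b u \<otimes>\<^bsub>K\<^esub> a s) \<odot>\<^bsub>Mor B y x\<^esub> f"
proof -
  have fa: "A'.tensor f a \<in> carrier (Mor S y x)"
    using assms by (simp add: S_simps A'.pure_tensor_closed)
  have "component y x s u (D'.tensor (A'.tensor f a) b) = A'.coord s (b u \<odot>\<^bsub>Mor S y x\<^esub> A'.tensor f a)"
    using assms fa by (simp add: component_def D'.coord_pure)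
  also have "\<dots> = b u \<odot>\<^bsub>Mor B y x\<^esub> A'.coord s (A'.tensor f a)"
    using assms fa by (simp add: S_simps linear_mapD(3)[OF A'.coord_linear] D.H_apply(4))
  also have "\<dots> = (b u \<otimes>\<^bsub>K\<^esub> a s) \<odot>\<^bsub>Mor B y x\<^esub> f"
    using assms by (simp add: A'.coord_pure A'.V.smult_assoc1 A.H_apply(4) D.H_apply(4))
  finally show ?thesis .
qed

lemma component_gen:
  assumes "s \<in> carrier G" "u \<in> carrier G" "f \<in> carrier (Mor B y x)"
  shows "component y x s u (gen y x f s' u') = (if s = s' \<and> u = u' then f else \<zero>\<^bsub>Mor B y x\<^esub>)"
  using assms
  by (simp add: gen_def component_pure A.delta_closed D.delta_closed A.delta_apply)

lemma component_eqI:
  assumes "t \<in> carrier (Mor X y x)" "t' \<in> carrier (Mor X y x)"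
    and "\<And>s u. \<lbrakk>s \<in> carrier G; u \<in> carrier G\<rbrakk> \<Longrightarrow> component y x s u t = component y x s u t'"
  shows "t = t'"
proof (rule D'.coord_eqI)
  fix u assume u: "u \<in> carrier G"
  show "D'.coord u t = D'.coord u t'"
  proof (rule A'.coord_eqI)
    show "D'.coord u t \<in> carrier A'.T" "D'.coord u t' \<in> carrier A'.T"
      using linear_mapD(1)[OF D'.coord_linear[OF u]] assms(1,2) by (auto simp: X_simps S_simps)
  qed (use assms(3) u in \<open>simp add: component_def\<close>)
qed (use assms in \<open>simp_all add: X_simps\<close>)

lemma component_surj:
  assumes "\<And>s u. \<lbrakk>s \<in> carrier G; u \<in> carrier G\<rbrakk> \<Longrightarrow> c s u \<in> carrier (Mor B y x)"
  shows "\<exists>t\<in>carrier (Mor X y x). \<forall>s\<in>carrier G. \<forall>u\<in>carrier G. component y x s u t = c s u"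
proof -
  define \<phi> where "\<phi> u = (\<Oplus>\<^bsub>Mor S y x\<^esub>s\<in>carrier G. A'.tensor (c s u) (\<delta> s))" for u
  have \<phi>: "\<phi> u \<in> carrier (Mor S y x)" if "u \<in> carrier G" for u
    unfolding \<phi>_def using assms that by (intro D'.V.finsum_closed) (auto intro: pure_closed_S)
  define t where "t = (\<Oplus>\<^bsub>D'.T\<^esub>u\<in>carrier G. D'.tensor (\<phi> u) (\<delta> u))"
  have "t \<in> carrier (Mor X y x)"
    unfolding t_def X_simps using \<phi>
    by (intro D'.T.finsum_closed) (auto intro: D'.pure_tensor_closed D.delta_closed)
  moreover have "component y x s u t = c s u" if "s \<in> carrier G" "u \<in> carrier G" for s u
  proof -
    have "component y x s u t = A'.coord s (\<phi> u)"
      unfolding component_def t_def using \<phi> that by (subst D'.coord_sum) auto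
    also have "\<dots> = c s u"
      unfolding \<phi>_def S_simps using assms that by (subst A'.coord_sum) auto
    finally show ?thesis .
  qed
  ultimately show ?thesis by blast
qed

lemma entry_linear:
  "\<lbrakk>p \<in> carrier G; q \<in> carrier G\<rbrakk> \<Longrightarrow> linear_map K (Mor X y x) (Mor B y x) (entry y x p q)"
  unfolding entry_def[abs_def]
  by (intro A'.V.linear_map_finsumI linear_map_compose[OF component_linear] yx.proj_linear finite_G
      G.m_closed G.inv_closed)

text \<open>Only the summand at \<open>s\<close> can see the generator. There the component is
  nonzero only in the column with \<open>u\<close> equal to \<open>s\<close> inverse times
  \<open>q\<close>, and the projection only in the row with \<open>d\<close> equal to
  \<open>p\<close> times \<open>s\<close> inverse.\<close>

lemma entry_gen:
  assumes d: "d \<in> carrier G" and f: "f \<in> E y x d" and s: "s \<in> carrier G" and u: "u \<in> carrier G"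
    and p: "p \<in> carrier G" and q: "q \<in> carrier G"
  shows "entry y x p q (gen y x f s u) =
    (if p = d \<otimes>\<^bsub>G\<^esub> s \<and> q = s \<otimes>\<^bsub>G\<^esub> u then f else \<zero>\<^bsub>Mor B y x\<^esub>)"
proof -
  have fB: "f \<in> carrier (Mor B y x)" using yx.component_carrier[OF d f] .
  have proj0: "proj y x r \<zero>\<^bsub>Mor B y x\<^esub> = \<zero>\<^bsub>Mor B y x\<^esub>" if "r \<in> carrier G" for r
    using linear_map_zero[OF A'.V.module_axioms A'.V.module_axioms yx.proj_linear[OF that]] .
  have iff: "inv\<^bsub>G\<^esub> s \<otimes>\<^bsub>G\<^esub> q = u \<longleftrightarrow> q = s \<otimes>\<^bsub>G\<^esub> u" "p \<otimes>\<^bsub>G\<^esub> inv\<^bsub>G\<^esub> s = d \<longleftrightarrow> p = d \<otimes>\<^bsub>G\<^esub> s"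
    using s q u p d by (metis G.inv_solve_left G.inv_solve_right G.m_closed)+
  have comp: "component y x s (inv\<^bsub>G\<^esub> s \<otimes>\<^bsub>G\<^esub> q) (gen y x f s u) =
      (if q = s \<otimes>\<^bsub>G\<^esub> u then f else \<zero>\<^bsub>Mor B y x\<^esub>)"
    using s q fB by (simp add: component_gen iff(1))
  have pf: "proj y x (p \<otimes>\<^bsub>G\<^esub> inv\<^bsub>G\<^esub> s) f = (if p = d \<otimes>\<^bsub>G\<^esub> s then f else \<zero>\<^bsub>Mor B y x\<^esub>)"
    using yx.proj_homogeneous[OF f d, of "p \<otimes>\<^bsub>G\<^esub> inv\<^bsub>G\<^esub> s"] p s by (simp add: iff(2))
  have "entry y x p q (gen y x f s u) =
      proj y x (p \<otimes>\<^bsub>G\<^esub> inv\<^bsub>G\<^esub> s) (component y x s (inv\<^bsub>G\<^esub> s \<otimes>\<^bsub>G\<^esub> q) (gen y x f s u))"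
    unfolding entry_def
  proof (rule A'.V.finsum_eq_single[OF finite_G s])
    show "proj y x (p \<otimes>\<^bsub>G\<^esub> inv\<^bsub>G\<^esub> s) (component y x s (inv\<^bsub>G\<^esub> s \<otimes>\<^bsub>G\<^esub> q) (gen y x f s u)) \<in> carrier (Mor B y x)"
      using p q s fB by (simp add: component_gen yx.proj_closed)
  qed (use p q fB proj0 in \<open>simp add: component_gen\<close>)
  also have "\<dots> = (if p = d \<otimes>\<^bsub>G\<^esub> s \<and> q = s \<otimes>\<^bsub>G\<^esub> u then f else \<zero>\<^bsub>Mor B y x\<^esub>)"
    unfolding comp using p s by (cases "q = s \<otimes>\<^bsub>G\<^esub> u") (simp_all add: proj0 pf)
  finally show ?thesis .
qed

text \<open>The summands of an entry are homogeneous of pairwise different degrees, so its part of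
  degree \<open>d\<close> is the one summand whose \<open>s\<close> is \<open>d\<close> inverse
  times \<open>p\<close>. This inverts the passage from \<open>(d, s, u)\<close> to matrix
  positions; both injectivity and surjectivity are read off from it.\<close>

lemma proj_entry:
  assumes d: "d \<in> carrier G" and p: "p \<in> carrier G" and q: "q \<in> carrier G"
    and t: "t \<in> carrier (Mor X y x)"
  shows "proj y x d (entry y x p q t) =
    proj y x d (component y x (inv\<^bsub>G\<^esub> d \<otimes>\<^bsub>G\<^esub> p) (inv\<^bsub>G\<^esub> p \<otimes>\<^bsub>G\<^esub> d \<otimes>\<^bsub>G\<^esub> q) t)"
proof -
  have c: "component y x s u t \<in> carrier (Mor B y x)" if "s \<in> carrier G" "u \<in> carrier G" for s u
    using linear_mapD(1)[OF component_linear[OF that] t] .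
  let ?s = "inv\<^bsub>G\<^esub> d \<otimes>\<^bsub>G\<^esub> p"
  let ?F = "\<lambda>s. proj y x (p \<otimes>\<^bsub>G\<^esub> inv\<^bsub>G\<^esub> s) (component y x s (inv\<^bsub>G\<^esub> s \<otimes>\<^bsub>G\<^esub> q) t)"
  have F: "?F s \<in> E y x (p \<otimes>\<^bsub>G\<^esub> inv\<^bsub>G\<^esub> s)" if "s \<in> carrier G" for s
    using that p q c by (intro yx.proj_component) auto
  have iff: "d = p \<otimes>\<^bsub>G\<^esub> inv\<^bsub>G\<^esub> s \<longleftrightarrow> s = ?s" if "s \<in> carrier G" for s
    using that d p by (metis G.inv_solve_left G.inv_solve_right' G.m_closed G.inv_closed)
  have pF: "proj y x d (?F s) = (if s = ?s then ?F s else \<zero>\<^bsub>Mor B y x\<^esub>)" if s: "s \<in> carrier G" for s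
    using yx.proj_homogeneous[OF F[OF s], of d] s p d by (simp add: iff[OF s])
  have "proj y x d (entry y x p q t) = (\<Oplus>\<^bsub>Mor B y x\<^esub>s\<in>carrier G. proj y x d (?F s))"
    unfolding entry_def
    using p q c by (intro linear_map_finsum[OF A'.V.module_axioms A'.V.module_axioms yx.proj_linear[OF d]])
      (auto intro!: yx.proj_closed)
  also have "\<dots> = proj y x d (?F ?s)"
    using d p q c pF finite_G by (intro A'.V.finsum_eq_single) (auto intro!: yx.proj_closed)
  also have "\<dots> = ?F ?s" using pF[of ?s] d p by simp
  also have "p \<otimes>\<^bsub>G\<^esub> inv\<^bsub>G\<^esub> ?s = d" using iff[of ?s] d p by simp
  also have "inv\<^bsub>G\<^esub> ?s \<otimes>\<^bsub>G\<^esub> q = inv\<^bsub>G\<^esub> p \<otimes>\<^bsub>G\<^esub> d \<otimes>\<^bsub>G\<^esub> q" using d p by (simp add: G.inv_mult_group)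
  finally show ?thesis .
qed

text \<open>An element is determined by the homogeneous parts of its components, and the part of
  degree \<open>d\<close> at \<open>(s, u)\<close> is visible in row \<open>ds\<close> and column
  \<open>su\<close>.\<close>

lemma entry_inj:
  assumes t: "t \<in> carrier (Mor X y x)" and t': "t' \<in> carrier (Mor X y x)"
    and eq: "\<And>p q. \<lbrakk>p \<in> carrier G; q \<in> carrier G\<rbrakk> \<Longrightarrow> entry y x p q t = entry y x p q t'"
  shows "t = t'"
proof (rule component_eqI[OF t t'])
  fix s u assume su: "s \<in> carrier G" "u \<in> carrier G"
  show "component y x s u t = component y x s u t'"
  proof (rule yx.proj_eqI)
    show "component y x s u t \<in> carrier (Mor B y x)" "component y x s u t' \<in> carrier (Mor B y x)"
      using linear_mapD(1)[OF component_linear[OF su]] t t' by auto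
    fix d assume d: "d \<in> carrier G"
    have 1: "inv\<^bsub>G\<^esub> d \<otimes>\<^bsub>G\<^esub> (d \<otimes>\<^bsub>G\<^esub> s) = s" "inv\<^bsub>G\<^esub> (d \<otimes>\<^bsub>G\<^esub> s) \<otimes>\<^bsub>G\<^esub> d \<otimes>\<^bsub>G\<^esub> (s \<otimes>\<^bsub>G\<^esub> u) = u"
      using d su by (simp_all add: G.inv_mult_group G.m_assoc G_cancel)
    show "proj y x d (component y x s u t) = proj y x d (component y x s u t')"
      using proj_entry[OF d _ _ t, of "d \<otimes>\<^bsub>G\<^esub> s" "s \<otimes>\<^bsub>G\<^esub> u"]
        proj_entry[OF d _ _ t', of "d \<otimes>\<^bsub>G\<^esub> s" "s \<otimes>\<^bsub>G\<^esub> u"] d su eq by (simp add: 1)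
  qed
qed

lemma entry_surj:
  assumes M: "\<And>p q. \<lbrakk>p \<in> carrier G; q \<in> carrier G\<rbrakk> \<Longrightarrow> M p q \<in> carrier (Mor B y x)"
  shows "\<exists>t\<in>carrier (Mor X y x). \<forall>p\<in>carrier G. \<forall>q\<in>carrier G. entry y x p q t = M p q"
proof -
  \<comment> \<open>The component at \<open>(s, u)\<close> gathers one homogeneous part for each
    degree \<open>d\<close>, taken from the only entry to which such a part contributes.\<close>
  define c where "c s u = (\<Oplus>\<^bsub>Mor B y x\<^esub>d\<in>carrier G. proj y x d (M (d \<otimes>\<^bsub>G\<^esub> s) (s \<otimes>\<^bsub>G\<^esub> u)))" for s u
  have "c s u \<in> carrier (Mor B y x)" if "s \<in> carrier G" "u \<in> carrier G" for s u
    unfolding c_def using M that by (intro A'.V.finsum_closed) (auto intro!: yx.proj_closed)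
  from component_surj[of c, OF this] obtain t where t: "t \<in> carrier (Mor X y x)"
    and tc: "\<And>s u. \<lbrakk>s \<in> carrier G; u \<in> carrier G\<rbrakk> \<Longrightarrow> component y x s u t = c s u" by blast
  have "entry y x p q t = M p q" if pq: "p \<in> carrier G" "q \<in> carrier G" for p q
  proof (rule yx.proj_eqI)
    show "entry y x p q t \<in> carrier (Mor B y x)"
      using linear_mapD(1)[OF entry_linear[OF pq] t] .
    fix d assume d: "d \<in> carrier G"
    let ?s = "inv\<^bsub>G\<^esub> d \<otimes>\<^bsub>G\<^esub> p" and ?u = "inv\<^bsub>G\<^esub> p \<otimes>\<^bsub>G\<^esub> d \<otimes>\<^bsub>G\<^esub> q"
    have 1: "d \<otimes>\<^bsub>G\<^esub> ?s = p" using d pq by (simp add: G.m_assoc[symmetric])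
    have 2: "?s \<otimes>\<^bsub>G\<^esub> ?u = q" using d pq by (simp add: G.m_assoc G_cancel)
    have "proj y x d (entry y x p q t) = proj y x d (c ?s ?u)"
      using proj_entry[OF d pq t] d pq by (simp add: tc)
    also have "\<dots> = proj y x d (M (d \<otimes>\<^bsub>G\<^esub> ?s) (?s \<otimes>\<^bsub>G\<^esub> ?u))"
      unfolding c_def using d pq M by (intro yx.proj_sum yx.proj_component) auto
    finally show "proj y x d (entry y x p q t) = proj y x d (M p q)" by (simp add: 1 2)
  qed (rule M[OF pq])
  with t show ?thesis by blast
qed

end

section \<open>Entries of composites and of identities\<close>

lemma Comp_gen:
  assumes obj: "x \<in> Obj B" "y \<in> Obj B" "z \<in> Obj B"
    and f: "f \<in> carrier (Mor B z y)" and g: "g \<in> carrier (Mor B y x)"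
    and G: "s \<in> carrier G" "u \<in> carrier G" "t \<in> carrier G" "v \<in> carrier G"
  shows "Comp X z y x (gen z y f s u) (gen y x g t v) =
    gen z x (Comp B z y x f (proj y x (s \<otimes>\<^bsub>G\<^esub> u \<otimes>\<^bsub>G\<^esub> inv\<^bsub>G\<^esub> t) g)) (t \<otimes>\<^bsub>G\<^esub> inv\<^bsub>G\<^esub> u) (u \<otimes>\<^bsub>G\<^esub> v)"
proof -
  have "s \<otimes>\<^bsub>G\<^esub> inv\<^bsub>G\<^esub> (t \<otimes>\<^bsub>G\<^esub> inv\<^bsub>G\<^esub> u) = s \<otimes>\<^bsub>G\<^esub> u \<otimes>\<^bsub>G\<^esub> inv\<^bsub>G\<^esub> t"
    using G by (simp add: G.inv_mult_group G.m_assoc)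
  then show ?thesis
    using assms unfolding gen_def
    by (simp add: X_Comp_pure pure_closed_S translation_action_delta S_Comp_pure)
qed

text \<open>Write the identity as the sum of its parts \<open>i\<^sub>s\<close>. Multiplying
  \<open>i\<^sub>t\<close> by this sum on the right returns \<open>i\<^sub>t\<close>; comparing
  degrees, \<open>i\<^sub>t i\<^sub>s\<close> vanishes for every \<open>s\<close> other than the
  neutral element. Multiplying \<open>i\<^sub>s\<close> by the sum on the left then gives
  \<open>i\<^sub>s = 0\<close> for those \<open>s\<close>.\<close>

lemma Ident_degree:
  assumes x: "x \<in> Obj B"
  shows "Ident B x \<in> E x x \<one>\<^bsub>G\<^esub>"
proof -
  interpret graded: graded_space K "Mor B x x" "carrier G" "E x x" by (intro Mor_graded x)
  let ?V = "Mor B x x" and ?i = "\<lambda>s. proj x x s (Ident B x)"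
  have I: "Ident B x \<in> carrier ?V" using B.Ident_closed[OF x] .
  have i: "?i s \<in> E x x s" "?i s \<in> carrier ?V" if "s \<in> carrier G" for s
    using that I graded.proj_component graded.proj_closed by auto
  note comp_lin = bilinear_mapD[OF B.Comp_bilinear[OF x x x]]
  note comp_closed = bilinear_map_closed[OF B.Comp_bilinear[OF x x x]]
  have prod: "Comp B x x x (?i t) (?i s) = \<zero>\<^bsub>?V\<^esub>"
    if s: "s \<in> carrier G" "s \<noteq> \<one>\<^bsub>G\<^esub>" and t: "t \<in> carrier G" for s t
  proof -
    \<comment> \<open>The products are listed by their degree \<open>r\<close>, the form in which
      projections can pick out a single one.\<close>
    define c where "c r = Comp B x x x (?i t) (?i (inv\<^bsub>G\<^esub> t \<otimes>\<^bsub>G\<^esub> r))" for r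
    have c: "c r \<in> E x x r" if "r \<in> carrier G" for r
    proof -
      have "c r \<in> E x x (t \<otimes>\<^bsub>G\<^esub> (inv\<^bsub>G\<^esub> t \<otimes>\<^bsub>G\<^esub> r))"
        unfolding c_def using t that by (intro grading_Comp x i) auto
      then show ?thesis using t that by (simp add: G.m_assoc[symmetric])
    qed
    have "?i t = Comp B x x x (?i t) (\<Oplus>\<^bsub>?V\<^esub>s\<in>carrier G. ?i s)"
      using I x i t by (simp add: graded.sum_proj B.Ident_right)
    also have "\<dots> = (\<Oplus>\<^bsub>?V\<^esub>s\<in>carrier G. Comp B x x x (?i t) (?i s))"
      using i t by (intro linear_map_finsum[OF graded.module_axioms graded.module_axioms comp_lin(1)]) auto
    \<comment> \<open>Left translation by the inverse of \<open>t\<close> permutes the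
      group.\<close>
    also have "\<dots> = (\<Oplus>\<^bsub>?V\<^esub>s\<in>(\<lambda>r. inv\<^bsub>G\<^esub> t \<otimes>\<^bsub>G\<^esub> r) ` carrier G. Comp B x x x (?i t) (?i s))"
      using G.surj_const_mult[of "inv\<^bsub>G\<^esub> t"] t by simp
    also have "\<dots> = (\<Oplus>\<^bsub>?V\<^esub>r\<in>carrier G. c r)"
      unfolding c_def
      using t i comp_closed G.inj_on_multc G.inj_on_cmult[of "inv\<^bsub>G\<^esub> t"]
      by (intro graded.finsum_reindex) auto
    finally have "proj x x (t \<otimes>\<^bsub>G\<^esub> s) (?i t) = c (t \<otimes>\<^bsub>G\<^esub> s)"
      using graded.proj_sum[of c "t \<otimes>\<^bsub>G\<^esub> s"] c s t by simp
    moreover have "proj x x (t \<otimes>\<^bsub>G\<^esub> s) (?i t) = \<zero>\<^bsub>?V\<^esub>"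
      using graded.proj_homogeneous[OF i(1)[OF t] t, of "t \<otimes>\<^bsub>G\<^esub> s"] s t
      by (simp add: G.r_cancel_one)
    moreover have "inv\<^bsub>G\<^esub> t \<otimes>\<^bsub>G\<^esub> (t \<otimes>\<^bsub>G\<^esub> s) = s" using s t by (simp add: G.m_assoc[symmetric])
    ultimately show ?thesis by (simp add: c_def)
  qed
  have zero: "?i s = \<zero>\<^bsub>?V\<^esub>" if s: "s \<in> carrier G" "s \<noteq> \<one>\<^bsub>G\<^esub>" for s
  proof -
    have "?i s = Comp B x x x (\<Oplus>\<^bsub>?V\<^esub>t\<in>carrier G. ?i t) (?i s)"
      using I x i s by (simp add: graded.sum_proj B.Ident_left)
    also have "\<dots> = (\<Oplus>\<^bsub>?V\<^esub>t\<in>carrier G. Comp B x x x (?i t) (?i s))"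
      using i s by (intro linear_map_finsum[OF graded.module_axioms graded.module_axioms comp_lin(2)]) auto
    also have "\<dots> = \<zero>\<^bsub>?V\<^esub>"
      using s by (intro graded.add.finprod_one_eqI) (simp add: prod)
    finally show ?thesis .
  qed
  have "Ident B x = (\<Oplus>\<^bsub>?V\<^esub>s\<in>carrier G. ?i s)" using I by (simp add: graded.sum_proj)
  also have "\<dots> = ?i \<one>\<^bsub>G\<^esub>"
    using finite_G i zero by (intro graded.finsum_eq_single) auto
  finally show ?thesis using i(1)[of "\<one>\<^bsub>G\<^esub>"] by simp
qed

text \<open>The group algebra factor of the identity is the neutral element, so a component at
  \<open>(s, u)\<close> vanishes unless \<open>u\<close> is neutral; in column \<open>q\<close> this
  leaves \<open>s = q\<close>. The remaining projection has degree \<open>p\<close> times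
  \<open>q\<close> inverse, and \<open>Ident_degree\<close> makes it vanish off the
  diagonal.\<close>

lemma entry_Ident:
  assumes x: "x \<in> Obj B" and p: "p \<in> carrier G" and q: "q \<in> carrier G"
  shows "entry x x p q (Ident X x) = (if p = q then Ident B x else \<zero>\<^bsub>Mor B x x\<^esub>)"
proof -
  interpret graded: graded_space K "Mor B x x" "carrier G" "E x x" by (intro Mor_graded x)
  have I: "Ident B x \<in> carrier (Mor B x x)" using B.Ident_closed[OF x] .
  have proj0: "proj x x r \<zero>\<^bsub>Mor B x x\<^esub> = \<zero>\<^bsub>Mor B x x\<^esub>" if "r \<in> carrier G" for r
    using linear_map_zero[OF graded.module_axioms graded.module_axioms graded.proj_linear[OF that]] .
  have one: "\<one>\<^bsub>A\<^esub> \<in> carrier A" "\<And>s. s \<in> carrier G \<Longrightarrow> \<one>\<^bsub>A\<^esub> s = \<one>\<^bsub>K\<^esub>" "\<one>\<^bsub>D\<^esub> = \<delta> \<one>\<^bsub>G\<^esub>"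
    by (simp_all add: function_hopf_mult[OF K_field G_group finite_G] A.restrict_closed
        group_hopf_mult[OF K_field G_group finite_G])
  have comp: "component x x s u (Ident X x) = (if u = \<one>\<^bsub>G\<^esub> then Ident B x else \<zero>\<^bsub>Mor B x x\<^esub>)"
    if "s \<in> carrier G" "u \<in> carrier G" for s u
    unfolding X_simps S_simps(3) one(3)
    using that x I by (simp add: component_pure one D.delta_closed D.delta_apply)
  have iff: "inv\<^bsub>G\<^esub> s \<otimes>\<^bsub>G\<^esub> q = \<one>\<^bsub>G\<^esub> \<longleftrightarrow> s = q" if "s \<in> carrier G" for s
    using that q by (metis G.inv_solve_left G.m_closed G.one_closed G.r_one)
  have "entry x x p q (Ident X x) = proj x x (p \<otimes>\<^bsub>G\<^esub> inv\<^bsub>G\<^esub> q) (component x x q (inv\<^bsub>G\<^esub> q \<otimes>\<^bsub>G\<^esub> q) (Ident X x))"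
    unfolding entry_def
  proof (rule graded.finsum_eq_single[OF finite_G q])
    show "proj x x (p \<otimes>\<^bsub>G\<^esub> inv\<^bsub>G\<^esub> q) (component x x q (inv\<^bsub>G\<^esub> q \<otimes>\<^bsub>G\<^esub> q) (Ident X x)) \<in> carrier (Mor B x x)"
      using p q I by (simp add: comp graded.proj_closed)
  qed (use p q in \<open>simp add: comp iff proj0\<close>)
  also have "\<dots> = (if p \<otimes>\<^bsub>G\<^esub> inv\<^bsub>G\<^esub> q = \<one>\<^bsub>G\<^esub> then Ident B x else \<zero>\<^bsub>Mor B x x\<^esub>)"
    using p q by (simp add: comp graded.proj_homogeneous[OF Ident_degree[OF x]])
  also have "p \<otimes>\<^bsub>G\<^esub> inv\<^bsub>G\<^esub> q = \<one>\<^bsub>G\<^esub> \<longleftrightarrow> p = q"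
    using p q by (metis G.inv_solve_right G.l_one G.one_closed)
  finally show ?thesis .
qed

text \<open>Both sides follow the rule for matrix units. If \<open>su = et\<close>, the composite is
  a generator on the product of \<open>f\<close> and \<open>g\<close>, of degree \<open>de\<close>,
  and the shifted group indices give row \<open>ds\<close> and column \<open>tv\<close>; otherwise
  both sides vanish.\<close>

lemma entry_Comp_gen:
  assumes obj: "x \<in> Obj B" "y \<in> Obj B" "z \<in> Obj B"
    and d: "d \<in> carrier G" and f: "f \<in> E z y d" and s: "s \<in> carrier G" and u: "u \<in> carrier G"
    and e: "e \<in> carrier G" and g: "g \<in> E y x e" and t: "t \<in> carrier G" and v: "v \<in> carrier G"
    and p: "p \<in> carrier G" and q: "q \<in> carrier G"
  shows "entry z x p q (Comp X z y x (gen z y f s u) (gen y x g t v)) =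
    (\<Oplus>\<^bsub>Mor B z x\<^esub>r\<in>carrier G.
      Comp B z y x (entry z y p r (gen z y f s u)) (entry y x r q (gen y x g t v)))"
proof -
  interpret zx: graded_space K "Mor B z x" "carrier G" "E z x" by (intro Mor_graded obj)
  interpret zy: graded_space K "Mor B z y" "carrier G" "E z y" by (intro Mor_graded obj)
  interpret yx: graded_space K "Mor B y x" "carrier G" "E y x" by (intro Mor_graded obj)
  have fB: "f \<in> carrier (Mor B z y)" and gB: "g \<in> carrier (Mor B y x)"
    using f g d e zy.component_carrier yx.component_carrier by auto
  note comp_lin = bilinear_mapD[OF B.Comp_bilinear[OF obj]]
  have comp0: "Comp B z y x h \<zero>\<^bsub>Mor B y x\<^esub> = \<zero>\<^bsub>Mor B z x\<^esub>" if "h \<in> carrier (Mor B z y)" for h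
    using linear_map_zero[OF yx.module_axioms zx.module_axioms comp_lin(1)[OF that]] .
  have comp0': "Comp B z y x \<zero>\<^bsub>Mor B z y\<^esub> h = \<zero>\<^bsub>Mor B z x\<^esub>" if "h \<in> carrier (Mor B y x)" for h
    using linear_map_zero[OF zy.module_axioms zx.module_axioms comp_lin(2)[OF that]] .
  have fg: "Comp B z y x f g \<in> E z x (d \<otimes>\<^bsub>G\<^esub> e)" by (intro grading_Comp obj d e f g)
  have fgB: "Comp B z y x f g \<in> carrier (Mor B z x)" using fg d e zx.component_carrier by blast
  \<comment> \<open>The common value of the two sides, computed separately from each.\<close>
  define R where "R = (if p = d \<otimes>\<^bsub>G\<^esub> s \<and> s \<otimes>\<^bsub>G\<^esub> u = e \<otimes>\<^bsub>G\<^esub> t \<and> q = t \<otimes>\<^bsub>G\<^esub> v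
    then Comp B z y x f g else \<zero>\<^bsub>Mor B z x\<^esub>)"
  \<comment> \<open>The left factor has nonzero entries only in column \<open>su\<close>, so the sum
    over the middle index reduces to that term.\<close>
  have "(\<Oplus>\<^bsub>Mor B z x\<^esub>r\<in>carrier G.
      Comp B z y x (entry z y p r (gen z y f s u)) (entry y x r q (gen y x g t v))) =
      Comp B z y x (entry z y p (s \<otimes>\<^bsub>G\<^esub> u) (gen z y f s u)) (entry y x (s \<otimes>\<^bsub>G\<^esub> u) q (gen y x g t v))"
    using obj d e f g s t u v p q fB gB fgB finite_G
    by (intro zx.finsum_eq_single) (auto simp: entry_gen comp0 comp0')
  also have "\<dots> = R"
    using obj d e f g s t u v p q fB gB by (auto simp: R_def entry_gen comp0 comp0')
  finally have rhs: "(\<Oplus>\<^bsub>Mor B z x\<^esub>r\<in>carrier G.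
      Comp B z y x (entry z y p r (gen z y f s u)) (entry y x r q (gen y x g t v))) = R" .
  have iff: "s \<otimes>\<^bsub>G\<^esub> u \<otimes>\<^bsub>G\<^esub> inv\<^bsub>G\<^esub> t = e \<longleftrightarrow> s \<otimes>\<^bsub>G\<^esub> u = e \<otimes>\<^bsub>G\<^esub> t"
    using s t u e by (metis G.inv_solve_right G.m_closed)
  have lhs: "entry z x p q (Comp X z y x (gen z y f s u) (gen y x g t v)) = R"
  proof (cases "s \<otimes>\<^bsub>G\<^esub> u = e \<otimes>\<^bsub>G\<^esub> t")
    case True
    have "Comp X z y x (gen z y f s u) (gen y x g t v) =
        gen z x (Comp B z y x f g) (t \<otimes>\<^bsub>G\<^esub> inv\<^bsub>G\<^esub> u) (u \<otimes>\<^bsub>G\<^esub> v)"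
      using obj s t u v e True iff fB gB yx.proj_homogeneous[OF g e, of e] by (simp add: Comp_gen)
    moreover have "d \<otimes>\<^bsub>G\<^esub> e \<otimes>\<^bsub>G\<^esub> (t \<otimes>\<^bsub>G\<^esub> inv\<^bsub>G\<^esub> u) = d \<otimes>\<^bsub>G\<^esub> s"
    proof -
      have "d \<otimes>\<^bsub>G\<^esub> e \<otimes>\<^bsub>G\<^esub> (t \<otimes>\<^bsub>G\<^esub> inv\<^bsub>G\<^esub> u) = d \<otimes>\<^bsub>G\<^esub> (e \<otimes>\<^bsub>G\<^esub> t) \<otimes>\<^bsub>G\<^esub> inv\<^bsub>G\<^esub> u"
        using d e t u by (simp add: G.m_assoc)
      also have "\<dots> = d \<otimes>\<^bsub>G\<^esub> s" unfolding True[symmetric] using d s u by (simp add: G.m_assoc)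
      finally show ?thesis .
    qed
    moreover have "t \<otimes>\<^bsub>G\<^esub> inv\<^bsub>G\<^esub> u \<otimes>\<^bsub>G\<^esub> (u \<otimes>\<^bsub>G\<^esub> v) = t \<otimes>\<^bsub>G\<^esub> v"
      using t u v by (simp add: G.m_assoc G_cancel)
    ultimately show ?thesis
      using d e t u v p q True by (simp add: entry_gen[OF obj(1,3) _ fg] R_def)
  next
    case False
    then have "proj y x (s \<otimes>\<^bsub>G\<^esub> u \<otimes>\<^bsub>G\<^esub> inv\<^bsub>G\<^esub> t) g = \<zero>\<^bsub>Mor B y x\<^esub>"
      using yx.proj_homogeneous[OF g e, of "s \<otimes>\<^bsub>G\<^esub> u \<otimes>\<^bsub>G\<^esub> inv\<^bsub>G\<^esub> t"] iff s t u by simp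
    then have "Comp X z y x (gen z y f s u) (gen y x g t v) = gen z x \<zero>\<^bsub>Mor B z x\<^esub> (t \<otimes>\<^bsub>G\<^esub> inv\<^bsub>G\<^esub> u) (u \<otimes>\<^bsub>G\<^esub> v)"
      using obj s t u v fB gB by (simp add: Comp_gen comp0)
    \<comment> \<open>Zero lies in every component; taken as homogeneous of neutral degree it is
      covered by \<open>entry_gen\<close>.\<close>
    also have "entry z x p q \<dots> = \<zero>\<^bsub>Mor B z x\<^esub>"
      using entry_gen[OF obj(1,3) G.one_closed zx.component_zero[OF G.one_closed]] t u v p q by simp
    finally show ?thesis using False by (simp add: R_def)
  qed
  show ?thesis unfolding lhs rhs ..
qed

text \<open>Both sides are linear in \<open>T\<close> and in \<open>T'\<close>, so each argument in
  turn may be replaced by a generator.\<close>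

lemma entry_Comp:
  assumes obj: "x \<in> Obj B" "y \<in> Obj B" "z \<in> Obj B"
    and p: "p \<in> carrier G" and q: "q \<in> carrier G"
    and T: "T \<in> carrier (Mor X z y)" and T': "T' \<in> carrier (Mor X y x)"
  shows "entry z x p q (Comp X z y x T T') =
    (\<Oplus>\<^bsub>Mor B z x\<^esub>r\<in>carrier G. Comp B z y x (entry z y p r T) (entry y x r q T'))"
proof -
  interpret zx: module K "Mor B z x" by (intro B.Mor_module obj)
  note X_lin = bilinear_mapD[OF X_Comp_bilinear[OF obj]]
  note comp_lin = bilinear_mapD[OF B.Comp_bilinear[OF obj]]
  \<comment> \<open>These rules follow the shape of the terms, so linearity of each side in each
    argument is found automatically.\<close>
  note [intro!] = zx.linear_map_finsumI finite_G linear_map_compose[OF X_lin(1) entry_linear]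
    linear_map_compose[OF X_lin(2) entry_linear]
    linear_map_compose[OF entry_linear comp_lin(1)] linear_map_compose[OF entry_linear comp_lin(2)]
  note closed = linear_mapD(1)[OF entry_linear] gen_closed
  show ?thesis
  proof (rule linear_map_eq_on_gen[OF obj(2,3) _ _ T])
    fix d f s u assume f: "d \<in> carrier G" "f \<in> E z y d" "s \<in> carrier G" "u \<in> carrier G"
    have fB: "f \<in> carrier (Mor B z y)"
      using graded_space.component_carrier[OF Mor_graded[OF obj(2,3)]] f by blast
    show "entry z x p q (Comp X z y x (gen z y f s u) T') =
      (\<Oplus>\<^bsub>Mor B z x\<^esub>r\<in>carrier G. Comp B z y x (entry z y p r (gen z y f s u)) (entry y x r q T'))"
    proof (rule linear_map_eq_on_gen[OF obj(1,2) _ _ T'])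
      show "linear_map K (Mor X y x) (Mor B z x) (\<lambda>T'. entry z x p q (Comp X z y x (gen z y f s u) T'))"
        using obj p q fB by (auto simp: closed)
      show "linear_map K (Mor X y x) (Mor B z x) (\<lambda>T'. \<Oplus>\<^bsub>Mor B z x\<^esub>r\<in>carrier G.
          Comp B z y x (entry z y p r (gen z y f s u)) (entry y x r q T'))"
        using obj p q fB by (auto simp: closed)
    qed (use obj p q f in \<open>intro entry_Comp_gen\<close>)
  next
    show "linear_map K (Mor X z y) (Mor B z x) (\<lambda>T. entry z x p q (Comp X z y x T T'))"
      using obj p q T' by (auto simp: closed)
    show "linear_map K (Mor X z y) (Mor B z x) (\<lambda>T. \<Oplus>\<^bsub>Mor B z x\<^esub>r\<in>carrier G.
          Comp B z y x (entry z y p r T) (entry y x r q T'))"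
      using obj p q T' by (auto simp: closed)
  qed
qed

end

section \<open>Isomorphisms of categories\<close>

lemma linear_map_inv_into:
  assumes "module K V" and lin: "linear_map K V W f" and bij: "bij_betw f (carrier V) (carrier W)"
  shows "linear_map K W V (inv_into (carrier V) f)"
proof -
  interpret V: module K V by fact
  let ?g = "inv_into (carrier V) f"
  have g: "?g w \<in> carrier V" "f (?g w) = w" if "w \<in> carrier W" for w
    using bij that by (auto simp: bij_betw_def inv_into_into f_inv_into_f)
  have gI: "?g w = v" if "v \<in> carrier V" "f v = w" for v w
    using bij that by (auto simp: bij_betw_def inv_into_f_f)
  show ?thesis
    by (intro linear_mapI gI) (auto simp: g linear_mapD[OF lin])
qed

text \<open>Transport of structure along maps that fix objects. Bilinearity, associativity and the
  unit laws hold in \<open>C\<close> because their images under the injective \<open>F\<close> are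
  the corresponding laws of \<open>D\<close>; the closure hypotheses ensure that both sides of each
  law lie where \<open>F\<close> is injective.\<close>

lemma isomorphic_k_categoriesI:
  assumes D: "k_category K D" and Obj: "Obj C = Obj D"
    and module: "\<And>x y. \<lbrakk>x \<in> Obj D; y \<in> Obj D\<rbrakk> \<Longrightarrow> module K (Mor C y x)"
    and lin: "\<And>x y. \<lbrakk>x \<in> Obj D; y \<in> Obj D\<rbrakk> \<Longrightarrow> linear_map K (Mor C y x) (Mor D y x) (F y x)"
    and bij: "\<And>x y. \<lbrakk>x \<in> Obj D; y \<in> Obj D\<rbrakk> \<Longrightarrow>
      bij_betw (F y x) (carrier (Mor C y x)) (carrier (Mor D y x))"
    and closed: "\<And>x y z g f. \<lbrakk>x \<in> Obj D; y \<in> Obj D; z \<in> Obj D;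
        g \<in> carrier (Mor C z y); f \<in> carrier (Mor C y x)\<rbrakk> \<Longrightarrow> Comp C z y x g f \<in> carrier (Mor C z x)"
    and comp: "\<And>x y z g f. \<lbrakk>x \<in> Obj D; y \<in> Obj D; z \<in> Obj D;
        g \<in> carrier (Mor C z y); f \<in> carrier (Mor C y x)\<rbrakk> \<Longrightarrow>
      F z x (Comp C z y x g f) = Comp D z y x (F z y g) (F y x f)"
    and Ident_closed: "\<And>x. x \<in> Obj D \<Longrightarrow> Ident C x \<in> carrier (Mor C x x)"
    and Ident: "\<And>x. x \<in> Obj D \<Longrightarrow> F x x (Ident C x) = Ident D x"
  shows "isomorphic_k_categories K C D"
proof -
  interpret D: k_category K D by fact
  have F: "F y x f \<in> carrier (Mor D y x)" if "x \<in> Obj D" "y \<in> Obj D" "f \<in> carrier (Mor C y x)" for x y f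
    using linear_mapD(1)[OF lin] that by blast
  \<comment> \<open>Every equation between morphisms of \<open>C\<close>, including those for the
    inverse functor, is checked after applying \<open>F\<close>.\<close>
  have eqI: "f = g" if "x \<in> Obj D" "y \<in> Obj D" "f \<in> carrier (Mor C y x)" "g \<in> carrier (Mor C y x)"
    "F y x f = F y x g" for x y f g
    using bij[OF that(1,2)] that(3-5) by (auto simp: bij_betw_def inj_on_def)
  have C: "k_category K C"
  proof (intro k_category.intro k_category_axioms.intro D.field_axioms; (simp only: Obj)?)
    fix x y z assume obj: "x \<in> Obj D" "y \<in> Obj D" "z \<in> Obj D"
    note D_lin = bilinear_mapD[OF D.Comp_bilinear[OF obj]]
    interpret zx: module K "Mor C z x" by (intro module obj)
    interpret zy: module K "Mor C z y" by (intro module obj)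
    interpret yx: module K "Mor C y x" by (intro module obj)
    note lins = linear_mapD(2,3)[OF lin[OF obj(1,2)]] linear_mapD(2,3)[OF lin[OF obj(2,3)]]
      linear_mapD(2,3)[OF lin[OF obj(1,3)]]
    show "bilinear_map K (Mor C z y) (Mor C y x) (Mor C z x) (Comp C z y x)"
      by (intro bilinear_mapI linear_mapI eqI[OF obj(1,3)])
        (simp_all add: obj closed comp lins F linear_mapD[OF D_lin(1)] linear_mapD[OF D_lin(2)])
  next
    fix w x y z h g f
    assume "w \<in> Obj D" "x \<in> Obj D" "y \<in> Obj D" "z \<in> Obj D"
      "h \<in> carrier (Mor C z y)" "g \<in> carrier (Mor C y x)" "f \<in> carrier (Mor C x w)"
    then show "Comp C z x w (Comp C z y x h g) f = Comp C z y w h (Comp C y x w g f)"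
      by (intro eqI[of w z]) (simp_all add: closed comp F D.Comp_assoc)
  next
    fix x y f assume "x \<in> Obj D" "y \<in> Obj D" "f \<in> carrier (Mor C y x)"
    then show "Comp C y y x (Ident C y) f = f" "Comp C y x x f (Ident C x) = f"
      by (intro eqI[of x y]; simp add: closed comp F Ident Ident_closed D.Ident_left D.Ident_right)+
  qed (auto intro: module Ident_closed)
  let ?I = "\<lambda>y x. inv_into (carrier (Mor C y x)) (F y x)"
  have I: "?I y x f \<in> carrier (Mor C y x)" "F y x (?I y x f) = f"
    if "x \<in> Obj D" "y \<in> Obj D" "f \<in> carrier (Mor D y x)" for x y f
    using bij[OF that(1,2)] that(3) by (auto simp: bij_betw_def inv_into_into f_inv_into_f)
  have I_F: "?I y x (F y x f) = f" if "x \<in> Obj D" "y \<in> Obj D" "f \<in> carrier (Mor C y x)" for x y f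
    using bij[OF that(1,2)] that(3) by (auto simp: bij_betw_def inv_into_f_f)
  have "k_functor K C D (\<lambda>x. x) F"
    by (intro k_functor.intro k_functor_axioms.intro C D) (auto simp: Obj lin comp Ident)
  moreover have "k_functor K D C (\<lambda>x. x) ?I"
  proof (intro k_functor.intro k_functor_axioms.intro C D)
    fix x y z g f assume asm: "x \<in> Obj D" "y \<in> Obj D" "z \<in> Obj D"
      "g \<in> carrier (Mor D z y)" "f \<in> carrier (Mor D y x)"
    then have "Comp D z y x g f \<in> carrier (Mor D z x)"
      using bilinear_map_closed[OF D.Comp_bilinear] by blast
    with asm show "?I z x (Comp D z y x g f) = Comp C z y x (?I z y g) (?I y x f)"
      by (intro eqI[of x z]) (simp_all add: I closed comp)
  next
    fix x assume "x \<in> Obj D"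
    then show "?I x x (Ident D x) = Ident C x"
      by (intro eqI[of x x]) (simp_all add: I Ident Ident_closed D.Ident_closed)
  qed (auto simp: Obj intro: linear_map_inv_into module lin bij)
  ultimately show ?thesis
    unfolding isomorphic_k_categories_def
    by (intro exI[of _ "\<lambda>x. x"] exI[of _ F] exI[of _ ?I]) (auto simp: I I_F Obj)
qed

section \<open>Matrix categories\<close>

lemma (in abelian_monoid) finsum_swap:
  assumes "finite A" "finite B" "\<And>i j. \<lbrakk>i \<in> A; j \<in> B\<rbrakk> \<Longrightarrow> f i j \<in> carrier G"
  shows "(\<Oplus>i\<in>A. \<Oplus>j\<in>B. f i j) = (\<Oplus>j\<in>B. \<Oplus>i\<in>A. f i j)"
  using assms(1,3)
proof (induction A rule: finite_induct)
  case (insert i A)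
  have "(\<Oplus>k\<in>insert i A. \<Oplus>j\<in>B. f k j) = (\<Oplus>j\<in>B. f i j) \<oplus> (\<Oplus>k\<in>A. \<Oplus>j\<in>B. f k j)"
    using insert by (intro finsum_insert) (auto intro!: finsum_closed)
  also have "\<dots> = (\<Oplus>j\<in>B. f i j \<oplus> (\<Oplus>k\<in>A. f k j))"
    using insert by (subst finsum_addf) (auto intro!: finsum_closed)
  also have "\<dots> = (\<Oplus>j\<in>B. \<Oplus>k\<in>insert i A. f k j)"
    using insert by (intro finsum_cong' finsum_insert[symmetric]) (auto intro!: finsum_closed)
  finally show ?case .
qed simp

lemma matrix_category_simps:
  "Obj (matrix_category n B) = Obj B"
  "carrier (Mor (matrix_category n B) y x) = {..<n} \<times> {..<n} \<rightarrow>\<^sub>E carrier (Mor B y x)"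
  "\<zero>\<^bsub>Mor (matrix_category n B) y x\<^esub> = (\<lambda>p\<in>{..<n} \<times> {..<n}. \<zero>\<^bsub>Mor B y x\<^esub>)"
  "add (Mor (matrix_category n B) y x) = (\<lambda>M N. \<lambda>p\<in>{..<n} \<times> {..<n}. M p \<oplus>\<^bsub>Mor B y x\<^esub> N p)"
  "smult (Mor (matrix_category n B) y x) = (\<lambda>a M. \<lambda>p\<in>{..<n} \<times> {..<n}. a \<odot>\<^bsub>Mor B y x\<^esub> M p)"
  "Comp (matrix_category n B) z y x M N = (\<lambda>p\<in>{..<n} \<times> {..<n}.
    \<Oplus>\<^bsub>Mor B z x\<^esub>l\<in>{..<n}. Comp B z y x (M (fst p, l)) (N (l, snd p)))"
  "Ident (matrix_category n B) x =
    (\<lambda>p\<in>{..<n} \<times> {..<n}. if fst p = snd p then Ident B x else \<zero>\<^bsub>Mor B x x\<^esub>)"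
  by (simp_all add: matrix_category_def Let_def)

lemma matrix_eqI:
  assumes "M \<in> carrier (Mor (matrix_category n B) y x)" "N \<in> carrier (Mor (matrix_category n B) y x)"
    and "\<And>i j. \<lbrakk>i < n; j < n\<rbrakk> \<Longrightarrow> M (i, j) = N (i, j)"
  shows "M = N"
  using assms unfolding matrix_category_simps by (intro PiE_ext) auto

lemma matrix_apply:
  assumes "i < n" "j < n"
  shows "(M \<oplus>\<^bsub>Mor (matrix_category n B) y x\<^esub> N) (i, j) = M (i, j) \<oplus>\<^bsub>Mor B y x\<^esub> N (i, j)"
    and "(a \<odot>\<^bsub>Mor (matrix_category n B) y x\<^esub> M) (i, j) = a \<odot>\<^bsub>Mor B y x\<^esub> M (i, j)"
    and "\<zero>\<^bsub>Mor (matrix_category n B) y x\<^esub> (i, j) = \<zero>\<^bsub>Mor B y x\<^esub>"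
    and "Comp (matrix_category n B) z y x M N (i, j) =
      (\<Oplus>\<^bsub>Mor B z x\<^esub>l\<in>{..<n}. Comp B z y x (M (i, l)) (N (l, j)))"
    and "Ident (matrix_category n B) x (i, j) = (if i = j then Ident B x else \<zero>\<^bsub>Mor B x x\<^esub>)"
    and "M \<in> carrier (Mor (matrix_category n B) y x) \<Longrightarrow> M (i, j) \<in> carrier (Mor B y x)"
  using assms by (auto simp: matrix_category_simps)

lemma matrix_closedI:
  "(\<And>i j. \<lbrakk>i < n; j < n\<rbrakk> \<Longrightarrow> f (i, j) \<in> carrier (Mor B y x)) \<Longrightarrow>
    restrict f ({..<n} \<times> {..<n}) \<in> carrier (Mor (matrix_category n B) y x)"
  by (auto simp: matrix_category_simps)

section \<open>Matrices over a category form a category\<close>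

context k_category
begin

lemma matrix_module:
  assumes "x \<in> Obj C" "y \<in> Obj C"
  shows "module K (Mor (matrix_category n C) y x)"
proof -
  interpret V: module K "Mor C y x" by (intro Mor_module assms)
  let ?M = "Mor (matrix_category n C) y x"
  note app = matrix_apply(1-3,6)
  have closed: "\<lbrakk>M \<in> carrier ?M; N \<in> carrier ?M\<rbrakk> \<Longrightarrow> M \<oplus>\<^bsub>?M\<^esub> N \<in> carrier ?M"
    "\<lbrakk>a \<in> carrier K; M \<in> carrier ?M\<rbrakk> \<Longrightarrow> a \<odot>\<^bsub>?M\<^esub> M \<in> carrier ?M" for M N a
    unfolding matrix_category_simps(4,5) by (intro matrix_closedI; simp add: app)+
  have zero: "\<zero>\<^bsub>?M\<^esub> \<in> carrier ?M"
    unfolding matrix_category_simps(3) by (intro matrix_closedI) simp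
  have "abelian_group ?M"
  proof (rule abelian_groupI)
    fix M assume M: "M \<in> carrier ?M"
    let ?N = "restrict (\<lambda>p. \<ominus>\<^bsub>Mor C y x\<^esub> M p) ({..<n} \<times> {..<n})"
    have N: "?N \<in> carrier ?M" using M by (intro matrix_closedI) (simp add: app)
    have "?N \<oplus>\<^bsub>?M\<^esub> M = \<zero>\<^bsub>?M\<^esub>"
      using M N by (intro matrix_eqI[where n = n and B = C and y = y and x = x] closed zero) (simp_all add: app V.l_neg)
    with N show "\<exists>N\<in>carrier ?M. N \<oplus>\<^bsub>?M\<^esub> M = \<zero>\<^bsub>?M\<^esub>" by blast
  qed (auto simp: closed zero app V.a_ac intro!: matrix_eqI[where n = n and B = C and y = y and x = x])
  then show ?thesis
    by (rule moduleI[OF cring_axioms])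
      (auto simp: closed app V.smult_l_distr V.smult_r_distr V.smult_assoc1 intro!: matrix_eqI[where n = n and B = C and y = y and x = x])
qed

lemma Comp_closed:
  "\<lbrakk>x \<in> Obj C; y \<in> Obj C; z \<in> Obj C; g \<in> carrier (Mor C z y); f \<in> carrier (Mor C y x)\<rbrakk> \<Longrightarrow>
    Comp C z y x g f \<in> carrier (Mor C z x)"
  using bilinear_map_closed[OF Comp_bilinear] .

lemma matrix_Comp_closed:
  assumes "x \<in> Obj C" "y \<in> Obj C" "z \<in> Obj C"
    "M \<in> carrier (Mor (matrix_category n C) z y)" "N \<in> carrier (Mor (matrix_category n C) y x)"
  shows "Comp (matrix_category n C) z y x M N \<in> carrier (Mor (matrix_category n C) z x)"
proof -
  interpret zx: module K "Mor C z x" by (intro Mor_module assms)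
  show ?thesis
    unfolding matrix_category_simps(6) using assms
    by (intro matrix_closedI zx.finsum_closed) (auto simp: matrix_apply intro!: Comp_closed)
qed

text \<open>Each entry of a product is a finite sum of composites of linear maps in either argument,
  and matrices are added and scaled entrywise.\<close>

lemma matrix_Comp_bilinear:
  assumes obj: "x \<in> Obj C" "y \<in> Obj C" "z \<in> Obj C"
  shows "bilinear_map K (Mor (matrix_category n C) z y) (Mor (matrix_category n C) y x)
    (Mor (matrix_category n C) z x) (Comp (matrix_category n C) z y x)"
proof -
  interpret zx: module K "Mor C z x" by (intro Mor_module obj)
  interpret Mzx: module K "Mor (matrix_category n C) z x" by (intro matrix_module obj)
  interpret Mzy: module K "Mor (matrix_category n C) z y" by (intro matrix_module obj)
  interpret Myx: module K "Mor (matrix_category n C) y x" by (intro matrix_module obj)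
  let ?M = "\<lambda>y x. Mor (matrix_category n C) y x" and ?C = "Comp (matrix_category n C) z y x"
  note lin = bilinear_mapD[OF Comp_bilinear[OF obj]]
  have entry: "linear_map K (?M v u) (Mor C v u) (\<lambda>M. M (i, j))" if "i < n" "j < n" for u v i j
    using that by (intro linear_mapI) (simp_all add: matrix_apply)
  have L: "linear_map K (?M y x) (Mor C z x) (\<lambda>N. ?C M N (i, j))"
    if "M \<in> carrier (?M z y)" "i < n" "j < n" for M i j
    unfolding matrix_apply(4)[OF that(2,3)] using that
    by (intro zx.linear_map_finsumI linear_map_compose[OF entry lin(1)]) (auto simp: matrix_apply)
  have R: "linear_map K (?M z y) (Mor C z x) (\<lambda>M. ?C M N (i, j))"
    if "N \<in> carrier (?M y x)" "i < n" "j < n" for N i j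
    unfolding matrix_apply(4)[OF that(2,3)] using that
    by (intro zx.linear_map_finsumI linear_map_compose[OF entry lin(2)]) (auto simp: matrix_apply)
  show ?thesis
  proof (rule bilinear_mapI; rule linear_mapI)
    fix M N N' assume "M \<in> carrier (?M z y)" "N \<in> carrier (?M y x)" "N' \<in> carrier (?M y x)"
    then show "?C M (N \<oplus>\<^bsub>?M y x\<^esub> N') = ?C M N \<oplus>\<^bsub>?M z x\<^esub> ?C M N'"
      by (intro matrix_eqI[where n = n and B = C and y = z and x = x] Mzx.a_closed)
        (simp_all add: matrix_Comp_closed obj matrix_apply(1) linear_mapD[OF L])
  next
    fix M N a assume "M \<in> carrier (?M z y)" "a \<in> carrier K" "N \<in> carrier (?M y x)"
    then show "?C M (a \<odot>\<^bsub>?M y x\<^esub> N) = a \<odot>\<^bsub>?M z x\<^esub> ?C M N"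
      by (intro matrix_eqI[where n = n and B = C and y = z and x = x] Mzx.smult_closed)
        (simp_all add: matrix_Comp_closed obj matrix_apply(2) linear_mapD[OF L])
  next
    fix M N M' assume "N \<in> carrier (?M y x)" "M \<in> carrier (?M z y)" "M' \<in> carrier (?M z y)"
    then show "?C (M \<oplus>\<^bsub>?M z y\<^esub> M') N = ?C M N \<oplus>\<^bsub>?M z x\<^esub> ?C M' N"
      by (intro matrix_eqI[where n = n and B = C and y = z and x = x] Mzx.a_closed)
        (simp_all add: matrix_Comp_closed obj matrix_apply(1) linear_mapD[OF R])
  next
    fix M N a assume "N \<in> carrier (?M y x)" "a \<in> carrier K" "M \<in> carrier (?M z y)"
    then show "?C (a \<odot>\<^bsub>?M z y\<^esub> M) N = a \<odot>\<^bsub>?M z x\<^esub> ?C M N"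
      by (intro matrix_eqI[where n = n and B = C and y = z and x = x] Mzx.smult_closed)
        (simp_all add: matrix_Comp_closed obj matrix_apply(2) linear_mapD[OF R])
  qed (simp_all add: matrix_Comp_closed obj)
qed

text \<open>Composition distributes over sums, so both sides are double sums of triple composites,
  with the two summation indices in opposite order.\<close>

lemma matrix_Comp_assoc:
  assumes obj: "w \<in> Obj C" "x \<in> Obj C" "y \<in> Obj C" "z \<in> Obj C"
    and L: "L \<in> carrier (Mor (matrix_category n C) z y)"
    and M: "M \<in> carrier (Mor (matrix_category n C) y x)"
    and N: "N \<in> carrier (Mor (matrix_category n C) x w)"
  shows "Comp (matrix_category n C) z x w (Comp (matrix_category n C) z y x L M) N =
    Comp (matrix_category n C) z y w L (Comp (matrix_category n C) y x w M N)"
proof (rule matrix_eqI[where n = n and B = C and y = z and x = w])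
  fix i j assume ij: "i < n" "j < n"
  interpret zw: module K "Mor C z w" by (intro Mor_module obj)
  note lin = bilinear_mapD[OF Comp_bilinear]
  note [simp] = matrix_apply(6)[OF _ _ L] matrix_apply(6)[OF _ _ M] matrix_apply(6)[OF _ _ N]
  have "Comp (matrix_category n C) z x w (Comp (matrix_category n C) z y x L M) N (i, j) =
      (\<Oplus>\<^bsub>Mor C z w\<^esub>l\<in>{..<n}. Comp C z x w (\<Oplus>\<^bsub>Mor C z x\<^esub>k\<in>{..<n}. Comp C z y x (L (i, k)) (M (k, l))) (N (l, j)))"
    using ij obj Mor_module
    by (simp add: matrix_apply(4)) (intro zw.finsum_cong' ; auto intro!: Comp_closed abelian_monoid.finsum_closed
        module.axioms abelian_group.axioms simp: matrix_apply(4))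
  also have "\<dots> = (\<Oplus>\<^bsub>Mor C z w\<^esub>l\<in>{..<n}. \<Oplus>\<^bsub>Mor C z w\<^esub>k\<in>{..<n}. Comp C z x w (Comp C z y x (L (i, k)) (M (k, l))) (N (l, j)))"
    using ij obj
    by (intro zw.finsum_cong' linear_map_finsum[OF Mor_module Mor_module lin(2)])
      (auto intro!: Comp_closed zw.finsum_closed)
  also have "\<dots> = (\<Oplus>\<^bsub>Mor C z w\<^esub>k\<in>{..<n}. \<Oplus>\<^bsub>Mor C z w\<^esub>l\<in>{..<n}. Comp C z x w (Comp C z y x (L (i, k)) (M (k, l))) (N (l, j)))"
    using ij obj by (intro zw.finsum_swap) (auto intro!: Comp_closed)
  also have "\<dots> = (\<Oplus>\<^bsub>Mor C z w\<^esub>k\<in>{..<n}. \<Oplus>\<^bsub>Mor C z w\<^esub>l\<in>{..<n}. Comp C z y w (L (i, k)) (Comp C y x w (M (k, l)) (N (l, j))))"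
    using ij obj by (intro zw.finsum_cong' Comp_assoc) (auto intro!: Comp_closed zw.finsum_closed)
  also have "\<dots> = (\<Oplus>\<^bsub>Mor C z w\<^esub>k\<in>{..<n}. Comp C z y w (L (i, k)) (\<Oplus>\<^bsub>Mor C y w\<^esub>l\<in>{..<n}. Comp C y x w (M (k, l)) (N (l, j))))"
    using ij obj
    by (intro zw.finsum_cong' linear_map_finsum[OF Mor_module Mor_module lin(1), symmetric])
      (auto intro!: Comp_closed abelian_monoid.finsum_closed Mor_module module.axioms abelian_group.axioms)
  also have "\<dots> = Comp (matrix_category n C) z y w L (Comp (matrix_category n C) y x w M N) (i, j)"
    using ij obj Mor_module
    by (simp add: matrix_apply(4)) (intro zw.finsum_cong' ; auto intro!: Comp_closed abelian_monoid.finsum_closed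
        module.axioms abelian_group.axioms simp: matrix_apply(4))
  finally show "Comp (matrix_category n C) z x w (Comp (matrix_category n C) z y x L M) N (i, j) =
    Comp (matrix_category n C) z y w L (Comp (matrix_category n C) y x w M N) (i, j)" .
qed (intro matrix_Comp_closed obj L M N)+

lemma matrix_k_category: "k_category K (matrix_category n C)"
proof (intro k_category.intro k_category_axioms.intro field_axioms; (simp only: matrix_category_simps(1))?)
  have Ident_closed_M: "Ident (matrix_category n C) x \<in> carrier (Mor (matrix_category n C) x x)"
    if "x \<in> Obj C" for x
  proof -
    interpret module K "Mor C x x" by (intro Mor_module that)
    show ?thesis
      unfolding matrix_category_simps(7) by (intro matrix_closedI) (simp add: Ident_closed that)
  qed
  then show "Ident (matrix_category n C) x \<in> carrier (Mor (matrix_category n C) x x)"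
    if "x \<in> Obj C" for x using that .
  fix x y M assume xy: "x \<in> Obj C" "y \<in> Obj C" and M: "M \<in> carrier (Mor (matrix_category n C) y x)"
  interpret yx: module K "Mor C y x" by (intro Mor_module xy)
  have zero: "Comp C y y x \<zero>\<^bsub>Mor C y y\<^esub> f = \<zero>\<^bsub>Mor C y x\<^esub>" "Comp C y x x f \<zero>\<^bsub>Mor C x x\<^esub> = \<zero>\<^bsub>Mor C y x\<^esub>"
    if "f \<in> carrier (Mor C y x)" for f
    using linear_map_zero[OF _ _ bilinear_mapD(2)[OF Comp_bilinear[OF xy(1,2,2)] that]]
      linear_map_zero[OF _ _ bilinear_mapD(1)[OF Comp_bilinear[OF xy(1,1,2)] that]] Mor_module xy by auto
  note [simp] = matrix_apply(6)[OF _ _ M]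
  show "Comp (matrix_category n C) y y x (Ident (matrix_category n C) y) M = M"
  proof (rule matrix_eqI[where n = n and B = C and y = y and x = x])
    fix i j assume ij: "i < n" "j < n"
    have "Comp (matrix_category n C) y y x (Ident (matrix_category n C) y) M (i, j) =
        Comp C y y x (Ident (matrix_category n C) y (i, i)) (M (i, j))"
      unfolding matrix_apply(4)[OF ij] using ij xy
      by (intro yx.finsum_eq_single) (auto simp: matrix_apply(5) zero Ident_left)
    then show "Comp (matrix_category n C) y y x (Ident (matrix_category n C) y) M (i, j) = M (i, j)"
      using ij xy by (simp add: matrix_apply(5) Ident_left)
  qed (intro matrix_Comp_closed Ident_closed_M xy M)+
  show "Comp (matrix_category n C) y x x M (Ident (matrix_category n C) x) = M"
  proof (rule matrix_eqI[where n = n and B = C and y = y and x = x])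
    fix i j assume ij: "i < n" "j < n"
    have "Comp (matrix_category n C) y x x M (Ident (matrix_category n C) x) (i, j) =
        Comp C y x x (M (i, j)) (Ident (matrix_category n C) x (j, j))"
      unfolding matrix_apply(4)[OF ij] using ij xy
      by (intro yx.finsum_eq_single) (auto simp: matrix_apply(5) zero Ident_right)
    then show "Comp (matrix_category n C) y x x M (Ident (matrix_category n C) x) (i, j) = M (i, j)"
      using ij xy by (simp add: matrix_apply(5) Ident_right)
  qed (intro matrix_Comp_closed Ident_closed_M xy M)+
qed (auto intro: matrix_module matrix_Comp_bilinear matrix_Comp_assoc)

end

section \<open>The isomorphism with the matrix category\<close>

context finite_grading
begin

text \<open>The entries computed so far have rows and columns labelled by group elements; the
  enumeration \<open>e\<close> relabels them by numbers. Any enumeration serves, as the same one is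
  used for rows and columns.\<close>

lemma smash_smash_isomorphic_matrix:
  assumes e: "bij_betw e {..<n} (carrier G)"
  shows "isomorphic_k_categories K X (matrix_category n B)"
proof -
  let ?M = "matrix_category n B"
  define F where "F y x t = (\<lambda>p\<in>{..<n} \<times> {..<n}. entry y x (e (fst p)) (e (snd p)) t)" for y x t
  have eG: "e i \<in> carrier G" if "i < n" for i using bij_betwE[OF e] that by auto
  have F_apply: "F y x t (i, j) = entry y x (e i) (e j) t" if "i < n" "j < n" for y x t i j
    using that by (simp add: F_def)
  have F_closed: "F y x t \<in> carrier (Mor ?M y x)"
    if "x \<in> Obj B" "y \<in> Obj B" "t \<in> carrier (Mor X y x)" for x y t
    unfolding F_def using that
    by (intro matrix_closedI) (simp add: linear_mapD(1)[OF entry_linear] eG)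
  \<comment> \<open>Needed to recover the entry at group elements from the numbered matrix, both for
    injectivity and to read a given matrix as one indexed by the group.\<close>
  define e' where "e' = inv_into {..<n} e"
  have e': "e' p < n" "e (e' p) = p" if "p \<in> carrier G" for p
    using e that inv_into_into[of p e "{..<n}"] by (auto simp: e'_def bij_betw_def f_inv_into_f)
  show ?thesis
  proof (rule isomorphic_k_categoriesI[where F = F]; (simp only: matrix_category_simps(1))?)
    show "k_category K ?M" by (rule B.matrix_k_category)
    show "Obj X = Obj B" by (rule X_simps)
    fix x y assume xy: "x \<in> Obj B" "y \<in> Obj B"
    interpret X: module K "Mor X y x" by (intro X_module xy)
    interpret M: module K "Mor ?M y x" by (intro B.matrix_module xy)
    show "module K (Mor X y x)" by (intro X_module xy)
    note lin = linear_mapD[OF entry_linear[OF xy]]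
    show "linear_map K (Mor X y x) (Mor ?M y x) (F y x)"
      by (intro linear_mapI matrix_eqI[where n = n and B = B and y = y and x = x] M.a_closed M.smult_closed F_closed xy X.a_closed X.smult_closed;
          simp add: F_apply matrix_apply(1,2) lin eG)
    show "bij_betw (F y x) (carrier (Mor X y x)) (carrier (Mor ?M y x))"
    proof (rule bij_betw_imageI)
      show "inj_on (F y x) (carrier (Mor X y x))"
      proof (rule inj_onI)
        fix t t' assume t: "t \<in> carrier (Mor X y x)" "t' \<in> carrier (Mor X y x)" and eq: "F y x t = F y x t'"
        have "entry y x p q t = entry y x p q t'" if "p \<in> carrier G" "q \<in> carrier G" for p q
          using fun_cong[OF eq, of "(e' p, e' q)"] that by (simp add: F_apply e')
        then show "t = t'" using entry_inj[OF xy t] by blast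
      qed
      show "F y x ` carrier (Mor X y x) = carrier (Mor ?M y x)"
      proof (intro subset_antisym subsetI)
        fix N assume N: "N \<in> carrier (Mor ?M y x)"
        from entry_surj[OF xy, of "\<lambda>p q. N (e' p, e' q)"] obtain t
          where t: "t \<in> carrier (Mor X y x)"
            "\<And>p q. \<lbrakk>p \<in> carrier G; q \<in> carrier G\<rbrakk> \<Longrightarrow> entry y x p q t = N (e' p, e' q)"
          using matrix_apply(6)[OF _ _ N] by (auto simp: e')
        have "e' (e i) = i" if "i < n" for i
          using e that by (auto simp: e'_def bij_betw_def inv_into_f_f)
        then have "F y x t = N"
          using t N by (intro matrix_eqI[where n = n and B = B and y = y and x = x] F_closed xy) (simp_all add: F_apply eG)
        then show "N \<in> F y x ` carrier (Mor X y x)" using t by blast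
      qed (auto intro: F_closed xy)
    qed
  next
    fix x y z g f assume obj: "x \<in> Obj B" "y \<in> Obj B" "z \<in> Obj B"
      and g: "g \<in> carrier (Mor X z y)" and f: "f \<in> carrier (Mor X y x)"
    show closed: "Comp X z y x g f \<in> carrier (Mor X z x)"
      using bilinear_map_closed[OF X_Comp_bilinear[OF obj] g f] .
    interpret zx: module K "Mor B z x" by (intro B.Mor_module obj)
    show "F z x (Comp X z y x g f) = Comp ?M z y x (F z y g) (F y x f)"
    proof (rule matrix_eqI[where n = n and B = B and y = z and x = x])
      fix i j assume ij: "i < n" "j < n"
      let ?h = "\<lambda>r. Comp B z y x (entry z y (e i) r g) (entry y x r (e j) f)"
      have h: "?h r \<in> carrier (Mor B z x)" if "r \<in> carrier G" for r
        using that ij obj f g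
        by (intro B.Comp_closed) (auto intro!: linear_mapD(1)[OF entry_linear] eG)
      have "F z x (Comp X z y x g f) (i, j) = (\<Oplus>\<^bsub>Mor B z x\<^esub>r\<in>carrier G. ?h r)"
        using ij obj f g by (simp add: F_apply entry_Comp eG)
      \<comment> \<open>Relabelling the middle index along \<open>e\<close> turns the sum over the
        group into the sum of the numbered matrix product.\<close>
      also have "carrier G = e ` {..<n}" using e by (simp add: bij_betw_def)
      also have "(\<Oplus>\<^bsub>Mor B z x\<^esub>r\<in>e ` {..<n}. ?h r) = (\<Oplus>\<^bsub>Mor B z x\<^esub>l\<in>{..<n}. ?h (e l))"
        using e h eG by (intro zx.finsum_reindex) (auto simp: bij_betw_def)
      also have "\<dots> = Comp ?M z y x (F z y g) (F y x f) (i, j)"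
        unfolding matrix_apply(4)[OF ij] using ij h eG
        by (intro zx.finsum_cong') (auto simp: F_apply)
      finally show "F z x (Comp X z y x g f) (i, j) = Comp ?M z y x (F z y g) (F y x f) (i, j)" .
    qed (intro F_closed B.matrix_Comp_closed obj closed f g)+
  next
    fix x assume x: "x \<in> Obj B"
    have one: "\<one>\<^bsub>A\<^esub> \<in> carrier A" "\<one>\<^bsub>D\<^esub> \<in> carrier D"
      by (simp_all add: function_hopf_mult[OF K_field G_group finite_G] A.restrict_closed
          group_hopf_mult[OF K_field G_group finite_G] D.delta_closed)
    interpret S: function_tensor K G D "Mor S x x" by (intro S_tensor x)
    interpret B': function_tensor K G A "Mor B x x" by (intro Mor_tensor x)
    show closed: "Ident X x \<in> carrier (Mor X x x)"
      unfolding X_simps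
      by (intro S.pure_tensor_closed one)
        (simp only: S_simps, intro B'.pure_tensor_closed one B.Ident_closed x)
    \<comment> \<open>Injectivity of \<open>e\<close> makes the diagonal of group labels the
      diagonal of numbers.\<close>
    have "inj_on e {..<n}" using e by (simp add: bij_betw_def)
    then have e_eq: "e i = e j \<longleftrightarrow> i = j" if "i < n" "j < n" for i j
      using that by (auto dest: inj_onD)
    show "F x x (Ident X x) = Ident ?M x"
      using k_category.Ident_closed[OF B.matrix_k_category] x
      by (intro matrix_eqI[where n = n and B = B and y = x and x = x] F_closed closed x)
        (simp_all add: F_apply matrix_apply(5) entry_Ident eG e_eq matrix_category_simps(1))
  qed
qed

end

theorem lemma4p3:
  fixes K :: "('k, 'r) ring_scheme" and G :: "('g, 's) monoid_scheme" and n :: nat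
    and B :: "('o, 'k, 'm) kcat" and E :: "'o \<Rightarrow> 'o \<Rightarrow> 'g \<Rightarrow> 'm set"
  assumes "field K"
    and "group G" and "finite (carrier G)" and "order G = n"
    and "graded_k_category K G B E"
  shows "isomorphic_k_categories K
    (smash K (group_hopf K G) (graded_smash K G B E) (translation_action K G B))
    (matrix_category n B)"
proof -
  interpret finite_grading K G B E
    using assms by (intro finite_grading.intro finite_grading_axioms.intro)
  obtain e where "bij_betw e {..<n} (carrier G)"
    using ex_bij_betw_nat_finite[OF assms(3)] assms(4) by (auto simp: order_def atLeast0LessThan)
  then show ?thesis by (rule smash_smash_isomorphic_matrix)
qed

end
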